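(* Let $k,l\ge 1$ be fixed. For each $N\ge1$, let $(W_1,\ldots,W_k)$ be a $k$-tuple of independent $\mathrm{GUE}(N,\sigma_N^2)$ matrices, with $\sigma_N^2=O(N^{-1})$, and let $(A_1,\ldots,A_l)$ be an $l$-tuple of deterministic $N\times N$ complex matrices (depending on $N$) with $*$-distribution $\nu_N$ in the noncommutative probability space $(\mathcal{M}_N(\mathbb{C})\otimes L^{\infty-},\ \mathbb{E}N^{-1}\mathrm{Tr})$. Assume that $\sup_{N\ge1}\|A_i\|<+\infty$ for $1\le i\le l$. Then the $*$-distribution $\xi_N$ of the $(k+l)$-tuple $(W_1,\ldots,W_k,A_1,\ldots,A_l)$ satisfies: for every noncommutative polynomial $P\in\mathbb{C}\langle X_1,\ldots,X_{k+l}\rangle$, $$\xi_N(P)=\big(\mu_{N\sigma_N^2}^{\star k}\star\nu_N\big)(P)+O(N^{-2})\qquad (N\to+\infty).$$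
   Context: $L^{\infty-}$ is the algebra of complex random variables with finite moments of all orders; $\mathcal{M}_N(\mathbb{C})\otimes L^{\infty-}$ is the algebra of $N\times N$ random matrices with entries in $L^{\infty-}$, with state $M\mapsto \mathbb{E}[N^{-1}\mathrm{Tr}(M)]$. A $\mathrm{GUE}(N,\sigma_N^2)$ matrix is a Hermitian random matrix whose entries on and above the diagonal are independent centred Gaussian: real of variance $\sigma_N^2$ on the diagonal, and complex off the diagonal with $\mathbb{E}[|W_{ij}|^2]=\sigma_N^2$, $\mathbb{E}[W_{ij}^2]=0$. $\|\cdot\|$ is the operator norm. So $\xi_N(P)=\mathbb{E}[N^{-1}\mathrm{Tr}\,P(W_1,\ldots,W_k,A_1,\ldots,A_l)]$. $\mu_v$ denotes the centred semicircular distribution of variance $v$, and $\mu_{N\sigma_N^2}^{\star k}\star\nu_N$ denotes the free product: $(\mu_{N\sigma_N^2}^{\star k}\star\nu_N)(P)=\varphi(P(w_1,\ldots,w_k,a_1,\ldots,a_l))$ where, in a noncommutative probability space $(\mathcal{A},\varphi)$, $w_1,\ldots,w_k$ are free semicircular elements (centred) of variance $N\sigma_N^2$, $(a_1,\ldots,a_l)$ has $*$-distribution $\nu_N$ (that of $(A_1,\ldots,A_l)$ with respect to $N^{-1}\mathrm{Tr}$), and $\{a_1,\ldots,a_l\}$ is $*$-free from $\{w_1,\ldots,w_k\}$. The constant in $O(N^{-2})$ may depend on $P$ but not on $N$. *)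

theory Defs
  imports
    "HOL-Probability.Probability"
    "HOL-Library.Poly_Mapping"
    "HOL-Library.Landau_Symbols"
    "Jordan_Normal_Form.VS_Connect"
    "Jordan_Normal_Form.Schur_Decomposition"
begin

section \<open>Noncommutative probability spaces\<close>

record 'a nc_space = "(complex, 'a) module" +
  star :: "'a \<Rightarrow> 'a"
  state :: "'a \<Rightarrow> complex"

locale nc_prob_space = ring S + Module.module "class_ring :: complex ring" S
  for S :: "'a nc_space" (structure) +
  assumes smult_mult_left:
      "\<lbrakk>x \<in> carrier S; y \<in> carrier S\<rbrakk> \<Longrightarrow> (c \<odot> x) \<otimes> y = c \<odot> (x \<otimes> y)"
    and smult_mult_right:
      "\<lbrakk>x \<in> carrier S; y \<in> carrier S\<rbrakk> \<Longrightarrow> x \<otimes> (c \<odot> y) = c \<odot> (x \<otimes> y)"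
    and star_closed: "x \<in> carrier S \<Longrightarrow> star S x \<in> carrier S"
    and star_star: "x \<in> carrier S \<Longrightarrow> star S (star S x) = x"
    and star_add:
      "\<lbrakk>x \<in> carrier S; y \<in> carrier S\<rbrakk> \<Longrightarrow> star S (x \<oplus> y) = star S x \<oplus> star S y"
    and star_smult: "x \<in> carrier S \<Longrightarrow> star S (c \<odot> x) = cnj c \<odot> star S x"
    and star_mult:
      "\<lbrakk>x \<in> carrier S; y \<in> carrier S\<rbrakk> \<Longrightarrow> star S (x \<otimes> y) = star S y \<otimes> star S x"
    and state_add:
      "\<lbrakk>x \<in> carrier S; y \<in> carrier S\<rbrakk> \<Longrightarrow> state S (x \<oplus> y) = state S x + state S y"
    and state_smult: "x \<in> carrier S \<Longrightarrow> state S (c \<odot> x) = c * state S x"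
    and state_one: "state S \<one> = 1"
    and state_pos:
      "x \<in> carrier S \<Longrightarrow> \<exists>r\<ge>0. state S (star S x \<otimes> x) = complex_of_real r"

section \<open>Noncommutative polynomials and distributions\<close>

text \<open>A noncommutative polynomial is a finitely supported family of complex coefficients indexed
  by the words over its set of letters.\<close>

type_synonym 'x ncpoly = "'x list \<Rightarrow>\<^sub>0 complex"

definition ncpolys :: "'x set \<Rightarrow> 'x ncpoly set" where
  "ncpolys V = {P. Poly_Mapping.keys P \<subseteq> lists V}"

definition word_eval :: "('a, 'm) monoid_scheme \<Rightarrow> ('x \<Rightarrow> 'a) \<Rightarrow> 'x list \<Rightarrow> 'a" where
  "word_eval S x u = foldr (\<lambda>i y. x i \<otimes>\<^bsub>S\<^esub> y) u \<one>\<^bsub>S\<^esub>"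

definition nc_eval :: "'a nc_space \<Rightarrow> ('x \<Rightarrow> 'a) \<Rightarrow> 'x ncpoly \<Rightarrow> 'a" where
  "nc_eval S x P =
     (\<Oplus>\<^bsub>S\<^esub>u \<in> Poly_Mapping.keys P. Poly_Mapping.lookup P u \<odot>\<^bsub>S\<^esub> word_eval S x u)"

definition nc_law :: "'a nc_space \<Rightarrow> ('x \<Rightarrow> 'a) \<Rightarrow> 'x ncpoly \<Rightarrow> complex" where
  "nc_law S x P = state S (nc_eval S x P)"

text \<open>For \<open>*\<close>-distributions the letters are pairs: \<open>(i, False)\<close> stands for the \<open>i\<close>-th variable and
  \<open>(i, True)\<close> for its adjoint.\<close>

definition star_law :: "'a nc_space \<Rightarrow> ('i \<Rightarrow> 'a) \<Rightarrow> ('i \<times> bool) ncpoly \<Rightarrow> complex" where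
  "star_law S x Q = nc_law S (\<lambda>(i, b). if b then star S (x i) else x i) Q"

section \<open>Freeness and semicircular elements\<close>

inductive_set star_alg_gen :: "'a nc_space \<Rightarrow> 'a set \<Rightarrow> 'a set"
  for S :: "'a nc_space" (structure) and X :: "'a set" where
  gen: "x \<in> X \<Longrightarrow> x \<in> star_alg_gen S X"
| one: "\<one> \<in> star_alg_gen S X"
| add: "\<lbrakk>x \<in> star_alg_gen S X; y \<in> star_alg_gen S X\<rbrakk> \<Longrightarrow> x \<oplus> y \<in> star_alg_gen S X"
| mult: "\<lbrakk>x \<in> star_alg_gen S X; y \<in> star_alg_gen S X\<rbrakk> \<Longrightarrow> x \<otimes> y \<in> star_alg_gen S X"
| smult: "x \<in> star_alg_gen S X \<Longrightarrow> c \<odot> x \<in> star_alg_gen S X"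
| star: "x \<in> star_alg_gen S X \<Longrightarrow> star S x \<in> star_alg_gen S X"

text \<open>In \<open>free_subalgs\<close> a product of centred elements of the subalgebras is encoded as the list of
  its factors, each paired with the index of its subalgebra; neighbouring indices differ.\<close>

definition free_subalgs :: "'a nc_space \<Rightarrow> 'i set \<Rightarrow> ('i \<Rightarrow> 'a set) \<Rightarrow> bool" where
  "free_subalgs S I B \<longleftrightarrow>
     (\<forall>xs. xs \<noteq> [] \<and> (\<forall>(i, b) \<in> set xs. i \<in> I \<and> b \<in> B i \<and> state S b = 0) \<and>
           distinct_adj (map fst xs) \<longrightarrow> state S (word_eval S snd xs) = 0)"

definition star_free :: "'a nc_space \<Rightarrow> 'i set \<Rightarrow> ('i \<Rightarrow> 'a set) \<Rightarrow> bool" where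
  "star_free S I X \<longleftrightarrow>
     (\<forall>i\<in>I. X i \<subseteq> carrier S) \<and> free_subalgs S I (\<lambda>i. star_alg_gen S (X i))"

definition semicircle_measure :: "real \<Rightarrow> real measure" where
  "semicircle_measure v =
     (if v = 0 then return borel 0
      else density lborel (\<lambda>x. ennreal (sqrt (max 0 (4 * v - x\<^sup>2)) / (2 * pi * v))))"

definition semicircular :: "'a nc_space \<Rightarrow> real \<Rightarrow> 'a \<Rightarrow> bool" where
  "semicircular S v x \<longleftrightarrow>
     x \<in> carrier S \<and> star S x = x \<and>
     (\<forall>n::nat. state S (x [^]\<^bsub>S\<^esub> n) = complex_of_real (\<integral>t. t ^ n \<partial>semicircle_measure v))"

text \<open>The tuples \<open>w\<^sub>0, \<dots>, w\<^bsub>k-1\<^esub>\<close> and \<open>a\<^sub>0, \<dots>, a\<^bsub>l-1\<^esub>\<close> realise the free product of \<open>k\<close> copies of the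
  semicircular distribution of variance \<open>v\<close> with the \<open>*\<close>-distribution \<open>\<nu>\<close>.\<close>

definition free_product_model ::
  "nat \<Rightarrow> nat \<Rightarrow> real \<Rightarrow> ((nat \<times> bool) ncpoly \<Rightarrow> complex) \<Rightarrow>
   'a nc_space \<Rightarrow> (nat \<Rightarrow> 'a) \<Rightarrow> (nat \<Rightarrow> 'a) \<Rightarrow> bool" where
  "free_product_model k l v \<nu> S w a \<longleftrightarrow>
     nc_prob_space S \<and>
     (\<forall>i<k. semicircular S v (w i)) \<and>
     star_free S {..<k} (\<lambda>i. {w i}) \<and>
     (\<forall>j<l. a j \<in> carrier S) \<and>
     (\<forall>Q \<in> ncpolys ({..<l} \<times> UNIV). star_law S a Q = \<nu> Q) \<and>
     star_free S UNIV (\<lambda>b. if b then a ` {..<l} else w ` {..<k})"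

definition append_tuple :: "nat \<Rightarrow> (nat \<Rightarrow> 'b) \<Rightarrow> (nat \<Rightarrow> 'b) \<Rightarrow> nat \<Rightarrow> 'b" where
  "append_tuple k x y i = (if i < k then x i else y (i - k))"

section \<open>Matrices and random matrices\<close>

definition mat_space :: "nat \<Rightarrow> complex mat nc_space" where
  "mat_space N =
     \<lparr>carrier = carrier_mat N N, mult = (*), one = 1\<^sub>m N, zero = 0\<^sub>m N N, add = (+),
      smult = (\<cdot>\<^sub>m), star = mat_adjoint, state = (\<lambda>X. (\<Sum>i<N. X $$ (i, i)) / of_nat N)\<rparr>"

definition vec_norm2 :: "complex vec \<Rightarrow> real" where
  "vec_norm2 v = L2_set (\<lambda>i. cmod (vec_index v i)) {..<dim_vec v}"

definition op_norm :: "complex mat \<Rightarrow> real" where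
  "op_norm X = (SUP v \<in> {v \<in> carrier_vec (dim_col X). vec_norm2 v \<le> 1}. vec_norm2 (X *\<^sub>v v))"

definition rand_law ::
  "'w measure \<Rightarrow> nat \<Rightarrow> ('x \<Rightarrow> 'w \<Rightarrow> complex mat) \<Rightarrow> 'x ncpoly \<Rightarrow> complex" where
  "rand_law M N X P = (\<integral>\<omega>. nc_law (mat_space N) (\<lambda>i. X i \<omega>) P \<partial>M)"

definition rand_star_law ::
  "'w measure \<Rightarrow> nat \<Rightarrow> ('i \<Rightarrow> 'w \<Rightarrow> complex mat) \<Rightarrow> ('i \<times> bool) ncpoly \<Rightarrow> complex" where
  "rand_star_law M N X Q = (\<integral>\<omega>. star_law (mat_space N) (\<lambda>i. X i \<omega>) Q \<partial>M)"

definition gaussian_measure :: "real \<Rightarrow> real measure" where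
  "gaussian_measure v =
     (if v = 0 then return borel 0
      else density lborel (\<lambda>x. ennreal (normal_density 0 (sqrt v) x)))"

definition centred_gaussian :: "'w measure \<Rightarrow> real \<Rightarrow> ('w \<Rightarrow> real) \<Rightarrow> bool" where
  "centred_gaussian M v X \<longleftrightarrow>
     X \<in> borel_measurable M \<and> distr M borel X = gaussian_measure v"

text \<open>A complex random variable is centred Gaussian if its real and imaginary parts form a centred
  Gaussian vector, i.e. all their real linear combinations are centred Gaussian.\<close>

definition centred_complex_gaussian :: "'w measure \<Rightarrow> ('w \<Rightarrow> complex) \<Rightarrow> bool" where
  "centred_complex_gaussian M Z \<longleftrightarrow>
     Z \<in> borel_measurable M \<and>
     (\<forall>s t. \<exists>v\<ge>0. centred_gaussian M v (\<lambda>\<omega>. s * Re (Z \<omega>) + t * Im (Z \<omega>)))"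

definition GUE :: "'w measure \<Rightarrow> nat \<Rightarrow> real \<Rightarrow> ('w \<Rightarrow> complex mat) \<Rightarrow> bool" where
  "GUE M N v W \<longleftrightarrow>
     (\<forall>\<omega>\<in>space M. W \<omega> \<in> carrier_mat N N \<and> mat_adjoint (W \<omega>) = W \<omega>) \<and>
     prob_space.indep_vars M (\<lambda>_. borel) (\<lambda>p \<omega>. W \<omega> $$ p) {(i, j). i \<le> j \<and> j < N} \<and>
     (\<forall>i<N. centred_gaussian M v (\<lambda>\<omega>. Re (W \<omega> $$ (i, i)))) \<and>
     (\<forall>j<N. \<forall>i<j. centred_complex_gaussian M (\<lambda>\<omega>. W \<omega> $$ (i, j)) \<and>
        (\<integral>\<omega>. (cmod (W \<omega> $$ (i, j)))\<^sup>2 \<partial>M) = v \<and>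
        (\<integral>\<omega>. (W \<omega> $$ (i, j))\<^sup>2 \<partial>M) = 0)"

text \<open>Independence of random matrices is independence of the random families of their entries.\<close>

definition indep_mats ::
  "'w measure \<Rightarrow> nat \<Rightarrow> (nat \<Rightarrow> 'w \<Rightarrow> complex mat) \<Rightarrow> nat set \<Rightarrow> bool" where
  "indep_mats M N W I \<longleftrightarrow>
     prob_space.indep_vars M (\<lambda>_. Pi\<^sub>M ({..<N} \<times> {..<N}) (\<lambda>_. borel))
       (\<lambda>r \<omega>. \<lambda>p \<in> {..<N} \<times> {..<N}. W r \<omega> $$ p) I"

lemma mat_adjoint_carrier: "X \<in> carrier_mat N N \<Longrightarrow> mat_adjoint X \<in> carrier_mat N N"
  by (auto simp: mat_adjoint_def)

lemma mat_adjoint_index: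
  fixes X :: "complex mat"
  assumes "X \<in> carrier_mat N N" "i < N" "j < N"
  shows "mat_adjoint X $$ (i, j) = cnj (X $$ (j, i))"
  using assms by (auto simp: mat_adjoint_def mat_of_rows_index conjugate_complex_def)

lemma mat_adjoint_eqI:
  fixes X Y :: "complex mat"
  assumes "X \<in> carrier_mat N N" "Y \<in> carrier_mat N N"
    and "\<And>i j. i < N \<Longrightarrow> j < N \<Longrightarrow> cnj (X $$ (j, i)) = Y $$ (i, j)"
  shows "mat_adjoint X = Y"
  by (rule eq_matI) (use assms mat_adjoint_carrier[OF assms(1)] in \<open>auto simp: mat_adjoint_index\<close>)

lemma ring_mat_space: "ring (mat_space N)"
  by (unfold_locales, insert add_inv_exists_mat,
      auto simp: mat_space_def algebra_simps Units_def)

lemma module_mat_space: "Module.module (class_ring :: complex ring) (mat_space N)"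
proof -
  interpret ring "mat_space N" by (rule ring_mat_space)
  show ?thesis
    by unfold_locales
      (auto simp: mat_space_def add_smult_distrib_left_mat add_smult_distrib_right_mat)
qed

lemma nc_prob_space_mat_space:
  assumes N: "N \<ge> 1"
  shows "nc_prob_space (mat_space N)"
proof -
  have tr: "(mat_adjoint X * X) $$ (i, i) = complex_of_real (\<Sum>j<N. (cmod (X $$ (j, i)))\<^sup>2)"
    if X: "X \<in> carrier_mat N N" and i: "i < N" for X i
  proof -
    have "(mat_adjoint X * X) $$ (i, i) = (\<Sum>j<N. mat_adjoint X $$ (i, j) * X $$ (j, i))"
      using X mat_adjoint_carrier[OF X] i
      by (auto simp: scalar_prod_def atLeast0LessThan intro!: sum.cong)
    also have "\<dots> = (\<Sum>j<N. complex_of_real ((cmod (X $$ (j, i)))\<^sup>2))"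
      using X i by (intro sum.cong refl)
        (simp add: mat_adjoint_index complex_norm_square mult.commute del: of_real_power)
    finally show ?thesis by simp
  qed
  have pos: "\<exists>r\<ge>0. (\<Sum>i<N. (mat_adjoint X * X) $$ (i, i)) / of_nat N = complex_of_real r"
    if X: "X \<in> carrier_mat N N" for X
  proof (intro exI conjI)
    show "0 \<le> (\<Sum>i<N. \<Sum>j<N. (cmod (X $$ (j, i)))\<^sup>2) / real N"
      by (intro divide_nonneg_nonneg sum_nonneg) auto
    show "(\<Sum>i<N. (mat_adjoint X * X) $$ (i, i)) / of_nat N =
      complex_of_real ((\<Sum>i<N. \<Sum>j<N. (cmod (X $$ (j, i)))\<^sup>2) / real N)"
      using X by (simp add: tr)
  qed
  have mult: "mat_adjoint (X * Y) = mat_adjoint Y * mat_adjoint X"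
    if X: "X \<in> carrier_mat N N" and Y: "Y \<in> carrier_mat N N" for X Y :: "complex mat"
    by (rule mat_adjoint_eqI[where N = N])
      (use X Y mat_adjoint_carrier[OF X] mat_adjoint_carrier[OF Y] in
        \<open>auto simp: scalar_prod_def mat_adjoint_index mult.commute intro!: sum.cong\<close>)
  show ?thesis
    unfolding nc_prob_space_def
  proof (intro conjI ring_mat_space module_mat_space, unfold_locales)
    fix X Y :: "complex mat" and c :: complex
    show "X \<in> carrier (mat_space N) \<Longrightarrow> star (mat_space N) X \<in> carrier (mat_space N)"
      by (simp add: mat_space_def mat_adjoint_carrier)
    show "X \<in> carrier (mat_space N) \<Longrightarrow> star (mat_space N) (star (mat_space N) X) = X"
      by (auto simp: mat_space_def mat_adjoint_index mat_adjoint_carrier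
          intro!: mat_adjoint_eqI[where N = N])
    show "X \<in> carrier (mat_space N) \<Longrightarrow> Y \<in> carrier (mat_space N) \<Longrightarrow>
      star (mat_space N) (X \<oplus>\<^bsub>mat_space N\<^esub> Y) =
      star (mat_space N) X \<oplus>\<^bsub>mat_space N\<^esub> star (mat_space N) Y"
      using mat_adjoint_carrier[of X N] mat_adjoint_carrier[of Y N]
      by (auto simp: mat_space_def mat_adjoint_index intro!: mat_adjoint_eqI[where N = N])
    show "X \<in> carrier (mat_space N) \<Longrightarrow>
      star (mat_space N) (c \<odot>\<^bsub>mat_space N\<^esub> X) = cnj c \<odot>\<^bsub>mat_space N\<^esub> star (mat_space N) X"
      using mat_adjoint_carrier[of X N]
      by (auto simp: mat_space_def mat_adjoint_index intro!: mat_adjoint_eqI[where N = N])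
  qed (use N in \<open>auto simp: mat_space_def mult pos add_divide_distrib sum.distrib
      sum_distrib_left\<close>)
qed

end

theory Submission
  imports Defs
begin

text \<open>Write \<open>v = N \<sigma>\<^sup>2\<close>, let \<open>\<phi>\<close> be the state of the free product model on words, and let \<open>tr\<close> be the
  normalised trace. The random matrices and the free model obey the same recursion, up to an error of
  relative order \<open>N\<^sup>-\<^sup>2\<close>. If the word \<open>\<alpha>\<close> contains deterministic letters only and \<open>i\<close> is a semicircular
  letter, then freeness gives the Schwinger-Dyson equation (\<open>schwinger_dyson_model\<close>)

    \<open>\<phi>(\<alpha> i u) = v \<Sum> \<phi>(p) \<phi>(\<alpha> q)\<close>, summed over all splittings \<open>u = p i q\<close>.

  For the random matrices, Gaussian integration by parts in the entries of the \<open>i\<close>-th matrix gives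
  (\<open>schwinger_dyson_gue\<close>), for every product \<open>T\<close> of traces of further words,

    \<open>E[tr(\<alpha> i u) T] = v \<Sum> E[tr(p) tr(\<alpha> q) T] + v N\<^sup>-\<^sup>2 \<Sum> E[T']\<close>.

  The first sum comes from derivatives of \<open>u\<close>; the second from derivatives of a factor of \<open>T\<close>, which
  merge two traces into one and thereby lose a factor \<open>N\<^sup>2\<close>. On words without random letters both sides
  agree exactly and are bounded, by submultiplicativity of the operator norm (\<open>ntrace_mat_word_le\<close>).
  Each use of the recursion lowers the number of random letters, so an induction on that number shows
  that expectations of products of traces are bounded and differ from the corresponding products of
  values of \<open>\<phi>\<close> by \<open>O(N\<^sup>-\<^sup>2)\<close> (\<open>schwinger_dyson_comparison\<close>). Working with products of traces from the
  start replaces a separate bound on the variances of traces.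

  For the free model the equation is linear in \<open>u\<close>, so it suffices to prove it on a spanning set, the
  alternating products of centred polynomials in free families (\<open>vanish_if_vanish_alt_centred\<close>). There
  freeness annihilates all contributions except those of the first factor, and what is left is the
  equation for powers of one semicircular element, that is, the convolution recursion of the Catalan
  numbers (\<open>semicircle_moment_recursion\<close>). That the single semicircular elements and the family of
  deterministic matrices are free from each other follows from the two-level freeness of the model by
  associativity (\<open>free_subalgs_join\<close>).

  For the random matrices, integration by parts is reduced to monomials in the entries, hence by
  independence to moments of single Gaussian entries (\<open>wick_one_step\<close>). The mixed moments of a complex
  entry and its conjugate follow from the rotation invariance of its real parts
  (\<open>centred_complex_gaussian_moment\<close>).\<close>

section \<open>The free algebra and linear functionals on words\<close>

text \<open>Finitely supported families over a monoid are multiplied by convolution. With concatenation as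
  the monoid operation on words, noncommutative polynomials become the free algebra.\<close>

instantiation list :: (type) monoid_add
begin
definition zero_list :: "'a list" where "zero_list = []"
definition plus_list :: "'a list \<Rightarrow> 'a list \<Rightarrow> 'a list" where "plus_list u v = u @ v"
instance by standard (simp_all add: zero_list_def plus_list_def)
end

abbreviation nc_monom :: "'x list \<Rightarrow> 'x ncpoly" where
  "nc_monom u \<equiv> Poly_Mapping.single u 1"

lemma ncpoly_induct [case_names zero add_term]:
  fixes P :: "'x ncpoly"
  assumes "Q 0" and "\<And>u c P. Q P \<Longrightarrow> Q (Poly_Mapping.single u c + P)"
  shows "Q P"
proof (induction P rule: Poly_Mapping.update_induct)
  case const then show ?case using assms(1) .
next
  case (update f a b)
  have "Poly_Mapping.update a b f = Poly_Mapping.single a b + f"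
    using update(1) by (intro poly_mapping_eqI)
      (auto simp: lookup_update lookup_add lookup_single when_def in_keys_iff)
  then show ?case using assms(2)[OF update(3)] by simp
qed

definition lin_ext :: "('x list \<Rightarrow> complex) \<Rightarrow> 'x ncpoly \<Rightarrow> complex" where
  "lin_ext f P = (\<Sum>u\<in>Poly_Mapping.keys P. Poly_Mapping.lookup P u * f u)"

lemma lin_ext_add: "lin_ext f (P + Q) = lin_ext f P + lin_ext f Q"
  unfolding lin_ext_def by (rule setsum_keys_plus_distrib) (auto simp: algebra_simps)

lemma lin_ext_zero [simp]: "lin_ext f 0 = 0"
  by (simp add: lin_ext_def)

lemma lin_ext_single [simp]: "lin_ext f (Poly_Mapping.single u c) = c * f u"
  by (simp add: lin_ext_def)

lemma lin_ext_fun_cong: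
  assumes "\<And>u. u \<in> Poly_Mapping.keys P \<Longrightarrow> f u = g u" shows "lin_ext f P = lin_ext g P"
  using assms by (simp add: lin_ext_def)

lemma lin_ext_fun_add: "lin_ext (\<lambda>u. f u + g u) P = lin_ext f P + lin_ext g P"
  by (simp add: lin_ext_def algebra_simps sum.distrib)

lemma lin_ext_fun_cmult: "lin_ext (\<lambda>u. c * f u) P = c * lin_ext f P"
  by (simp add: lin_ext_def algebra_simps sum_distrib_left)

lemma lin_ext_fun_zero [simp]: "lin_ext (\<lambda>u. 0) P = 0"
  by (simp add: lin_ext_def)

lemma lin_ext_smult: "lin_ext f (Poly_Mapping.single [] c * P) = c * lin_ext f P"
proof (induction P rule: ncpoly_induct)
  case zero then show ?case by simp
next
  case (add_term u d P)
  then show ?case by (simp add: distrib_left lin_ext_add mult_single plus_list_def)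
qed

lemma lin_ext_diff: "lin_ext f (P - Q) = lin_ext f P - lin_ext f Q"
  using lin_ext_add[of f "P - Q" Q] by simp

lemma lin_ext_one [simp]: "lin_ext f 1 = f []"
  using lin_ext_single[of f "[]" 1] by (simp add: zero_list_def[symmetric])

lemma lin_ext_mult: "lin_ext f (P * Q) = lin_ext (\<lambda>u. lin_ext (\<lambda>w. f (u @ w)) Q) P"
proof (induction P rule: ncpoly_induct)
  case zero then show ?case by simp
next
  case (add_term u c P)
  have "lin_ext f (Poly_Mapping.single u c * Q) = c * lin_ext (\<lambda>w. f (u @ w)) Q"
    by (induction Q rule: ncpoly_induct)
      (simp_all add: distrib_left lin_ext_add mult_single plus_list_def)
  with add_term show ?case by (simp add: distrib_right lin_ext_add)
qed

lemma lin_ext_fun_sum_list: "lin_ext (\<lambda>w. \<Sum>x\<leftarrow>xs. H w x) Q = (\<Sum>x\<leftarrow>xs. lin_ext (\<lambda>w. H w x) Q)"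
  by (induction xs) (simp_all add: lin_ext_fun_add)

lemma lin_ext_swap: "lin_ext (\<lambda>u. lin_ext (\<lambda>w. H u w) Q) P = lin_ext (\<lambda>w. lin_ext (\<lambda>u. H u w) P) Q"
  unfolding lin_ext_def sum_distrib_left by (subst sum.swap) (simp add: mult.left_commute)

lemma scalar_commute: "P * Poly_Mapping.single [] c = Poly_Mapping.single [] c * (P :: 'x ncpoly)"
  by (induction P rule: ncpoly_induct)
    (simp_all add: distrib_left distrib_right mult_single plus_list_def mult.commute)

text \<open>The step behind every centring argument: subtracting a scalar from a factor changes the value
  by a product with one factor fewer.\<close>

lemma lin_ext_mult_diff_scalar:
  "lin_ext f (A * (P - Poly_Mapping.single [] c) * B) = lin_ext f (A * P * B) - c * lin_ext f (A * B)"
  by (simp add: left_diff_distrib right_diff_distrib lin_ext_diff scalar_commute mult.assoc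
      lin_ext_smult)

lemma keys_diff_subset: "Poly_Mapping.keys (P - Q) \<subseteq> Poly_Mapping.keys P \<union> Poly_Mapping.keys (Q ::
    'x ncpoly)"
  by (auto simp: in_keys_iff lookup_minus)

lemma ncpolys_closed:
  "1 \<in> ncpolys V" "u \<in> lists V \<Longrightarrow> Poly_Mapping.single u c \<in> ncpolys V"
  "P \<in> ncpolys V \<Longrightarrow> Q \<in> ncpolys V \<Longrightarrow> P * Q \<in> ncpolys V"
  "P \<in> ncpolys V \<Longrightarrow> Q \<in> ncpolys V \<Longrightarrow> P - Q \<in> ncpolys V"
  using keys_mult[of P Q] keys_diff_subset[of P Q]
  by (fastforce simp: ncpolys_def zero_list_def plus_list_def)+

section \<open>Splitting words at a letter\<close>

text \<open>On words this is the free difference quotient with respect to the letter \<open>i\<close>: the word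
  \<open>p @ i # q\<close> contributes the pair \<open>(p, q)\<close>, which stands for the tensor product of \<open>p\<close> and \<open>q\<close>.\<close>

primrec splits :: "'x \<Rightarrow> 'x list \<Rightarrow> ('x list \<times> 'x list) list" where
  "splits i [] = []"
| "splits i (x # u) = (if x = i then [([], u)] else []) @ map (\<lambda>(p, q). (x # p, q)) (splits i u)"

lemma splits_imp: "(p, q) \<in> set (splits i u) \<Longrightarrow> u = p @ i # q"
  by (induction u arbitrary: p) (auto split: if_splits)

lemma splits_empty_iff: "splits i u = [] \<longleftrightarrow> i \<notin> set u"
  by (induction u) auto

definition split_sum :: "'x \<Rightarrow> ('x list \<Rightarrow> 'x list \<Rightarrow> complex) \<Rightarrow> 'x list \<Rightarrow> complex" where
  "split_sum i F u = (\<Sum>(p, q)\<leftarrow>splits i u. F p q)"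

lemma split_sum_Nil [simp]: "split_sum i F [] = 0"
  and split_sum_Cons: "split_sum i F (x # u) =
    (if x = i then F [] u else 0) + split_sum i (\<lambda>p q. F (x # p) q) u"
  by (simp_all add: split_sum_def case_prod_unfold comp_def)

lemma split_sum_append:
  "split_sum i F (u @ w) = split_sum i (\<lambda>p q. F p (q @ w)) u + split_sum i (\<lambda>p q. F (u @ p) q) w"
  by (induction u arbitrary: F) (simp_all add: split_sum_Cons add.assoc)

lemma split_sum_cong:
  assumes "\<And>p q. u = p @ i # q \<Longrightarrow> F p q = G p q"
  shows "split_sum i F u = split_sum i G u"
  unfolding split_sum_def using assms splits_imp[of _ _ i u]
  by (intro arg_cong[of _ _ sum_list] map_cong) auto

lemma split_sum_add: "split_sum i (\<lambda>p q. F p q + G p q) u = split_sum i F u + split_sum i G u"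
  by (simp add: split_sum_def case_prod_unfold sum_list_addf)

lemma split_sum_cmult: "split_sum i (\<lambda>p q. c * F p q) u = c * split_sum i F u"
  by (simp add: split_sum_def case_prod_unfold sum_list_const_mult)

lemma lin_ext_split_sum:
  "lin_ext (\<lambda>w. split_sum i (\<lambda>p q. H w p q) u) Q = split_sum i (\<lambda>p q. lin_ext (\<lambda>w. H w p q) Q) u"
  by (simp add: split_sum_def case_prod_unfold lin_ext_fun_sum_list)

text \<open>The Leibniz rule: an occurrence of \<open>i\<close> in a product lies in one of the two factors, and the
  other factor is then attached to the piece next to it.\<close>

lemma split_sum_Leibniz:
  "lin_ext (split_sum i F) (P * Q) =
     lin_ext (split_sum i (\<lambda>p q. lin_ext (\<lambda>w. F p (q @ w)) Q)) P +
     lin_ext (split_sum i (\<lambda>p q. lin_ext (\<lambda>u. F (u @ p) q) P)) Q"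
  unfolding lin_ext_mult split_sum_append lin_ext_fun_add lin_ext_split_sum
  using lin_ext_swap[of "\<lambda>u. split_sum i (\<lambda>p q. F (u @ p) q)" Q P] by (simp add: lin_ext_split_sum)

section \<open>The Schwinger-Dyson equation as a consequence of freeness\<close>

text \<open>Each factor carries the index \<open>t\<close> of the family \<open>V t\<close> of letters in which it is a polynomial.
  Words are only split at letters, so the factors have to be kept as polynomials and not as elements
  of an algebra in which they may satisfy relations.\<close>

definition alt_centred ::
  "'t set \<Rightarrow> ('t \<Rightarrow> 'x set) \<Rightarrow> ('x list \<Rightarrow> complex) \<Rightarrow> ('t \<times> 'x ncpoly) list \<Rightarrow> bool" where
  "alt_centred I V \<phi> Ps \<longleftrightarrow> distinct_adj (map fst Ps) \<and>
     (\<forall>(t, P)\<in>set Ps. t \<in> I \<and> P \<in> ncpolys (V t) \<and> lin_ext \<phi> P = 0)"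

definition poly_prod :: "('t \<times> 'x ncpoly) list \<Rightarrow> 'x ncpoly" where
  "poly_prod Ps = prod_list (map snd Ps)"

lemma poly_prod_simps [simp]:
  "poly_prod [] = 1" "poly_prod ((t, P) # Ps) = P * poly_prod Ps"
  "poly_prod (Ps @ Qs) = poly_prod Ps * poly_prod Qs"
  by (simp_all add: poly_prod_def)

definition word_free :: "'t set \<Rightarrow> ('t \<Rightarrow> 'x set) \<Rightarrow> ('x list \<Rightarrow> complex) \<Rightarrow> bool" where
  "word_free I V \<phi> \<longleftrightarrow> (\<forall>Ps. Ps \<noteq> [] \<and> alt_centred I V \<phi> Ps \<longrightarrow> lin_ext \<phi> (poly_prod Ps) = 0)"

lemma not_distinct_adj_decomp: "\<not> distinct_adj xs \<Longrightarrow> \<exists>as a bs. xs = as @ [a, a] @ bs"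
proof (induction xs)
  case (Cons x xs)
  show ?case
  proof (cases "distinct_adj xs")
    case True
    then have "xs \<noteq> []" "hd xs = x" using Cons.prems by (auto simp: distinct_adj_Cons)
    then have "x # xs = [] @ [x, x] @ tl xs" by (cases xs) auto
    then show ?thesis by blast
  next
    case False
    then obtain as a bs where "xs = as @ [a, a] @ bs" using Cons.IH by blast
    then have "x # xs = (x # as) @ [a, a] @ bs" by simp
    then show ?thesis by blast
  qed
qed simp

text \<open>Alternating products of centred polynomials span everything. Write each factor as its centred
  part plus a scalar; the scalars lead to products with fewer factors, and neighbours from the same
  family merge into one factor. So the claim follows by induction on the number of factors.\<close>

lemma vanish_if_vanish_alt_centred:
  fixes T \<phi> :: "'x list \<Rightarrow> complex"
  assumes one: "\<phi> [] = 1"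
    and T: "\<And>Ps. alt_centred I V \<phi> Ps \<Longrightarrow> lin_ext T (poly_prod Ps) = 0"
    and u: "u \<in> lists (\<Union>t\<in>I. V t)"
  shows "T u = 0"
proof -
  have van: "lin_ext T (poly_prod Ps) = 0"
    if "\<forall>(t, P)\<in>set Ps. t \<in> I \<and> P \<in> ncpolys (V t)" for Ps
    using that
  proof (induction "length Ps" arbitrary: Ps rule: less_induct)
    case less
    show ?case
    proof (cases "distinct_adj (map fst Ps)")
      case False
      then obtain xs a ys where "map fst Ps = xs @ [a, a] @ ys"
        using not_distinct_adj_decomp by metis
      then obtain As P Q Bs where Ps: "Ps = As @ [(a, P), (a, Q)] @ Bs"
        by (auto simp: map_eq_append_conv map_eq_Cons_conv)
      have "lin_ext T (poly_prod (As @ [(a, P * Q)] @ Bs)) = 0"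
        using less.prems Ps by (intro less.hyps) (auto simp: ncpolys_closed)
      then show ?thesis by (simp add: Ps mult.assoc)
    next
      case True
      have "lin_ext T (poly_prod (As @ Bs)) = 0"
        if "length (As @ Bs) = length Ps" "distinct_adj (map fst (As @ Bs))"
          "\<forall>(t, P)\<in>set (As @ Bs). t \<in> I \<and> P \<in> ncpolys (V t)" "\<forall>(t, P)\<in>set As. lin_ext \<phi> P = 0" for
              As Bs
        using that
      proof (induction Bs arbitrary: As)
        case Nil
        then show ?case by (intro T) (auto simp: alt_centred_def)
      next
        case (Cons b Bs)
        obtain t P where b: "b = (t, P)" by force
        define P0 where "P0 = P - Poly_Mapping.single [] (lin_ext \<phi> P)"
        have "lin_ext T (poly_prod ((As @ [(t, P0)]) @ Bs)) = 0"
          using Cons.prems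
          by (intro Cons.IH) (auto simp: b P0_def ncpolys_closed lin_ext_diff one)
        moreover have "lin_ext T (poly_prod (As @ Bs)) = 0"
          using Cons.prems by (intro less.hyps) auto
        ultimately show ?case
          using lin_ext_mult_diff_scalar[of T "poly_prod As" P "lin_ext \<phi> P" "poly_prod Bs"]
          by (simp add: b P0_def mult.assoc)
      qed
      from this[of "[]" Ps] True less.prems show ?thesis by simp
    qed
  qed
  have "\<exists>Ps. (\<forall>(t, P)\<in>set Ps. t \<in> I \<and> P \<in> ncpolys (V t)) \<and> poly_prod Ps = nc_monom u"
    using u
  proof (induction u)
    case Nil
    show ?case by (rule exI[of _ "[]"]) (simp add: single_one[symmetric] zero_list_def del:
        single_one)
  next
    case (Cons x u)
    then obtain Ps t where "\<forall>(t, P)\<in>set Ps. t \<in> I \<and> P \<in> ncpolys (V t)" "poly_prod Ps = nc_monom u"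
      "t \<in> I" "x \<in> V t" by auto
    then show ?case
      by (intro exI[of _ "(t, nc_monom [x]) # Ps"]) (auto simp: mult_single plus_list_def
          ncpolys_closed)
  qed
  then obtain Ps where "\<forall>(t, P)\<in>set Ps. t \<in> I \<and> P \<in> ncpolys (V t)" "poly_prod Ps = nc_monom u"
    by blast
  then show ?thesis using van[of Ps] by simp
qed

lemma alt_centred_append_mid:
  assumes "alt_centred I V \<phi> (L @ (t, P) # R)" "Q \<in> ncpolys (V t)" "lin_ext \<phi> Q = 0"
  shows "alt_centred I V \<phi> (L @ (t, Q) # R)"
  using assms by (auto simp: alt_centred_def)

text \<open>In the place of a factor of an alternating centred product any polynomial of the same family
  may stand: its centred part contributes nothing, so it acts like the scalar \<open>\<phi>(Q)\<close>.\<close>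

lemma lin_ext_prod_mid:
  assumes free: "word_free I V \<phi>" and one: "\<phi> [] = 1"
    and alt: "alt_centred I V \<phi> (L @ (t, P) # R)" and Q: "Q \<in> ncpolys (V t)"
  shows "lin_ext \<phi> (poly_prod L * Q * poly_prod R) = lin_ext \<phi> Q * lin_ext \<phi> (poly_prod L *
      poly_prod R)"
proof -
  define Q0 where "Q0 = Q - Poly_Mapping.single [] (lin_ext \<phi> Q)"
  have "alt_centred I V \<phi> (L @ (t, Q0) # R)"
    by (rule alt_centred_append_mid[OF alt]) (auto simp: Q0_def Q one ncpolys_closed lin_ext_diff)
  then have "lin_ext \<phi> (poly_prod (L @ (t, Q0) # R)) = 0"
    using free unfolding word_free_def by blast
  then show ?thesis
    using lin_ext_mult_diff_scalar[of \<phi> "poly_prod L" Q "lin_ext \<phi> Q" "poly_prod R"]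
    by (simp add: Q0_def mult.assoc)
qed

lemma lin_ext_split_sum_cong:
  assumes "P \<in> ncpolys V" "\<And>p q. p \<in> lists V \<Longrightarrow> q \<in> lists V \<Longrightarrow> i \<in> V \<Longrightarrow> F p q = G p q"
  shows "lin_ext (split_sum i F) P = lin_ext (split_sum i G) P"
proof (intro lin_ext_fun_cong split_sum_cong)
  fix u p q assume "u \<in> Poly_Mapping.keys P" "u = p @ i # q"
  then have "p @ i # q \<in> lists V" using assms(1) by (auto simp: ncpolys_def)
  then show "F p q = G p q" by (intro assms(2)) auto
qed

text \<open>A splitting that happens behind a nonempty alternating centred product \<open>L\<close> contributes
  nothing. If it happens in the first factor after \<open>L\<close>, then its left piece is \<open>L p\<close> with \<open>p\<close> from
  the family of that factor, and freeness gives \<open>\<phi>(L p) = \<phi>(p) \<phi>(L) = 0\<close>; the later factors are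
  treated by moving the boundary of \<open>L\<close>.\<close>

lemma lin_ext_split_sum_alt_tail:
  assumes free: "word_free I V \<phi>" and one: "\<phi> [] = 1"
    and alt: "alt_centred I V \<phi> (L @ R)" and L: "L \<noteq> []"
  shows "lin_ext (split_sum i (\<lambda>p q. lin_ext \<phi> (poly_prod L * nc_monom p) * g q)) (poly_prod R) = 0"
  using alt L
proof (induction R arbitrary: L g)
  case Nil
  then show ?case by simp
next
  case (Cons b R)
  obtain t P where b: "b = (t, P)" by force
  have P: "P \<in> ncpolys (V t)" using Cons.prems by (auto simp: alt_centred_def b)
  have alt1: "alt_centred I V \<phi> L" and altP: "alt_centred I V \<phi> (L @ [(t, P)])"
    using Cons.prems by (auto simp: alt_centred_def b distinct_adj_append_iff)
  have L0: "lin_ext \<phi> (poly_prod L) = 0"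
    using free alt1 Cons.prems unfolding word_free_def by blast
  have "lin_ext (split_sum i (\<lambda>p q. lin_ext (\<lambda>w. lin_ext \<phi> (poly_prod L * nc_monom p) * g (q @ w))
      (poly_prod R))) P
    = lin_ext (split_sum i (\<lambda>p q. 0 * 0)) P"
  proof (rule lin_ext_split_sum_cong[OF P])
    fix p q assume "p \<in> lists (V t)"
    then have "lin_ext \<phi> (poly_prod L * nc_monom p) = 0"
      using lin_ext_prod_mid[OF free one altP, of "nc_monom p"] L0 by (simp add: ncpolys_closed)
    then show "lin_ext (\<lambda>w. lin_ext \<phi> (poly_prod L * nc_monom p) * g (q @ w)) (poly_prod R) = 0 * 0"
      by (simp add: lin_ext_fun_cmult)
  qed
  also have "\<dots> = 0"
    unfolding split_sum_cmult by (simp add: lin_ext_def)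
  finally have 1: "lin_ext (split_sum i (\<lambda>p q. lin_ext (\<lambda>w. lin_ext \<phi> (poly_prod L * nc_monom p) *
      g (q @ w)) (poly_prod R))) P = 0" .
  have "lin_ext (\<lambda>u. lin_ext \<phi> (poly_prod L * nc_monom (u @ p)) * g q) P
      = lin_ext \<phi> (poly_prod (L @ [(t, P)]) * nc_monom p) * g q" for p q
  proof -
    have "lin_ext \<phi> (poly_prod L * (P * nc_monom p)) = lin_ext (\<lambda>u. lin_ext \<phi> (poly_prod L *
        nc_monom (u @ p))) P"
      unfolding lin_ext_mult[of \<phi> "poly_prod L"] lin_ext_mult[of _ P]
      by (subst lin_ext_swap) simp
    then show ?thesis by (simp add: mult.assoc mult.commute[of _ "g q"] lin_ext_fun_cmult)
  qed
  then have 2: "lin_ext (split_sum i (\<lambda>p q. lin_ext (\<lambda>u. lin_ext \<phi> (poly_prod L * nc_monom (u @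
      p)) * g q) P)) (poly_prod R) = 0"
    using Cons.IH[of "L @ [(t, P)]"] Cons.prems by (simp add: b)
  show ?case
    using 1 2 by (simp add: b split_sum_Leibniz)
qed

text \<open>Only the first factor \<open>P\<close> of \<open>Ps\<close> matters. If it belongs to another family than \<open>i\<close>, then the
  left-hand side vanishes because \<open>i\<close> is itself centred, and the right-hand side because \<open>i\<close> does not
  occur in \<open>P\<close>. If \<open>P\<close> is a polynomial in \<open>i\<close>, then freeness takes
  \<open>\<phi>(i P)\<close> out of the left-hand side and the sum of all \<open>\<phi>(p) \<phi>(q)\<close> out of the right-hand side, and
  these agree by the equation for the single letter \<open>i\<close>. The list \<open>Bs\<close> represents what stands in front
  of \<open>i\<close>.\<close>

lemma schwinger_dyson_alt_centred:
  assumes free: "word_free I V \<phi>" and one: "\<phi> [] = 1"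
    and s: "s \<in> I" "V s = {i}" and disj: "\<And>t. t \<in> I \<Longrightarrow> t \<noteq> s \<Longrightarrow> i \<notin> V t"
    and semi: "\<And>u. u \<in> lists {i} \<Longrightarrow> \<phi> (i # u) = v * split_sum i (\<lambda>p q. \<phi> p * \<phi> q) u"
    and Bs: "alt_centred I V \<phi> Bs" "Bs \<noteq> [] \<Longrightarrow> fst (last Bs) \<noteq> s"
    and BsPs: "alt_centred I V \<phi> Ps"
  shows "lin_ext \<phi> (poly_prod Bs * nc_monom [i] * poly_prod Ps) =
    v * lin_ext (split_sum i (\<lambda>p q. \<phi> p * lin_ext \<phi> (poly_prod Bs * nc_monom q))) (poly_prod Ps)"
proof -
  have i0: "\<phi> [i] = 0" using semi[of "[]"] by simp
  have Xi: "nc_monom [i] \<in> ncpolys (V s)" by (simp add: s ncpolys_closed)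
  have lin_ext_alt0: "lin_ext \<phi> (poly_prod Qs) = 0" if "alt_centred I V \<phi> Qs" "Qs \<noteq> []" for Qs
    using free that unfolding word_free_def by blast
  have BX: "alt_centred I V \<phi> (Bs @ [(s, nc_monom [i])])"
    using Bs Xi i0 s by (auto simp: alt_centred_def distinct_adj_append_iff last_map)
  show ?thesis
  proof (cases Ps)
    case Nil
    then show ?thesis using lin_ext_alt0[OF BX] by simp
  next
    case (Cons b R)
    obtain t P where b: "b = (t, P)" by force
    have P: "P \<in> ncpolys (V t)" "t \<in> I" using BsPs by (auto simp: alt_centred_def b Cons)
    have altR: "alt_centred I V \<phi> ([(t, P)] @ R)" using BsPs b Cons by simp
    have swapF: "lin_ext (\<lambda>u. \<phi> (u @ p) * g q) P = lin_ext \<phi> (poly_prod [(t, P)] * nc_monom p) * g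
        q" for p q g
      using lin_ext_fun_cmult[of "g q" "\<lambda>u. \<phi> (u @ p)" P] by (simp add: lin_ext_mult mult.commute)
    have tail: "lin_ext (split_sum i (\<lambda>p q. lin_ext (\<lambda>u. \<phi> (u @ p) * lin_ext \<phi> (poly_prod Bs *
        nc_monom q)) P)) (poly_prod R) = 0"
      unfolding swapF[of _ "\<lambda>q. lin_ext \<phi> (poly_prod Bs * nc_monom q)"]
      by (rule lin_ext_split_sum_alt_tail[OF free one altR]) simp
    have head: "lin_ext (\<lambda>w. \<phi> p * lin_ext \<phi> (poly_prod Bs * nc_monom (q @ w))) (poly_prod R)
      = \<phi> p * lin_ext \<phi> (poly_prod Bs * nc_monom q * poly_prod R)" for p q
    proof -
      have "lin_ext \<phi> (poly_prod Bs * (nc_monom q * poly_prod R))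
        = lin_ext (\<lambda>w. lin_ext \<phi> (poly_prod Bs * nc_monom (q @ w))) (poly_prod R)"
        unfolding lin_ext_mult[of \<phi> "poly_prod Bs"] lin_ext_mult[of _ "nc_monom q"]
        by (subst (2) lin_ext_swap) simp
      then show ?thesis by (simp add: lin_ext_fun_cmult mult.assoc)
    qed
    have RHS: "lin_ext (split_sum i (\<lambda>p q. \<phi> p * lin_ext \<phi> (poly_prod Bs * nc_monom q)))
        (poly_prod Ps)
      = lin_ext (split_sum i (\<lambda>p q. \<phi> p * lin_ext \<phi> (poly_prod Bs * nc_monom q * poly_prod R))) P"
      unfolding Cons b poly_prod_simps split_sum_Leibniz head tail by simp
    show ?thesis
    proof (cases "t = s")
      case False
      have "alt_centred I V \<phi> ((Bs @ [(s, nc_monom [i])]) @ Ps)"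
        using BX BsPs False unfolding Cons b
        by (auto simp: alt_centred_def distinct_adj_append_iff)
      then have "lin_ext \<phi> (poly_prod Bs * nc_monom [i] * poly_prod Ps) = 0"
        using lin_ext_alt0[of "(Bs @ [(s, nc_monom [i])]) @ Ps"] by (simp add: mult.assoc)
      moreover have "lin_ext (split_sum i (\<lambda>p q. \<phi> p * lin_ext \<phi> (poly_prod Bs * nc_monom q *
          poly_prod R))) P
        = lin_ext (split_sum i (\<lambda>p q. 0 * 0)) P"
        using disj[OF P(2) False] by (intro lin_ext_split_sum_cong[OF P(1)]) auto
      moreover have "\<dots> = 0"
        unfolding split_sum_cmult by (simp add: lin_ext_def)
      ultimately show ?thesis using RHS by simp
    next
      case True
      have alt2: "alt_centred I V \<phi> (Bs @ (s, nc_monom [i]) # R)"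
        using BX BsPs unfolding Cons b True
        by (auto simp: alt_centred_def distinct_adj_append_iff distinct_adj_Cons)
      have "lin_ext (split_sum i (\<lambda>p q. \<phi> p * lin_ext \<phi> (poly_prod Bs * nc_monom q * poly_prod R))) P
        = lin_ext (split_sum i (\<lambda>p q. lin_ext \<phi> (poly_prod Bs * poly_prod R) * (\<phi> p * \<phi> q))) P"
        using lin_ext_prod_mid[OF free one alt2] 
        by (intro lin_ext_split_sum_cong[OF P(1)]) (simp add: True ncpolys_closed)
      also have "\<dots> = lin_ext \<phi> (poly_prod Bs * poly_prod R) * lin_ext (split_sum i (\<lambda>p q. \<phi> p * \<phi>
          q)) P"
        unfolding split_sum_cmult lin_ext_fun_cmult ..
      finally have rhs: "v * lin_ext (split_sum i (\<lambda>p q. \<phi> p * lin_ext \<phi> (poly_prod Bs * nc_monom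
          q))) (poly_prod Ps)
        = lin_ext \<phi> (poly_prod Bs * poly_prod R) * lin_ext (\<lambda>u. v * split_sum i (\<lambda>p q. \<phi> p * \<phi> q)
            u) P"
        unfolding RHS lin_ext_fun_cmult by simp
      have "lin_ext (\<lambda>u. v * split_sum i (\<lambda>p q. \<phi> p * \<phi> q) u) P = lin_ext (\<lambda>u. \<phi> (i # u)) P"
        using P(1) True s by (intro lin_ext_fun_cong semi[symmetric]) (auto simp: ncpolys_def)
      also have "\<dots> = lin_ext \<phi> (nc_monom [i] * P)"
        by (simp add: lin_ext_mult)
      finally have c: "lin_ext (\<lambda>u. v * split_sum i (\<lambda>p q. \<phi> p * \<phi> q) u) P = lin_ext \<phi> (nc_monom
          [i] * P)" .
      have "lin_ext \<phi> (poly_prod Bs * (nc_monom [i] * P) * poly_prod R)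
        = lin_ext \<phi> (nc_monom [i] * P) * lin_ext \<phi> (poly_prod Bs * poly_prod R)"
        using P(1) Xi True by (intro lin_ext_prod_mid[OF free one alt2]) (auto intro!:
            ncpolys_closed(3))
      then show ?thesis unfolding rhs c by (simp add: Cons b mult.assoc)
    qed
  qed
qed

text \<open>Both sides are linear in \<open>u\<close>, so \<open>u\<close> may be replaced by an alternating centred product. They
  are linear in \<open>\<alpha>\<close> as well, and \<open>\<alpha>\<close> is the sum of a centred polynomial of its family, which is a
  legitimate factor in front of \<open>i\<close>, and a scalar.\<close>

theorem schwinger_dyson_free:
  fixes \<phi> :: "'x list \<Rightarrow> complex"
  assumes free: "word_free I V \<phi>" and one: "\<phi> [] = 1"
    and s: "s \<in> I" "V s = {i}" and disj: "\<And>t. t \<in> I \<Longrightarrow> t \<noteq> s \<Longrightarrow> i \<notin> V t"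
    and semi: "\<And>u. u \<in> lists {i} \<Longrightarrow> \<phi> (i # u) = v * split_sum i (\<lambda>p q. \<phi> p * \<phi> q) u"
    and j: "j \<in> I" "j \<noteq> s" and \<alpha>: "\<alpha> \<in> lists (V j)" and u: "u \<in> lists (\<Union>t\<in>I. V t)"
  shows "\<phi> (\<alpha> @ i # u) = v * split_sum i (\<lambda>p q. \<phi> p * \<phi> (\<alpha> @ q)) u"
proof -
  define D where "D B P = lin_ext \<phi> (B * nc_monom [i] * P) -
    v * lin_ext (split_sum i (\<lambda>p q. \<phi> p * lin_ext \<phi> (B * nc_monom q))) P" for B P :: "'x ncpoly"
  have D_add: "D (B + C) P = D B P + D C P" for B C P
    unfolding D_def distrib_right lin_ext_add distrib_left split_sum_add lin_ext_fun_add by simp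
  have D_scalar: "D (Poly_Mapping.single [] c) P = c * D 1 P" for c P
  proof -
    have *: "lin_ext \<phi> (Poly_Mapping.single [] c * Q) = c * lin_ext \<phi> (1 * Q)" for Q :: "'x ncpoly"
      by (simp add: lin_ext_smult)
    have **: "(\<lambda>p q. \<phi> p * (c * lin_ext \<phi> (1 * nc_monom q))) = (\<lambda>p q. c * (\<phi> p * lin_ext \<phi> (1 *
        nc_monom q)))"
      by (simp add: algebra_simps)
    show ?thesis
      unfolding D_def mult.assoc * ** split_sum_cmult lin_ext_fun_cmult by (simp add: algebra_simps)
  qed
  define B where "B = nc_monom \<alpha> - Poly_Mapping.single [] (\<phi> \<alpha>)"
  define T where "T u = \<phi> (\<alpha> @ i # u) - v * split_sum i (\<lambda>p q. \<phi> p * \<phi> (\<alpha> @ q)) u" for u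
  have T: "lin_ext T P = D (nc_monom \<alpha>) P" for P
  proof -
    have "lin_ext T P = lin_ext (\<lambda>u. \<phi> (\<alpha> @ i # u) + (- v) * split_sum i (\<lambda>p q. \<phi> p * \<phi> (\<alpha> @ q)) u) P"
      by (intro lin_ext_fun_cong) (simp add: T_def)
    then show ?thesis
      unfolding D_def lin_ext_fun_add lin_ext_fun_cmult
      by (simp add: lin_ext_mult mult_single plus_list_def)
  qed
  have "T u = 0"
  proof (rule vanish_if_vanish_alt_centred[where I = I and V = V and \<phi> = \<phi> and T = T, OF one _ u])
    fix Ps assume alt: "alt_centred I V \<phi> Ps"
    have "D 1 (poly_prod Ps) = 0"
      using schwinger_dyson_alt_centred[OF free one s disj semi _ _ alt, of "[]"]
      by (simp add: D_def alt_centred_def)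
    moreover have "alt_centred I V \<phi> [(j, B)]"
      using j \<alpha> one by (auto simp: alt_centred_def B_def ncpolys_closed lin_ext_diff)
    then have "D B (poly_prod Ps) = 0"
      using schwinger_dyson_alt_centred[OF free one s disj semi _ _ alt, of "[(j, B)]"] j
      by (simp add: D_def)
    ultimately have "D (B + Poly_Mapping.single [] (\<phi> \<alpha>)) (poly_prod Ps) = 0"
      unfolding D_add D_scalar by simp
    then show "lin_ext T (poly_prod Ps) = 0"
      by (simp add: T B_def)
  qed
  then show ?thesis by (simp add: T_def)
qed

section \<open>From freeness of subalgebras to freeness on words\<close>

lemma poly_prod_ncpolys:
  "\<forall>(t, P)\<in>set Ps. P \<in> ncpolys V \<Longrightarrow> poly_prod Ps \<in> ncpolys V"
  by (induction Ps) (auto simp: ncpolys_closed)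

context nc_prob_space
begin

lemma ring_S: "ring S"
  using nc_prob_space_axioms by (simp add: nc_prob_space_def)

text \<open>The locale contains two rings, the algebra and the field of scalars, and unqualified names of
  ring laws may refer to the scalars. These are the laws of the algebra.\<close>

lemmas S_assoc = monoid.m_assoc[OF ring.is_monoid[OF ring_S]]
lemmas S_distrib = ring.ring_simprules(13,23)[OF ring_S]

lemma word_eval_closed:
  assumes "\<And>i. i \<in> set u \<Longrightarrow> x i \<in> carrier S" shows "word_eval S x u \<in> carrier S"
  using assms by (induction u) (auto simp: word_eval_def)

lemma word_eval_Cons [simp]: "word_eval S x (i # u) = x i \<otimes> word_eval S x u"
  and word_eval_Nil [simp]: "word_eval S x [] = \<one>"
  by (simp_all add: word_eval_def)

lemma word_eval_append:
  assumes "\<And>i. i \<in> set u \<union> set w \<Longrightarrow> x i \<in> carrier S"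
  shows "word_eval S x (u @ w) = word_eval S x u \<otimes> word_eval S x w"
  using assms
proof (induction u)
  case Nil
  then have "word_eval S x w \<in> carrier S" by (intro word_eval_closed) auto
  then show ?case by simp
next
  case (Cons i u)
  then have "word_eval S x w \<in> carrier S" "word_eval S x u \<in> carrier S" "x i \<in> carrier S"
    by (auto intro!: word_eval_closed)
  moreover have "word_eval S x (u @ w) = word_eval S x u \<otimes> word_eval S x w"
    using Cons.prems by (intro Cons.IH) auto
  ultimately show ?case by (simp add: S_assoc)
qed

lemma zero_smult: "y \<in> carrier S \<Longrightarrow> 0 \<odot> y = \<zero>"
  using smult_l_null[of y] by (simp add: class_ring_simps)

lemma smult_carrier: "y \<in> carrier S \<Longrightarrow> c \<odot> y \<in> carrier S"
  using smult_closed[of c y] by (simp add: class_ring_simps)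

lemma star_alg_gen_carrier:
  assumes "X \<subseteq> carrier S" shows "star_alg_gen S X \<subseteq> carrier S"
proof
  fix y assume "y \<in> star_alg_gen S X"
  then show "y \<in> carrier S"
    by induction (use assms in \<open>auto intro: star_closed\<close>)
qed

lemma star_alg_gen_mono:
  assumes "X \<subseteq> Y" shows "star_alg_gen S X \<subseteq> star_alg_gen S Y"
proof
  fix y assume "y \<in> star_alg_gen S X"
  then show "y \<in> star_alg_gen S Y"
    by induction (use assms in \<open>auto intro: star_alg_gen.intros\<close>)
qed

lemma word_eval_star_alg_gen:
  assumes "\<And>i. i \<in> set u \<Longrightarrow> x i \<in> star_alg_gen S X"
  shows "word_eval S x u \<in> star_alg_gen S X"
  using assms by (induction u) (auto intro: star_alg_gen.intros)

lemma zero_in_star_alg_gen: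
  assumes "X \<subseteq> carrier S" shows "\<zero> \<in> star_alg_gen S X"
  using star_alg_gen.smult[OF star_alg_gen.one[of S X], of 0] by (simp add: zero_smult)

lemma finsum_in_star_alg_gen:
  assumes "finite F" "X \<subseteq> carrier S" "\<And>u. u \<in> F \<Longrightarrow> f u \<in> star_alg_gen S X"
  shows "(\<Oplus>u\<in>F. f u) \<in> star_alg_gen S X"
  using assms
proof (induction F rule: finite_induct)
  case empty
  then show ?case using zero_in_star_alg_gen by simp
next
  case (insert u F)
  then have "f \<in> F \<rightarrow> carrier S" "f u \<in> carrier S" using star_alg_gen_carrier[of X] by auto
  then show ?case using insert by (simp add: finsum_insert star_alg_gen.add)
qed

lemma nc_eval_star_alg_gen:
  assumes "X \<subseteq> carrier S" "P \<in> ncpolys V" "\<And>i. i \<in> V \<Longrightarrow> x i \<in> star_alg_gen S X"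
  shows "nc_eval S x P \<in> star_alg_gen S X"
  unfolding nc_eval_def using assms
  by (intro finsum_in_star_alg_gen star_alg_gen.smult word_eval_star_alg_gen)
    (auto simp: ncpolys_def)

lemma nc_eval_closed:
  assumes "P \<in> ncpolys V" "\<And>i. i \<in> V \<Longrightarrow> x i \<in> carrier S"
  shows "nc_eval S x P \<in> carrier S"
proof -
  have "nc_eval S x P \<in> star_alg_gen S (carrier S)"
    using assms by (intro nc_eval_star_alg_gen[of _ P V]) (auto intro: star_alg_gen.gen)
  then show ?thesis using star_alg_gen_carrier by blast
qed

lemma linear_nc_eval:
  assumes add: "\<And>y z. y \<in> carrier S \<Longrightarrow> z \<in> carrier S \<Longrightarrow> \<psi> (y \<oplus> z) = \<psi> y + \<psi> z"
    and smult: "\<And>c y. y \<in> carrier S \<Longrightarrow> \<psi> (c \<odot> y) = c * \<psi> y"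
    and P: "P \<in> ncpolys V" and x: "\<And>i. i \<in> V \<Longrightarrow> x i \<in> carrier S"
  shows "\<psi> (nc_eval S x P) = lin_ext (\<lambda>u. \<psi> (word_eval S x u)) P"
proof -
  have zero: "\<psi> \<zero> = (0 :: complex)"
    using smult[of \<one> 0] by (simp add: zero_smult)
  have "finite F \<Longrightarrow> F \<subseteq> lists V \<Longrightarrow>
    \<psi> (\<Oplus>u\<in>F. g u \<odot> word_eval S x u) = (\<Sum>u\<in>F. g u * \<psi> (word_eval S x u))" for F g
  proof (induction F rule: finite_induct)
    case empty
    then show ?case by (simp add: zero)
  next
    case (insert u F)
    have c: "word_eval S x w \<in> carrier S" if "w \<in> lists V" for w
      using that x by (intro word_eval_closed) auto
    have "(\<lambda>u. g u \<odot> word_eval S x u) \<in> F \<rightarrow> carrier S" "g u \<odot> word_eval S x u \<in> carrier S"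
      using c insert.prems by (auto intro!: smult_carrier)
    then show ?case using insert c by (simp add: finsum_insert add smult)
  qed
  then show ?thesis
    using P unfolding nc_eval_def lin_ext_def ncpolys_def by simp
qed

lemma nc_law_eq_lin_ext:
  assumes "P \<in> ncpolys V" "\<And>i. i \<in> V \<Longrightarrow> x i \<in> carrier S"
  shows "nc_law S x P = lin_ext (\<lambda>u. state S (word_eval S x u)) P"
  unfolding nc_law_def using assms
  by (intro linear_nc_eval[of "state S"]) (auto simp: state_add state_smult)

text \<open>Evaluation is multiplicative on polynomials. The left factor \<open>y\<close> collects the factors that
  have already been evaluated in the induction.\<close>

lemma state_word_eval_nc_eval:
  assumes x: "\<And>i. i \<in> L \<Longrightarrow> x i \<in> carrier S"
    and Ps: "\<forall>(t, P)\<in>set Ps. P \<in> ncpolys L" and y: "y \<in> carrier S"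
  shows "state S (y \<otimes> word_eval S snd (map (\<lambda>(t, P). (t, nc_eval S x P)) Ps)) =
    lin_ext (\<lambda>u. state S (y \<otimes> word_eval S x u)) (poly_prod Ps)"
  using Ps y
proof (induction Ps arbitrary: y)
  case Nil
  then show ?case by simp
next
  case (Cons b Ps)
  obtain t P where b: "b = (t, P)" by force
  have P: "P \<in> ncpolys L" using Cons.prems by (simp add: b)
  have we: "word_eval S x u \<in> carrier S" if "u \<in> lists L" for u
    using that x by (intro word_eval_closed) auto
  define R where "R = word_eval S snd (map (\<lambda>(t, P). (t, nc_eval S x P)) Ps)"
  have R: "R \<in> carrier S"
    unfolding R_def using Cons.prems x by (intro word_eval_closed) (auto intro!: nc_eval_closed[of
        _ L])
  have "state S (y \<otimes> (nc_eval S x P \<otimes> R)) = lin_ext (\<lambda>u. state S (y \<otimes> (word_eval S x u \<otimes> R))) P"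
  proof (rule linear_nc_eval[OF _ _ P x])
    fix z z' c assume "z \<in> carrier S"
    then show "state S (y \<otimes> (c \<odot> z \<otimes> R)) = c * state S (y \<otimes> (z \<otimes> R))"
      using R Cons.prems by (simp add: smult_mult_left smult_mult_right state_smult)
  next
    fix z z' assume "z \<in> carrier S" "z' \<in> carrier S"
    then show "state S (y \<otimes> ((z \<oplus> z') \<otimes> R)) = state S (y \<otimes> (z \<otimes> R)) + state S (y \<otimes> (z' \<otimes> R))"
      using R Cons.prems by (simp add: S_distrib state_add)
  qed
  also have "\<dots> = lin_ext (\<lambda>u. lin_ext (\<lambda>w. state S (y \<otimes> word_eval S x (u @ w))) (poly_prod Ps)) P"
  proof (rule lin_ext_fun_cong)
    fix u assume "u \<in> Poly_Mapping.keys P"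
    then have u: "u \<in> lists L" using P by (auto simp: ncpolys_def)
    have polyprod: "poly_prod Ps \<in> ncpolys L"
      using Cons.prems(1) by (intro poly_prod_ncpolys) simp
    have "state S (y \<otimes> (word_eval S x u \<otimes> R)) = state S ((y \<otimes> word_eval S x u) \<otimes> R)"
      using Cons.prems u R we by (simp add: S_assoc)
    also have "\<dots> = lin_ext (\<lambda>w. state S ((y \<otimes> word_eval S x u) \<otimes> word_eval S x w)) (poly_prod Ps)"
      unfolding R_def using Cons.prems u we by (intro Cons.IH) auto
    also have "\<dots> = lin_ext (\<lambda>w. state S (y \<otimes> word_eval S x (u @ w))) (poly_prod Ps)"
    proof (rule lin_ext_fun_cong)
      fix w assume "w \<in> Poly_Mapping.keys (poly_prod Ps)"
      then have "w \<in> lists L" using polyprod by (auto simp: ncpolys_def)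
      then show "state S ((y \<otimes> word_eval S x u) \<otimes> word_eval S x w) = state S (y \<otimes> word_eval S x (u
          @ w))"
        using u we x Cons.prems by (subst word_eval_append) (auto simp: S_assoc)
    qed
    finally show "state S (y \<otimes> (word_eval S x u \<otimes> R)) =
      lin_ext (\<lambda>w. state S (y \<otimes> word_eval S x (u @ w))) (poly_prod Ps)" .
  qed
  finally show ?case by (simp add: b R_def lin_ext_mult)
qed

text \<open>Associativity of freeness. In an alternating product of centred factors, each maximal run of
  factors from the subalgebras with index in \<open>I\<close> is centred by their freeness and lies in \<open>D\<close>.
  Collecting the runs gives an alternating product of centred elements of \<open>C\<close> and \<open>D\<close>.\<close>

lemma free_subalgs_join:
  assumes freeI: "free_subalgs S I B"
    and free2: "free_subalgs S UNIV (\<lambda>b. if b then C else D)"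
    and D: "\<And>xs. xs \<noteq> [] \<Longrightarrow> (\<forall>(t, b)\<in>set xs. t \<in> I \<and> b \<in> B t) \<Longrightarrow> word_eval S snd xs \<in> D"
    and BC: "D \<subseteq> carrier S" "C \<subseteq> carrier S" and B0: "\<And>t. t \<in> I \<Longrightarrow> B t \<subseteq> carrier S"
    and k: "k \<notin> I" "B k = C"
  shows "free_subalgs S (insert k I) B"
  unfolding free_subalgs_def
proof (intro allI impI)
  fix xs :: "('b \<times> 'a) list"
  assume "xs \<noteq> [] \<and> (\<forall>(i, b)\<in>set xs. i \<in> insert k I \<and> b \<in> B i \<and> state S b = 0) \<and> distinct_adj (map
      fst xs)"
  then have xs: "xs \<noteq> []" "\<forall>(i, b)\<in>set xs. i \<in> insert k I \<and> b \<in> B i \<and> state S b = 0" "distinct_adj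
      (map fst xs)"
    by auto
  have carr: "b \<in> carrier S" if "i \<in> insert k I" "b \<in> B i" for i b
    using that B0 BC k by auto
  have "\<exists>ys. word_eval S snd ys = word_eval S snd xs \<and> (ys = [] \<longleftrightarrow> xs = []) \<and>
    (xs \<noteq> [] \<longrightarrow> fst (hd ys) = (fst (hd xs) = k)) \<and> distinct_adj (map fst ys) \<and>
    (\<forall>(c, b)\<in>set ys. b \<in> (if c then C else D) \<and> state S b = 0)"
    using xs(2,3)
  proof (induction "length xs" arbitrary: xs rule: less_induct)
    case less
    show ?case
    proof (cases xs)
      case Nil
      then show ?thesis by (intro exI[of _ "[]"]) simp
    next
      case (Cons x xs')
      obtain t b where x: "x = (t, b)" by force
      show ?thesis
      proof (cases "t = k")
        case True
        have "\<exists>ys. word_eval S snd ys = word_eval S snd xs' \<and> (ys = [] \<longleftrightarrow> xs' = []) \<and>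
          (xs' \<noteq> [] \<longrightarrow> fst (hd ys) = (fst (hd xs') = k)) \<and> distinct_adj (map fst ys) \<and>
          (\<forall>(c, b)\<in>set ys. b \<in> (if c then C else D) \<and> state S b = 0)"
          using less.prems Cons by (intro less.hyps) (auto simp: distinct_adj_Cons)
        then obtain ys where ys: "word_eval S snd ys = word_eval S snd xs'" "ys = [] \<longleftrightarrow> xs' = []"
          "xs' \<noteq> [] \<longrightarrow> fst (hd ys) = (fst (hd xs') = k)" "distinct_adj (map fst ys)"
          "\<forall>(c, b)\<in>set ys. b \<in> (if c then C else D) \<and> state S b = 0" by blast
        have "xs' \<noteq> [] \<Longrightarrow> fst (hd xs') \<noteq> k"
          using less.prems(2) True by (auto simp: Cons x distinct_adj_Cons hd_map)
        then show ?thesis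
          using ys less.prems True k
          by (intro exI[of _ "(True, b) # ys"]) (auto simp: Cons x distinct_adj_Cons hd_map)
      next
        case False
        define as where "as = takeWhile (\<lambda>x. fst x \<noteq> k) xs"
        define bs where "bs = dropWhile (\<lambda>x. fst x \<noteq> k) xs"
        have ab: "xs = as @ bs" by (simp add: as_def bs_def)
        have as: "as \<noteq> []" using False by (simp add: as_def Cons x)
        have bs: "bs \<noteq> [] \<Longrightarrow> fst (hd bs) = k"
          unfolding bs_def using hd_dropWhile[of "\<lambda>x. fst x \<noteq> k" xs] by auto
        have ask: "\<forall>x\<in>set as. fst x \<noteq> k" unfolding as_def by (auto dest: set_takeWhileD)
        have asI: "\<forall>(t, b)\<in>set as. t \<in> I \<and> b \<in> B t \<and> state S b = 0"
        proof clarify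
          fix t b assume tb: "(t, b) \<in> set as"
          then have "t \<noteq> k" "(t, b) \<in> set xs" using ask by (auto simp: ab)
          then show "t \<in> I \<and> b \<in> B t \<and> state S b = 0" using less.prems(1) by auto
        qed
        have dist: "distinct_adj (map fst as)" "distinct_adj (map fst bs)"
          using less.prems(2) by (auto simp: ab distinct_adj_append_iff)
        have cent: "state S (word_eval S snd as) = 0"
          using freeI as asI dist unfolding free_subalgs_def by blast
        have inD: "word_eval S snd as \<in> D"
          using as asI by (intro D) auto
        have "length bs < length xs" using as by (simp add: ab)
        then have "\<exists>ys. word_eval S snd ys = word_eval S snd bs \<and> (ys = [] \<longleftrightarrow> bs = []) \<and>
          (bs \<noteq> [] \<longrightarrow> fst (hd ys) = (fst (hd bs) = k)) \<and> distinct_adj (map fst ys) \<and>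
          (\<forall>(c, b)\<in>set ys. b \<in> (if c then C else D) \<and> state S b = 0)"
          using less.prems(1) dist by (intro less.hyps) (auto simp: ab)
        then obtain ys where ys: "word_eval S snd ys = word_eval S snd bs" "ys = [] \<longleftrightarrow> bs = []"
          "bs \<noteq> [] \<longrightarrow> fst (hd ys) = (fst (hd bs) = k)" "distinct_adj (map fst ys)"
          "\<forall>(c, b)\<in>set ys. b \<in> (if c then C else D) \<and> state S b = 0" by blast
        have "word_eval S snd xs = word_eval S snd as \<otimes> word_eval S snd bs"
        proof -
          have "snd i \<in> carrier S" if "i \<in> set xs" for i
          proof -
            have "fst i \<in> insert k I \<and> snd i \<in> B (fst i)"
              using less.prems(1) that by (simp add: case_prod_unfold)
            then show ?thesis using carr by blast
          qed
          then show ?thesis unfolding ab by (intro word_eval_append) auto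
        qed
        then show ?thesis
          using ys bs cent inD False
          by (intro exI[of _ "(False, word_eval S snd as) # ys"])
            (auto simp: Cons x distinct_adj_Cons hd_map)
      qed
    qed
  qed
  then obtain ys where "word_eval S snd ys = word_eval S snd xs" "ys \<noteq> []" "distinct_adj (map fst ys)"
    "\<forall>(c, b)\<in>set ys. b \<in> (if c then C else D) \<and> state S b = 0" using xs(1) by blast
  then show "state S (word_eval S snd xs) = 0"
    using free2[unfolded free_subalgs_def, rule_format, of ys] by auto
qed

end

text \<open>Each semicircular letter \<open>t < k\<close> is a family of its own, whereas all deterministic letters
  together form the family with index \<open>k\<close>.\<close>

definition letter_class :: "nat \<Rightarrow> nat \<Rightarrow> nat \<Rightarrow> nat set" where
  "letter_class k l t = (if t < k then {t} else {k..<k + l})"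

definition model_state :: "nat \<Rightarrow> 'a nc_space \<Rightarrow> (nat \<Rightarrow> 'a) \<Rightarrow> (nat \<Rightarrow> 'a) \<Rightarrow> nat list \<Rightarrow> complex" where
  "model_state k S w a u = state S (word_eval S (append_tuple k w a) u)"

lemma UN_letter_class: "(\<Union>t\<in>{..k}. letter_class k l t) = {..<k + l}"
  by (auto simp: letter_class_def)

lemma word_free_model:
  assumes "free_product_model k l v \<nu> S w a"
  shows "word_free {..k} (letter_class k l) (model_state k S w a)"
proof -
  interpret nc_prob_space S using assms by (simp add: free_product_model_def)
  define x where "x = append_tuple k w a"
  define B where "B t = (if t < k then star_alg_gen S {w t} else star_alg_gen S (a ` {..<l}))" for t
  have w: "w i \<in> carrier S" if "i < k" for i
    using assms that by (simp add: free_product_model_def semicircular_def)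
  have a: "a j \<in> carrier S" if "j < l" for j
    using assms that by (simp add: free_product_model_def)
  have xc: "x i \<in> carrier S" if "i \<in> {..<k + l}" for i
    using that w a by (auto simp: x_def append_tuple_def)
  have f1: "free_subalgs S {..<k} (\<lambda>i. star_alg_gen S {w i})"
    and f2': "free_subalgs S UNIV (\<lambda>b. star_alg_gen S (if b then a ` {..<l} else w ` {..<k}))"
    using assms by (auto simp: free_product_model_def star_free_def)
  have f1': "free_subalgs S {..<k} B"
    using f1 unfolding free_subalgs_def B_def
    by (auto 0 4 simp: case_prod_unfold)
  have f2: "free_subalgs S UNIV (\<lambda>b. if b then star_alg_gen S (a ` {..<l}) else star_alg_gen S (w
      ` {..<k}))"
    using f2' by (simp add: if_distrib)
  have "free_subalgs S (insert k {..<k}) B"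
  proof (rule free_subalgs_join[OF f1' f2])
    fix xs assume "\<forall>(t, b)\<in>set xs. t \<in> {..<k} \<and> b \<in> B t"
    then show "word_eval S snd xs \<in> star_alg_gen S (w ` {..<k})"
      using star_alg_gen_mono[of "{w _}" "w ` {..<k}"]
      by (intro word_eval_star_alg_gen) (fastforce simp: B_def)
  qed (use star_alg_gen_carrier w a in \<open>auto simp: B_def image_subset_iff\<close>)
  also have "insert k {..<k} = {..k}" by auto
  finally have free: "free_subalgs S {..k} B" .
  show ?thesis
    unfolding word_free_def
  proof (intro allI impI)
    fix Ps assume *: "Ps \<noteq> [] \<and> alt_centred {..k} (letter_class k l) (model_state k S w a) Ps"
    define xs where "xs = map (\<lambda>(t, P). (t, nc_eval S x P)) Ps"
    have *: "Ps \<noteq> []" "distinct_adj (map fst Ps)"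
      "\<And>t P. (t, P) \<in> set Ps \<Longrightarrow> t \<le> k \<and> P \<in> ncpolys (letter_class k l t) \<and> lin_ext (model_state k S
          w a) P = 0"
      using * by (auto simp: alt_centred_def)
    have sub: "ncpolys (letter_class k l t) \<subseteq> ncpolys {..<k + l}" if "t \<le> k" for t
    proof -
      have "letter_class k l t \<subseteq> {..<k + l}" by (auto simp: letter_class_def)
      then show ?thesis using lists_mono unfolding ncpolys_def by blast
    qed
    have Ps: "P \<in> ncpolys {..<k + l}" if "(t, P) \<in> set Ps" for t P
      using *(3)[OF that] sub by blast
    have xs: "nc_eval S x P \<in> B t" "state S (nc_eval S x P) = 0" if "(t, P) \<in> set Ps" for t P
    proof -
      have t: "t \<le> k" "P \<in> ncpolys (letter_class k l t)" "lin_ext (model_state k S w a) P = 0"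
        using *(3)[OF that] by auto
      show "nc_eval S x P \<in> B t"
      proof (cases "t < k")
        case True
        then show ?thesis
          using t(2) w[OF True] nc_eval_star_alg_gen[of "{w t}" P "{t}" x]
          by (simp add: B_def letter_class_def x_def append_tuple_def star_alg_gen.gen)
      next
        case False
        have "x i \<in> a ` {..<l}" if "i \<in> {k..<k + l}" for i
          using that by (auto simp: x_def append_tuple_def)
        then show ?thesis
          using t(2) a False nc_eval_star_alg_gen[of "a ` {..<l}" P "{k..<k + l}" x]
          by (simp add: B_def letter_class_def star_alg_gen.gen image_subset_iff)
      qed
      show "state S (nc_eval S x P) = 0"
        using nc_law_eq_lin_ext[OF Ps[OF that], of x] xc t(3)
        by (simp add: nc_law_def model_state_def[abs_def] x_def)
    qed
    have "state S (word_eval S snd xs) = 0"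
    proof (rule free[unfolded free_subalgs_def, rule_format], intro conjI)
      show "xs \<noteq> []" "distinct_adj (map fst xs)"
        using *(1,2) by (simp_all add: xs_def case_prod_unfold comp_def)
      show "\<forall>(i, b)\<in>set xs. i \<in> {..k} \<and> b \<in> B i \<and> state S b = 0"
        using xs *(3) by (auto simp: xs_def)
    qed
    moreover have "word_eval S snd xs \<in> carrier S"
    proof (rule word_eval_closed)
      fix b assume "b \<in> set xs"
      then show "snd b \<in> carrier S"
        using Ps by (auto simp: xs_def intro!: nc_eval_closed[of _ "{..<k + l}"] xc)
    qed
    moreover have "\<forall>(t, P)\<in>set Ps. P \<in> ncpolys {..<k + l}"
      using Ps by blast
    moreover have "lin_ext (\<lambda>u. state S (\<one>\<^bsub>S\<^esub> \<otimes>\<^bsub>S\<^esub> word_eval S x u)) (poly_prod Ps)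
      = lin_ext (model_state k S w a) (poly_prod Ps)"
    proof (rule lin_ext_fun_cong)
      fix u assume "u \<in> Poly_Mapping.keys (poly_prod Ps)"
      moreover have "poly_prod Ps \<in> ncpolys {..<k + l}"
        using Ps by (intro poly_prod_ncpolys) auto
      ultimately have "u \<in> lists {..<k + l}" by (auto simp: ncpolys_def)
      then have "word_eval S x u \<in> carrier S"
        using xc by (intro word_eval_closed) auto
      then show "state S (\<one>\<^bsub>S\<^esub> \<otimes>\<^bsub>S\<^esub> word_eval S x u) = model_state k S w a u"
        by (simp add: model_state_def x_def)
    qed
    ultimately show "lin_ext (model_state k S w a) (poly_prod Ps) = 0"
      using state_word_eval_nc_eval[of "{..<k + l}" x Ps "\<one>\<^bsub>S\<^esub>", OF xc]
      by (simp add: xs_def)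
  qed
qed

lemma split_sum_replicate:
  "split_sum i F (replicate n i) = (\<Sum>r<n. F (replicate r i) (replicate (n - 1 - r) i))"
proof (induction n arbitrary: F)
  case (Suc n)
  then show ?case
    by (simp add: split_sum_Cons sum.lessThan_Suc_shift del: sum.lessThan_Suc)
qed simp

context nc_prob_space
begin

lemma word_eval_replicate:
  assumes "x i \<in> carrier S"
  shows "word_eval S x (replicate n i) = x i [^]\<^bsub>S\<^esub> n"
proof (induction n)
  case 0
  then show ?case using monoid.nat_pow_0[OF ring.is_monoid[OF ring_S]] by simp
next
  case (Suc n)
  then show ?case using monoid.nat_pow_Suc2[OF ring.is_monoid[OF ring_S]] assms by simp
qed

end

section \<open>Moments of the semicircular distribution\<close>

text \<open>The ratio of consecutive Catalan numbers implies their convolution identity. By the symmetry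
  of the convolution \<open>S n\<close>, weighting its terms with \<open>j + 1\<close> multiplies it by \<open>(n + 2) / 2\<close>. Applying
  the ratio to the weighted sum of order \<open>n + 1\<close> expresses it through \<open>S n\<close>, which gives the ratio
  relation for \<open>S\<close>.\<close>

lemma catalan_convolution:
  fixes c :: "nat \<Rightarrow> real"
  assumes c0: "c 0 = 1" and ratio: "\<And>n. real (n + 2) * c (Suc n) = real (4 * n + 2) * c n"
  shows "(\<Sum>j\<le>n. c j * c (n - j)) = c (Suc n)"
proof (induction n)
  case 0
  then show ?case using c0 ratio[of 0] by simp
next
  case (Suc n)
  define S where "S m = (\<Sum>j\<le>m. c j * c (m - j))" for m
  have sym: "2 * (\<Sum>j\<le>m. real (j + 1) * (c j * c (m - j))) = real (m + 2) * S m" for m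
  proof -
    have "(\<Sum>j\<le>m. real (j + 1) * (c j * c (m - j))) = (\<Sum>j\<le>m. real (m - j + 1) * (c (m - j) * c (m -
        (m - j))))"
      by (rule sum.nat_diff_reindex[symmetric, of _ "Suc m", unfolded lessThan_Suc_atMost
          diff_Suc_Suc, simplified])
    also have "\<dots> = (\<Sum>j\<le>m. real (m - j + 1) * (c j * c (m - j)))"
      by (intro sum.cong) (auto simp: mult.commute)
    finally have "2 * (\<Sum>j\<le>m. real (j + 1) * (c j * c (m - j))) =
      (\<Sum>j\<le>m. real (j + 1) * (c j * c (m - j)) + real (m - j + 1) * (c j * c (m - j)))"
      by (simp add: sum.distrib)
    also have "\<dots> = real (m + 2) * S m"
      unfolding S_def sum_distrib_left
      by (intro sum.cong) (auto simp: of_nat_diff algebra_simps)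
    finally show ?thesis .
  qed
  have "(\<Sum>j\<le>Suc n. real (j + 1) * (c j * c (Suc n - j)))
    = c (Suc n) + (\<Sum>j\<le>n. real (j + 2) * (c (Suc j) * c (n - j)))"
    by (subst sum.atMost_Suc_shift) (simp add: c0 algebra_simps)
  also have "(\<Sum>j\<le>n. real (j + 2) * (c (Suc j) * c (n - j)))
    = (\<Sum>j\<le>n. 4 * (real (j + 1) * (c j * c (n - j))) - 2 * (c j * c (n - j)))"
  proof (intro sum.cong refl)
    fix j
    have "real (j + 2) * (c (Suc j) * c (n - j)) = real (4 * j + 2) * c j * c (n - j)"
      using ratio[of j] by (simp add: mult.assoc[symmetric])
    then show "real (j + 2) * (c (Suc j) * c (n - j)) = 4 * (real (j + 1) * (c j * c (n - j))) - 2
        * (c j * c (n - j))"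
      by (simp add: algebra_simps)
  qed
  also have "\<dots> = 4 * (\<Sum>j\<le>n. real (j + 1) * (c j * c (n - j))) - 2 * S n"
    by (simp add: sum_subtractf sum_distrib_left S_def)
  finally have "real (n + 3) * S (Suc n) = 2 * c (Suc n) + real (4 * n + 4) * S n"
    using sym[of "Suc n"] sym[of n] by (simp add: algebra_simps)
  also have "\<dots> = real (n + 3) * c (Suc (Suc n))"
    using Suc.IH ratio[of "Suc n"] by (simp add: S_def algebra_simps)
  finally show ?case by (simp add: S_def)
qed

definition semicircle_moment :: "real \<Rightarrow> nat \<Rightarrow> real" where
  "semicircle_moment v n = (\<integral>t. t ^ n \<partial>semicircle_measure v)"

lemma semicircle_moment_integral:
  assumes v: "v > 0"
  shows "semicircle_moment v n =
    integral {- 2 * sqrt v..2 * sqrt v} (\<lambda>x. sqrt (4 * v - x\<^sup>2) * x ^ n) / (2 * pi * v)"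
proof -
  define I where "I = {- 2 * sqrt v..2 * sqrt v}"
  have in_I: "x \<in> I \<longleftrightarrow> 0 \<le> 4 * v - x\<^sup>2" for x
  proof -
    have "x\<^sup>2 \<le> (2 * sqrt v)\<^sup>2 \<longleftrightarrow> \<bar>x\<bar> \<le> 2 * sqrt v"
      using abs_le_square_iff[of x "2 * sqrt v"] v by simp
    then show ?thesis using v by (auto simp: I_def power_mult_distrib)
  qed
  have "semicircle_moment v n = (\<integral>x. (sqrt (max 0 (4 * v - x\<^sup>2)) / (2 * pi * v)) * x ^ n \<partial>lborel)"
    unfolding semicircle_moment_def semicircle_measure_def using v
    by (simp add: integral_density)
  also have "\<dots> = (\<integral>x. (indicator I x *\<^sub>R (sqrt (4 * v - x\<^sup>2) * x ^ n)) / (2 * pi * v) \<partial>lborel)"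
    using in_I by (intro Bochner_Integration.integral_cong) (auto simp: indicator_def max_def)
  also have "\<dots> = (\<integral>x. indicator I x *\<^sub>R (sqrt (4 * v - x\<^sup>2) * x ^ n) \<partial>lborel) / (2 * pi * v)"
    by simp
  also have "(\<integral>x. indicator I x *\<^sub>R (sqrt (4 * v - x\<^sup>2) * x ^ n) \<partial>lborel)
    = integral I (\<lambda>x. sqrt (4 * v - x\<^sup>2) * x ^ n)"
    unfolding set_lebesgue_integral_def[symmetric]
    by (intro set_borel_integral_eq_integral)
      (auto simp: I_def intro!: borel_integrable_atLeastAtMost' continuous_intros)
  finally show ?thesis by (simp add: I_def)
qed

text \<open>The function \<open>q(x) (4 v - x\<^sup>2)\<^bsup>3/2\<^esup>\<close> vanishes at both ends of the support, so its derivative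
  has integral zero.\<close>

lemma semicircle_ibp:
  assumes v: "v > 0" and D: "\<And>x. (q has_real_derivative q' x) (at x)"
  shows "((\<lambda>x. sqrt (4 * v - x\<^sup>2) * (q' x * (4 * v - x\<^sup>2) - 3 * x * q x)) has_integral 0)
    {- 2 * sqrt v..2 * sqrt v}"
proof -
  define r where "r = 2 * sqrt v"
  have r2: "r\<^sup>2 = 4 * v" and r0: "r > 0" using v by (auto simp: r_def power_mult_distrib)
  define G where "G x = q x * ((4 * v - x\<^sup>2) * sqrt (4 * v - x\<^sup>2))" for x
  have "((\<lambda>x. sqrt (4 * v - x\<^sup>2) * (q' x * (4 * v - x\<^sup>2) - 3 * x * q x)) has_integral (G r - G (-
      r))) {- r..r}"
  proof (rule fundamental_theorem_of_calculus_interior)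
    have "continuous_on {- r..r} q"
      using D by (meson DERIV_continuous continuous_at_imp_continuous_on)
    then show "continuous_on {- r..r} G"
      unfolding G_def by (intro continuous_intros)
  next
    fix x assume "x \<in> {- r<..<r}"
    then have "\<bar>x\<bar> < \<bar>r\<bar>" by auto
    then have pos: "4 * v - x\<^sup>2 > 0" 
      using abs_le_square_iff[of r x] r2 by linarith
    define s where "s = sqrt (4 * v - x\<^sup>2)"
    have s: "s > 0" "4 * v - x\<^sup>2 = s * s" using pos by (simp_all add: s_def)
    have inner: "((\<lambda>x. 4 * v - x\<^sup>2) has_real_derivative - 2 * x) (at x)"
      by (rule derivative_eq_intros refl)+ simp
    have d: "(G has_real_derivative (q' x * ((4 * v - x\<^sup>2) * s) +
        ((- 2 * x) * s + (inverse s / 2 * (- 2 * x)) * (4 * v - x\<^sup>2)) * q x)) (at x)"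
      unfolding G_def s_def
      by (intro DERIV_mult D inner DERIV_chain2[OF DERIV_real_sqrt[OF pos] inner])
    have e: "(inverse s / 2 * (- 2 * x)) * (4 * v - x\<^sup>2) = - x * s"
      using s by simp
    have "(G has_real_derivative s * (q' x * (4 * v - x\<^sup>2) - 3 * x * q x)) (at x)"
      by (rule DERIV_cong[OF d[unfolded e]]) (simp add: algebra_simps)
    then have "(G has_real_derivative sqrt (4 * v - x\<^sup>2) * (q' x * (4 * v - x\<^sup>2) - 3 * x * q x))
        (at x)"
      by (simp only: s_def)
    then show "(G has_vector_derivative sqrt (4 * v - x\<^sup>2) * (q' x * (4 * v - x\<^sup>2) - 3 * x * q x))
        (at x)"
      by (simp add: has_real_derivative_iff_has_vector_derivative)
  qed (use r0 in simp)
  moreover have "G r = 0" "G (- r) = 0" by (simp_all add: G_def r2)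
  ultimately show ?thesis by (simp add: r_def)
qed

text \<open>Integration by parts with \<open>q = 1\<close> and with \<open>q = x\<^bsup>n + 1\<^esup>\<close>.\<close>

lemma semicircle_moment_ratio:
  assumes v: "v > 0"
  shows "semicircle_moment v 1 = 0"
    and "real (n + 4) * semicircle_moment v (n + 2) = 4 * v * real (n + 1) * semicircle_moment v n"
proof -
  let ?I = "{- 2 * sqrt v..2 * sqrt v}"
  define J where "J n = integral ?I (\<lambda>x. sqrt (4 * v - x\<^sup>2) * x ^ n)" for n
  have mom: "semicircle_moment v n = J n / (2 * pi * v)" for n
    unfolding J_def by (rule semicircle_moment_integral[OF v])
  have J: "((\<lambda>x. sqrt (4 * v - x\<^sup>2) * x ^ n) has_integral J n) ?I" for n
    unfolding J_def by (intro integrable_integral integrable_continuous_real continuous_intros)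
  have "((\<lambda>x. sqrt (4 * v - x\<^sup>2) * (0 * (4 * v - x\<^sup>2) - 3 * x * 1)) has_integral 0) ?I"
    using v by (rule semicircle_ibp) simp
  then have "((\<lambda>x. - 3 * (sqrt (4 * v - x\<^sup>2) * x ^ 1)) has_integral 0) ?I"
    by (simp add: algebra_simps)
  moreover have "((\<lambda>x. - 3 * (sqrt (4 * v - x\<^sup>2) * x ^ 1)) has_integral (- 3 * J 1)) ?I"
    by (intro has_integral_mult_right J)
  ultimately have "- 3 * J 1 = 0" using has_integral_unique by blast
  then show "semicircle_moment v 1 = 0"
    by (simp add: mom)
  have "((\<lambda>x. sqrt (4 * v - x\<^sup>2) * (real (n + 1) * x ^ n * (4 * v - x\<^sup>2) - 3 * x * x ^ (n + 1)))
      has_integral 0) ?I"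
    using v by (rule semicircle_ibp) (use DERIV_pow[of "n + 1"] in simp)
  moreover have "s * (real (n + 1) * x ^ n * (4 * v - x\<^sup>2) - 3 * x * x ^ (n + 1)) =
    (4 * v * real (n + 1)) * (s * x ^ n) - real (n + 4) * (s * x ^ (n + 2))" for x s
    by (simp add: algebra_simps power2_eq_square)
  ultimately have "((\<lambda>x. (4 * v * real (n + 1)) * (sqrt (4 * v - x\<^sup>2) * x ^ n) -
    real (n + 4) * (sqrt (4 * v - x\<^sup>2) * x ^ (n + 2))) has_integral 0) ?I"
    by simp
  moreover have "((\<lambda>x. (4 * v * real (n + 1)) * (sqrt (4 * v - x\<^sup>2) * x ^ n) -
    real (n + 4) * (sqrt (4 * v - x\<^sup>2) * x ^ (n + 2))) has_integral
      (4 * v * real (n + 1)) * J n - real (n + 4) * J (n + 2)) ?I"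
    by (intro has_integral_diff has_integral_mult_right J)
  ultimately have "(4 * v * real (n + 1)) * J n - real (n + 4) * J (n + 2) = 0"
    using has_integral_unique by blast
  then show "real (n + 4) * semicircle_moment v (n + 2) = 4 * v * real (n + 1) * semicircle_moment
      v n"
    by (simp add: mom)
qed

text \<open>The odd moments vanish, and the even ones divided by powers of \<open>v\<close> obey the Catalan ratio, so
  this is the Catalan convolution. The hypothesis \<open>m0\<close> holds if
  \<open>v\<close> is the variance of a semicircular element, since the state of the unit is 1.\<close>

lemma semicircle_moment_recursion:
  assumes v: "v \<ge> 0" and m0: "semicircle_moment v 0 = 1"
  shows "semicircle_moment v (Suc n) =
    v * (\<Sum>r<n. semicircle_moment v r * semicircle_moment v (n - 1 - r))"
proof (cases "v = 0")
  case True
  then show ?thesis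
    by (simp add: semicircle_moment_def semicircle_measure_def integral_return)
next
  case False
  then have v: "v > 0" using v by simp
  define m where "m = semicircle_moment v"
  have odd0: "m (2 * j + 1) = 0" for j
  proof (induction j)
    case 0
    then show ?case using semicircle_moment_ratio(1)[OF v] by (simp add: m_def)
  next
    case (Suc j)
    then show ?case using semicircle_moment_ratio(2)[OF v, of "2 * j + 1"] by (simp add: m_def)
  qed
  define c where "c j = m (2 * j) / v ^ j" for j
  have meven: "m (2 * j) = v ^ j * c j" for j using v by (simp add: c_def)
  have conv: "(\<Sum>j\<le>n. c j * c (n - j)) = c (Suc n)" for n
  proof (rule catalan_convolution)
    show "c 0 = 1" using m0 by (simp add: c_def m_def)
    fix n
    have "real (2 * n + 4) * m (2 * n + 2) = 4 * v * real (2 * n + 1) * m (2 * n)"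
      unfolding m_def by (rule semicircle_moment_ratio(2)[OF v])
    then have "real (2 * n + 4) * (v * v ^ n * c (Suc n)) = 4 * v * real (2 * n + 1) * (v ^ n * c n)"
      using meven[of "Suc n"] meven[of n] by simp
    then have "v * v ^ n * (real (2 * n + 4) * c (Suc n)) = v * v ^ n * (4 * real (2 * n + 1) * c n)"
      by (simp add: algebra_simps)
    then show "real (n + 2) * c (Suc n) = real (4 * n + 2) * c n"
    proof -
      have "v * v ^ n \<noteq> 0" using v by simp
      then have "real (2 * n + 4) * c (Suc n) = 4 * real (2 * n + 1) * c n"
        using \<open>v * v ^ n * _ = _\<close> mult_left_cancel by blast
      then show ?thesis by (simp add: algebra_simps)
    qed
  qed
  show ?thesis
  proof (cases "even n")
    case True
    then obtain j where n: "n = 2 * j" by auto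
    have "m r * m (n - 1 - r) = 0" if "r < n" for r
    proof (cases "even r")
      case True
      then obtain i where "r = 2 * i" by auto
      then have "n - 1 - r = 2 * (j - 1 - i) + 1" using that n by simp
      then show ?thesis using odd0 by simp
    next
      case False
      then show ?thesis using odd0 by (auto elim: oddE)
    qed
    then have "(\<Sum>r<n. m r * m (n - 1 - r)) = 0" by (intro sum.neutral) auto
    then show ?thesis using odd0[of j] by (simp add: m_def n)
  next
    case False
    then obtain j where n: "n = 2 * j + 1" by (auto elim: oddE)
    have "(\<Sum>r<n. m r * m (n - 1 - r)) = (\<Sum>r\<in>(\<lambda>i. 2 * i) ` {..j}. m r * m (n - 1 - r))"
    proof (rule sum.mono_neutral_right)
      show "\<forall>r\<in>{..<n} - (\<lambda>i. 2 * i) ` {..j}. m r * m (n - 1 - r) = 0"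
      proof
        fix r assume r: "r \<in> {..<n} - (\<lambda>i. 2 * i) ` {..j}"
        have "odd r"
        proof
          assume "even r"
          then obtain i where "r = 2 * i" by auto
          with r n show False by auto
        qed
        then show "m r * m (n - 1 - r) = 0" using odd0 by (auto elim: oddE)
      qed
    qed (auto simp: n)
    also have "\<dots> = (\<Sum>i\<le>j. m (2 * i) * m (2 * (j - i)))"
      by (subst sum.reindex) (auto simp: inj_on_def n diff_mult_distrib2)
    also have "\<dots> = (\<Sum>i\<le>j. v ^ j * (c i * c (j - i)))"
      by (intro sum.cong) (auto simp: meven power_add[symmetric])
    also have "\<dots> = v ^ j * c (Suc j)"
      by (simp add: sum_distrib_left[symmetric] conv)
    finally show ?thesis
      using meven[of "Suc j"] by (simp add: m_def n)
  qed
qed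

section \<open>Moments of Gaussian variables\<close>

definition gauss_moment :: "real \<Rightarrow> nat \<Rightarrow> real" where
  "gauss_moment v n = (if even n then v ^ (n div 2) * fact n / (2 ^ (n div 2) * fact (n div 2))
      else 0)"

lemma gauss_moment_Suc: "gauss_moment v (Suc n) = v * real n * gauss_moment v (n - 1)"
proof (cases "odd n")
  case True
  then obtain m where n: "n = 2 * m + 1" by (auto elim: oddE)
  have "v ^ Suc m * fact (2 * m + 2) / (2 ^ Suc m * fact (Suc m)) =
      v * real (2 * m + 1) * (v ^ m * fact (2 * m) / (2 ^ m * fact m))"
  proof -
    have "(fact (2 * m + 2) :: real) = (2 * real (m + 1)) * (real (2 * m + 1) * fact (2 * m))"
      by (simp add: fact_reduce algebra_simps)
    moreover have "(fact (Suc m) :: real) = real (m + 1) * fact m" by simp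
    ultimately show ?thesis
      by (simp add: divide_simps del: of_nat_Suc fact_Suc)
  qed
  then show ?thesis by (simp add: gauss_moment_def n)
next
  case False
  then show ?thesis by (cases n) (auto simp: gauss_moment_def)
qed

lemma gaussian_measure_moment:
  assumes v: "v \<ge> 0"
  shows "integrable (gaussian_measure v) (\<lambda>t. t ^ n)"
    and "(\<integral>t. t ^ n \<partial>gaussian_measure v) = gauss_moment v n"
proof -
  have "integrable (gaussian_measure v) (\<lambda>t. t ^ n) \<and> (\<integral>t. t ^ n \<partial>gaussian_measure v) =
      gauss_moment v n"
  proof (cases "v = 0")
    case True
    interpret R: prob_space "return borel (0::real)" by (rule prob_space_return) simp
    have "integrable (return borel 0) (\<lambda>t::real. t ^ n)"
    proof (rule R.integrable_const_bound[where B = 1])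
      show "AE x in return borel (0::real). norm (x ^ n) \<le> 1"
        by (subst AE_return) (auto simp: power_le_one power_0_left)
    qed simp
    moreover have "(\<integral>t. t ^ n \<partial>return borel (0::real)) = gauss_moment 0 n"
      by (subst integral_return) (auto simp: gauss_moment_def power_0_left elim!: evenE)
    ultimately show ?thesis using True by (simp add: gaussian_measure_def)
  next
    case False
    then have s: "sqrt v > 0" using v by simp
    have "has_bochner_integral lborel (\<lambda>x. normal_density 0 (sqrt v) x * x ^ n) (gauss_moment v n)"
    proof (cases "even n")
      case True
      then obtain m where n: "n = 2 * m" by auto
      have "fact (2 * m) / ((2 / (sqrt v)\<^sup>2) ^ m * fact m) = gauss_moment v n"
        using False v by (simp add: n gauss_moment_def power_divide field_simps)
      then show ?thesis using normal_moment_even[OF s, of 0 m] by (simp add: n)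
    next
      case False
      then obtain m where n: "n = 2 * m + 1" by (auto elim: oddE)
      then show ?thesis using normal_moment_odd[OF s, of 0 m] by (simp add: n gauss_moment_def)
    qed
    then show ?thesis
      using False by (simp add: gaussian_measure_def has_bochner_integral_iff integrable_density
          integral_density)
  qed
  then show "integrable (gaussian_measure v) (\<lambda>t. t ^ n)"
    "(\<integral>t. t ^ n \<partial>gaussian_measure v) = gauss_moment v n" by auto
qed

lemma centred_gaussian_moment:
  assumes "centred_gaussian M v X" and v: "v \<ge> 0"
  shows "integrable M (\<lambda>\<omega>. X \<omega> ^ n)" and "(\<integral>\<omega>. X \<omega> ^ n \<partial>M) = gauss_moment v n"
proof -
  have X: "X \<in> borel_measurable M" and d: "distr M borel X = gaussian_measure v"
    using assms by (auto simp: centred_gaussian_def)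
  show "integrable M (\<lambda>\<omega>. X \<omega> ^ n)"
    using integrable_distr_eq[OF X, of "\<lambda>t. t ^ n"] gaussian_measure_moment(1)[OF v, of n] d by simp
  show "(\<integral>\<omega>. X \<omega> ^ n \<partial>M) = gauss_moment v n"
    using integral_distr[OF X, of "\<lambda>t. t ^ n"] gaussian_measure_moment(2)[OF v, of n] d by simp
qed

lemma centred_complex_gaussian_integrable:
  assumes Z: "centred_complex_gaussian M Z"
  shows "integrable M (\<lambda>\<omega>. Z \<omega> ^ p * cnj (Z \<omega>) ^ q)"
proof -
  have Zm: "Z \<in> borel_measurable M" using Z by (simp add: centred_complex_gaussian_def)
  have ab: "integrable M (\<lambda>\<omega>. (a * Re (Z \<omega>) + b * Im (Z \<omega>)) ^ n)" for a b n
    using Z centred_gaussian_moment(1) unfolding centred_complex_gaussian_def by blast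
  define n where "n = p + q"
  have "integrable M (\<lambda>\<omega>. \<bar>Re (Z \<omega>) ^ n\<bar>)" "integrable M (\<lambda>\<omega>. \<bar>Im (Z \<omega>) ^ n\<bar>)"
    using ab[of 1 0 n] ab[of 0 1 n] by (simp_all add: integrable_abs)
  then have "integrable M (\<lambda>\<omega>. 2 ^ n * (\<bar>Re (Z \<omega>) ^ n\<bar> + \<bar>Im (Z \<omega>) ^ n\<bar>))"
    by (intro integrable_mult_right Bochner_Integration.integrable_add)
  then show ?thesis
  proof (rule Bochner_Integration.integrable_bound)
    show "(\<lambda>\<omega>. Z \<omega> ^ p * cnj (Z \<omega>) ^ q) \<in> borel_measurable M"
      using Zm by (intro borel_measurable_times borel_measurable_power)
        (auto intro!: borel_measurable_continuous_on[where f = cnj] continuous_intros)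
    have "cmod (z ^ p * cnj z ^ q) \<le> \<bar>2 ^ n * (\<bar>Re z ^ n\<bar> + \<bar>Im z ^ n\<bar>)\<bar>" for z
    proof -
      have "cmod (z ^ p * cnj z ^ q) = cmod z ^ n"
        by (simp add: norm_mult norm_power n_def power_add)
      also have "\<dots> \<le> (2 * max \<bar>Re z\<bar> \<bar>Im z\<bar>) ^ n"
        using cmod_le[of z] by (intro power_mono) auto
      also have "\<dots> \<le> 2 ^ n * (\<bar>Re z\<bar> ^ n + \<bar>Im z\<bar> ^ n)"
        by (auto simp: power_mult_distrib max_def)
      finally show ?thesis by (simp add: power_abs)
    qed
    then show "AE \<omega> in M. norm (Z \<omega> ^ p * cnj (Z \<omega>) ^ q) \<le> norm (2 ^ n * (\<bar>Re (Z \<omega>) ^ n\<bar> + \<bar>Im (Z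
        \<omega>) ^ n\<bar>))"
      by simp
  qed
qed

lemma polynomial_zero_on_unit_circle:
  fixes c :: "nat \<Rightarrow> complex"
  assumes "\<And>x. cmod x = 1 \<Longrightarrow> (\<Sum>j\<le>n. c j * x ^ j) = 0" and "j \<le> n"
  shows "c j = 0"
proof (rule ccontr)
  assume "c j \<noteq> 0"
  then have fin: "finite {z. (\<Sum>i\<le>n. c i * z ^ i) = 0}"
    using polyfun_finite_roots[of c n] assms(2) by blast
  \<comment> \<open>The unit circle is infinite: cos is injective on the interval from 0 to pi, hence cis is so
      on a smaller one.\<close>
  have "cis ` {0..1} \<subseteq> {z. (\<Sum>i\<le>n. c i * z ^ i) = 0}"
    using assms(1) by auto
  then have "finite (cis ` {0..1})" using fin finite_subset by blast
  moreover have "inj_on cis {0..1}"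
  proof (rule inj_onI)
    fix x y :: real assume xy: "x \<in> {0..1}" "y \<in> {0..1}" "cis x = cis y"
    then have "0 \<le> x" "x \<le> 1" "0 \<le> y" "y \<le> 1" by simp_all
    moreover from this have "x \<le> pi" "y \<le> pi" using pi_gt3 by linarith+
    moreover have "cos x = cos y" using arg_cong[OF xy(3), of Re] by simp
    ultimately show "x = y" using cos_inj_pi by blast
  qed
  ultimately have "finite {0..1::real}" using finite_imageD by blast
  then show False by (simp add: infinite_Icc)
qed

text \<open>The two second moments force \<open>Re (z Z)\<close> to have variance \<open>s / 2\<close> for every \<open>z\<close> on the unit
  circle, so its moments do not depend on \<open>z\<close>. The \<open>n\<close>-th of them, multiplied by \<open>(2 z)\<^sup>n\<close>, is a
  polynomial in \<open>z\<^sup>2\<close> whose coefficients are the mixed moments of \<open>Z\<close> of total degree \<open>n\<close> with binomial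
  weights. Comparing coefficients determines all of them.\<close>

lemma centred_complex_gaussian_moment:
  assumes Z: "centred_complex_gaussian M Z"
    and EZ2: "(\<integral>\<omega>. (cmod (Z \<omega>))\<^sup>2 \<partial>M) = s" and EZZ: "(\<integral>\<omega>. (Z \<omega>)\<^sup>2 \<partial>M) = 0"
  shows "(\<integral>\<omega>. Z \<omega> ^ p * cnj (Z \<omega>) ^ q \<partial>M) = (if p = q then of_real (fact p * s ^ p) else 0)"
proof -
  note int = centred_complex_gaussian_integrable[OF Z]
  define m where "m p q = (\<integral>\<omega>. Z \<omega> ^ p * cnj (Z \<omega>) ^ q \<partial>M)" for p q
  have sq: "(2 * Re (z * w))\<^sup>2 = 2 * (cmod w)\<^sup>2 + 2 * Re (z\<^sup>2 * w\<^sup>2)" if "cmod z = 1" for z w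
  proof -
    have "(2 * Re u)\<^sup>2 = 2 * (cmod u)\<^sup>2 + 2 * Re (u\<^sup>2)" for u
      unfolding cmod_power2 by (simp add: power2_eq_square)
    then have "(2 * Re (z * w))\<^sup>2 = 2 * (cmod (z * w))\<^sup>2 + 2 * Re ((z * w)\<^sup>2)" .
    also have "cmod (z * w) = cmod w" using that by (simp only: norm_mult mult_1)
    also have "(z * w)\<^sup>2 = z\<^sup>2 * w\<^sup>2" by (rule power_mult_distrib)
    finally show ?thesis .
  qed
  have rot: "(\<integral>\<omega>. (2 * Re (z * Z \<omega>)) ^ n \<partial>M) = 2 ^ n * gauss_moment (s / 2) n" if z: "cmod z = 1"
      for z n
  proof -
    obtain v where v: "v \<ge> 0" "centred_gaussian M v (\<lambda>\<omega>. Re z * Re (Z \<omega>) + (- Im z) * Im (Z \<omega>))"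
      using Z unfolding centred_complex_gaussian_def by blast
    then have g: "centred_gaussian M v (\<lambda>\<omega>. Re (z * Z \<omega>))" by simp
    have "4 * v = 4 * (\<integral>\<omega>. (Re (z * Z \<omega>)) ^ 2 \<partial>M)"
      using centred_gaussian_moment(2)[OF g v(1), of 2] by (simp add: gauss_moment_def)
    also have "\<dots> = (\<integral>\<omega>. (2 * Re (z * Z \<omega>))\<^sup>2 \<partial>M)"
    proof -
      have "(2 * r)\<^sup>2 = 4 * r\<^sup>2" for r :: real by (simp add: power_mult_distrib)
      then show ?thesis by (simp only: integral_mult_right_zero)
    qed
    also have "\<dots> = (\<integral>\<omega>. 2 * (cmod (Z \<omega>))\<^sup>2 + 2 * Re (z\<^sup>2 * (Z \<omega>)\<^sup>2) \<partial>M)"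
      by (simp only: sq[OF z])
    also have "\<dots> = 2 * (\<integral>\<omega>. (cmod (Z \<omega>))\<^sup>2 \<partial>M) + 2 * Re (z\<^sup>2 * (\<integral>\<omega>. (Z \<omega>)\<^sup>2 \<partial>M))"
    proof -
      have i2: "integrable M (\<lambda>\<omega>. (Z \<omega>)\<^sup>2)" using int[of 2 0] by simp
      have i3: "integrable M (\<lambda>\<omega>. z\<^sup>2 * (Z \<omega>)\<^sup>2)" using i2 by (intro integrable_mult_right)
      have i1: "integrable M (\<lambda>\<omega>. (cmod (Z \<omega>))\<^sup>2)"
        using integrable_norm[OF int[of 1 1]] by (simp add: norm_mult power2_eq_square)
      show ?thesis
        using i1 integrable_Re[OF i3]
        by (simp only: Bochner_Integration.integral_add integrable_mult_right
            integral_mult_right_zero integral_Re[OF i3])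
    qed
    also have "\<dots> = 2 * s" by (simp add: EZ2 EZZ)
    finally have "v = s / 2" by simp
    then show ?thesis
      using centred_gaussian_moment(2)[OF g v(1), of n] \<open>v = s / 2\<close>
      by (simp only: power_mult_distrib integral_mult_right_zero)
  qed
  have key: "of_nat (n choose j) * m j (n - j) = (if 2 * j = n then of_real (2 ^ n * gauss_moment
      (s / 2) n) else 0)"
    if "j \<le> n" for j n
  proof -
    define c where "c j = of_nat (n choose j) * m j (n - j) - (if 2 * j = n then of_real (2 ^ n *
        gauss_moment (s / 2) n) else 0)" for j
    have "c j = 0"
    proof (rule polynomial_zero_on_unit_circle[OF _ that])
      fix x :: complex assume x: "cmod x = 1"
      define z where "z = csqrt x"
      have z2: "z ^ 2 = x" and z1: "cmod z = 1"
        using x by (simp_all add: z_def)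
      have zz: "z * cnj z = 1" using z1 complex_norm_square[of z] by simp
      have "(\<Sum>j\<le>n. of_nat (n choose j) * m j (n - j) * x ^ j)
        = (\<integral>\<omega>. (\<Sum>j\<le>n. (of_nat (n choose j) * x ^ j) * (Z \<omega> ^ j * cnj (Z \<omega>) ^ (n - j))) \<partial>M)"
        unfolding m_def using int
        by (subst Bochner_Integration.integral_sum) (auto simp: mult_ac)
      also have "\<dots> = (\<integral>\<omega>. z ^ n * of_real ((2 * Re (z * Z \<omega>)) ^ n) \<partial>M)"
      proof (rule Bochner_Integration.integral_cong[OF refl])
        fix \<omega>
        have "z * (cnj z * cnj (Z \<omega>)) = cnj (Z \<omega>)"
          by (simp only: mult.assoc[symmetric] zz mult_1)
        then have "x * Z \<omega> + cnj (Z \<omega>) = z * (z * Z \<omega> + cnj (z * Z \<omega>))"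
          by (simp only: distrib_left z2[symmetric] power2_eq_square mult.assoc complex_cnj_mult)
        also have "\<dots> = z * of_real (2 * Re (z * Z \<omega>))"
          by (simp only: complex_add_cnj)
        finally have e: "x * Z \<omega> + cnj (Z \<omega>) = z * of_real (2 * Re (z * Z \<omega>))" .
        have "(\<Sum>j\<le>n. (of_nat (n choose j) * x ^ j) * (Z \<omega> ^ j * cnj (Z \<omega>) ^ (n - j)))
          = (x * Z \<omega> + cnj (Z \<omega>)) ^ n"
          by (simp add: binomial_ring power_mult_distrib mult_ac)
        also have "\<dots> = z ^ n * of_real ((2 * Re (z * Z \<omega>)) ^ n)"
          unfolding e power_mult_distrib[of z] of_real_power ..
        finally show "(\<Sum>j\<le>n. (of_nat (n choose j) * x ^ j) * (Z \<omega> ^ j * cnj (Z \<omega>) ^ (n - j)))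
          = z ^ n * of_real ((2 * Re (z * Z \<omega>)) ^ n)" .
      qed
      also have "\<dots> = z ^ n * of_real (\<integral>\<omega>. (2 * Re (z * Z \<omega>)) ^ n \<partial>M)"
        by (simp only: integral_mult_right_zero integral_complex_of_real)
      also have "\<dots> = z ^ n * of_real (2 ^ n * gauss_moment (s / 2) n)"
        by (simp only: rot[OF z1])
      finally have 1: "(\<Sum>j\<le>n. of_nat (n choose j) * m j (n - j) * x ^ j) = z ^ n * of_real (2 ^ n
          * gauss_moment (s / 2) n)" .
      have 2: "(\<Sum>j\<le>n. (if 2 * j = n then G else 0) * x ^ j) = z ^ n * G"
        if "odd n \<Longrightarrow> G = 0" for G
      proof (cases "even n")
        case True
        then obtain h where h: "n = 2 * h" by auto
        have "(\<Sum>j\<le>n. (if 2 * j = n then G else 0) * x ^ j) = (\<Sum>j\<le>n. if j = h then G * x ^ j else 0)"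
          by (intro sum.cong) (auto simp: h)
        also have "\<dots> = G * x ^ h" by (simp add: h)
        also have "x ^ h = z ^ n" by (simp add: h z2[symmetric] power_mult)
        finally show ?thesis by (simp only: mult.commute)
      next
        case False
        then show ?thesis using that by simp
      qed
      have odd: "odd n \<Longrightarrow> complex_of_real (2 ^ n * gauss_moment (s / 2) n) = 0"
        by (simp add: gauss_moment_def)
      show "(\<Sum>j\<le>n. c j * x ^ j) = 0"
      proof -
        have "(\<Sum>j\<le>n. c j * x ^ j) = (\<Sum>j\<le>n. of_nat (n choose j) * m j (n - j) * x ^ j) -
            (\<Sum>j\<le>n. (if 2 * j = n then complex_of_real (2 ^ n * gauss_moment (s / 2) n) else 0) * x
                ^ j)"
          by (simp only: c_def left_diff_distrib sum_subtractf)
        also have "(\<Sum>j\<le>n. (if 2 * j = n then complex_of_real (2 ^ n * gauss_moment (s / 2) n) else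
            0) * x ^ j)
            = z ^ n * complex_of_real (2 ^ n * gauss_moment (s / 2) n)"
          by (rule 2) (rule odd)
        finally show ?thesis using 1 by (simp only: diff_self)
      qed
    qed
    then show ?thesis by (simp add: c_def)
  qed
  have "m p q = (if p = q then of_real (fact p * s ^ p) else 0)"
  proof (cases "p = q")
    case False
    then show ?thesis using key[of p "p + q"] by auto
  next
    case True
    have "real ((2 * p) choose p) = fact (2 * p) / (fact p * fact p)"
      using binomial_fact[of p "2 * p", where ?'a = real] by simp
    moreover have "2 ^ (2 * p) * gauss_moment (s / 2) (2 * p) = s ^ p * fact (2 * p) / fact p"
    proof -
      have "(2::real) ^ (2 * p) = 2 ^ p * 2 ^ p" by (simp only: mult_2 power_add)
      then show ?thesis by (simp add: gauss_moment_def power_divide)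
    qed
    moreover have "of_real (real ((2 * p) choose p)) * m p p = of_real (2 ^ (2 * p) * gauss_moment
        (s / 2) (2 * p))"
      using key[of p "2 * p"] by simp
    ultimately have "of_real (fact (2 * p) / (fact p * fact p)) * m p p = complex_of_real (s ^ p *
        fact (2 * p) / fact p)"
      by metis
    moreover have "complex_of_real (fact (2 * p) / (fact p * fact p)) \<noteq> 0"
      by (simp del: of_real_divide)
    ultimately have "m p p = complex_of_real (s ^ p * fact (2 * p) / fact p) / of_real (fact (2 *
        p) / (fact p * fact p))"
      by (metis nonzero_mult_div_cancel_left)
    also have "\<dots> = of_real (s ^ p * fact (2 * p) / fact p / (fact (2 * p) / (fact p * fact p)))"
      by (rule of_real_divide[symmetric])
    also have "s ^ p * fact (2 * p) / fact p / (fact (2 * p) / (fact p * fact p)) = fact p * s ^ p"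
      by simp
    finally show ?thesis using True by simp
  qed
  then show ?thesis by (simp add: m_def)
qed

section \<open>Wick's formula for the entries of independent GUE matrices\<close>

text \<open>The index \<open>(r, (i, j))\<close> refers to the entry \<open>(i, j)\<close> of the \<open>r\<close>-th matrix.\<close>

definition mat_entry :: "(nat \<Rightarrow> 'w \<Rightarrow> complex mat) \<Rightarrow> nat \<times> nat \<times> nat \<Rightarrow> 'w \<Rightarrow> complex" where
  "mat_entry W x \<omega> = W (fst x) \<omega> $$ snd x"

definition entry_monomial :: "(nat \<Rightarrow> 'w \<Rightarrow> complex mat) \<Rightarrow> (nat \<times> nat \<times> nat) multiset \<Rightarrow> 'w \<Rightarrow>
    complex" where
  "entry_monomial W L \<omega> = (\<Prod>x\<in>#L. mat_entry W x \<omega>)"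

definition transpose_index :: "nat \<times> nat \<times> nat \<Rightarrow> nat \<times> nat \<times> nat" where
  "transpose_index x = (fst x, prod.swap (snd x))"

definition entry_indices :: "nat \<Rightarrow> nat \<Rightarrow> (nat \<times> nat \<times> nat) set" where
  "entry_indices k N = {..<k} \<times> {..<N} \<times> {..<N}"

definition upper_indices :: "nat \<Rightarrow> (nat \<times> nat) set" where
  "upper_indices N = {(i, j). i \<le> j \<and> j < N}"

lemma upper_indices_subset: "upper_indices N \<subseteq> {..<N} \<times> {..<N}"
  by (auto simp: upper_indices_def)

lemma finite_upper_indices [simp]: "finite (upper_indices N)"
  using upper_indices_subset finite_subset by blast

lemma prod_square_upper_indices:
  fixes g :: "nat \<times> nat \<Rightarrow> 'a :: comm_monoid_mult"
  shows "(\<Prod>p\<in>{..<N} \<times> {..<N}. g p) =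
    (\<Prod>p\<in>upper_indices N. if fst p = snd p then g p else g p * g (prod.swap p))"
proof -
  define U where "U = {p\<in>upper_indices N. fst p \<noteq> snd p}"
  have split: "{..<N} \<times> {..<N} = upper_indices N \<union> prod.swap ` U"
  proof (intro equalityI subsetI)
    fix p assume p: "p \<in> {..<N} \<times> {..<N}"
    show "p \<in> upper_indices N \<union> prod.swap ` U"
    proof (cases "fst p \<le> snd p")
      case True
      then show ?thesis using p by (auto simp: upper_indices_def)
    next
      case False
      then have "prod.swap p \<in> U" using p by (auto simp: U_def upper_indices_def)
      then have "prod.swap (prod.swap p) \<in> prod.swap ` U" by (rule imageI)
      then show ?thesis by simp
    qed
  qed (auto simp: U_def upper_indices_def)
  have "(\<Prod>p\<in>{..<N} \<times> {..<N}. g p) = (\<Prod>p\<in>upper_indices N. g p) * (\<Prod>p\<in>prod.swap ` U. g p)"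
  proof -
    have "finite U" by (simp add: U_def)
    moreover have "upper_indices N \<inter> prod.swap ` U = {}" by (auto simp: U_def upper_indices_def)
    ultimately show ?thesis by (simp only: split prod.union_disjoint finite_upper_indices
        finite_imageI)
  qed
  also have "(\<Prod>p\<in>prod.swap ` U. g p) = (\<Prod>p\<in>U. g (prod.swap p))"
    by (subst prod.reindex) auto
  also have "\<dots> = (\<Prod>p\<in>upper_indices N. if fst p \<noteq> snd p then g (prod.swap p) else 1)"
    unfolding U_def by (rule prod.inter_filter) simp
  also have "(\<Prod>p\<in>upper_indices N. g p) * \<dots> =
    (\<Prod>p\<in>upper_indices N. if fst p = snd p then g p else g p * g (prod.swap p))"
    unfolding prod.distrib[symmetric] by (intro prod.cong) auto
  finally show ?thesis .
qed

text \<open>If \<open>c\<close> counts the occurrences of the entries of one matrix in a monomial, this is the part of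
  the monomial that depends on the entry \<open>z\<close> at the position \<open>p\<close> on or above the diagonal. An
  occurrence of the transposed position contributes \<open>cnj z\<close>.\<close>

definition entry_factor :: "(nat \<times> nat \<Rightarrow> nat) \<Rightarrow> nat \<times> nat \<Rightarrow> complex \<Rightarrow> complex" where
  "entry_factor c p z = (if fst p = snd p then z ^ c p else z ^ c p * cnj z ^ c (prod.swap p))"

definition entry_factor_moment :: "real \<Rightarrow> (nat \<times> nat \<Rightarrow> nat) \<Rightarrow> nat \<times> nat \<Rightarrow> real" where
  "entry_factor_moment v c p = (if fst p = snd p then gauss_moment v (c p)
     else if c p = c (prod.swap p) then fact (c p) * v ^ c p else 0)"

lemma entry_factor_measurable: "entry_factor c p \<in> borel_measurable borel"
  by (cases "fst p = snd p")
    (auto simp: entry_factor_def[abs_def] intro!: borel_measurable_continuous_onI continuous_intros)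

locale gue_family = prob_space M for M :: "'w measure" +
  fixes k N :: nat and v :: real and W :: "nat \<Rightarrow> 'w \<Rightarrow> complex mat"
  assumes GUE: "i < k \<Longrightarrow> GUE M N v (W i)"
    and indep: "indep_mats M N W {..<k}"
    and v_nonneg: "v \<ge> 0"
begin

lemma W_carrier: "i < k \<Longrightarrow> \<omega> \<in> space M \<Longrightarrow> W i \<omega> \<in> carrier_mat N N"
  using GUE by (auto simp: GUE_def)

lemma W_hermitian:
  assumes "i < k" "\<omega> \<in> space M" "a < N" "b < N"
  shows "W i \<omega> $$ (b, a) = cnj (W i \<omega> $$ (a, b))"
proof -
  have "mat_adjoint (W i \<omega>) = W i \<omega>" using GUE[OF assms(1)] assms(2) by (auto simp: GUE_def)
  then show ?thesis
    using mat_adjoint_index[OF W_carrier[OF assms(1,2)] assms(4,3)] by simp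
qed

lemma entry_monomial_eq_prod:
  assumes \<omega>: "\<omega> \<in> space M" and L: "set_mset L \<subseteq> entry_indices k N"
  shows "entry_monomial W L \<omega> = (\<Prod>i<k. \<Prod>p\<in>upper_indices N. entry_factor (\<lambda>p. count L (i, p)) p (W
      i \<omega> $$ p))"
proof -
  have "entry_monomial W L \<omega> = (\<Prod>y\<in>set_mset L. mat_entry W y \<omega> ^ count L y)"
    unfolding entry_monomial_def by (rule image_prod_mset_multiplicity)
  also have "\<dots> = (\<Prod>y\<in>entry_indices k N. mat_entry W y \<omega> ^ count L y)"
    by (rule prod.mono_neutral_left[OF _ L]) (auto simp: entry_indices_def not_in_iff)
  also have "\<dots> = (\<Prod>i<k. \<Prod>p\<in>{..<N} \<times> {..<N}. W i \<omega> $$ p ^ count L (i, p))"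
    unfolding entry_indices_def mat_entry_def by (subst prod.cartesian_product) (simp add:
        case_prod_unfold)
  also have "\<dots> = (\<Prod>i<k. \<Prod>p\<in>upper_indices N. entry_factor (\<lambda>p. count L (i, p)) p (W i \<omega> $$ p))"
  proof (rule prod.cong[OF refl], unfold prod_square_upper_indices, rule prod.cong[OF refl])
    fix i p assume i: "i \<in> {..<k}" and p: "p \<in> upper_indices N"
    have "W i \<omega> $$ prod.swap p = cnj (W i \<omega> $$ p)"
      using W_hermitian[OF _ \<omega>, of i "fst p" "snd p"] i p by (cases p) (auto simp: upper_indices_def)
    then show "(if fst p = snd p then W i \<omega> $$ p ^ count L (i, p)
        else W i \<omega> $$ p ^ count L (i, p) * W i \<omega> $$ prod.swap p ^ count L (i, prod.swap p)) =
      entry_factor (\<lambda>p. count L (i, p)) p (W i \<omega> $$ p)"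
      by (simp add: entry_factor_def)
  qed
  finally show ?thesis .
qed

lemma entry_factor_expectation:
  assumes i: "i < k" and p: "p \<in> upper_indices N"
  shows "integrable M (\<lambda>\<omega>. entry_factor c p (W i \<omega> $$ p))"
    and "(\<integral>\<omega>. entry_factor c p (W i \<omega> $$ p) \<partial>M) = entry_factor_moment v c p"
proof -
  obtain a b where ab: "p = (a, b)" "a \<le> b" "b < N" using p by (auto simp: upper_indices_def)
  have "integrable M (\<lambda>\<omega>. entry_factor c p (W i \<omega> $$ p)) \<and>
    (\<integral>\<omega>. entry_factor c p (W i \<omega> $$ p) \<partial>M) = entry_factor_moment v c p"
  proof (cases "a = b")
    case True
    have g: "centred_gaussian M v (\<lambda>\<omega>. Re (W i \<omega> $$ (b, b)))"
      using GUE[OF i] ab by (auto simp: GUE_def)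
    have eq: "entry_factor c p (W i \<omega> $$ p) = complex_of_real (Re (W i \<omega> $$ (b, b)) ^ c p)" if "\<omega>
        \<in> space M" for \<omega>
    proof -
      have "W i \<omega> $$ (b, b) = complex_of_real (Re (W i \<omega> $$ (b, b)))"
        using W_hermitian[OF i that ab(3,3)] by (metis Reals_cnj_iff of_real_Re)
      then show ?thesis using True ab(1) by (simp add: entry_factor_def)
    qed
    have "integrable M (\<lambda>\<omega>. complex_of_real (Re (W i \<omega> $$ (b, b)) ^ c p))"
      using centred_gaussian_moment(1)[OF g v_nonneg] by (intro integrable_of_real)
    moreover have "(\<integral>\<omega>. complex_of_real (Re (W i \<omega> $$ (b, b)) ^ c p) \<partial>M) = entry_factor_moment v c p"
      using centred_gaussian_moment(2)[OF g v_nonneg] True ab(1)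
      by (simp only: integral_complex_of_real) (simp add: entry_factor_moment_def)
    moreover have "integrable M (\<lambda>\<omega>. entry_factor c p (W i \<omega> $$ p)) =
        integrable M (\<lambda>\<omega>. complex_of_real (Re (W i \<omega> $$ (b, b)) ^ c p))"
      by (intro Bochner_Integration.integrable_cong refl eq)
    moreover have "expectation (\<lambda>\<omega>. entry_factor c p (W i \<omega> $$ p)) =
        expectation (\<lambda>\<omega>. complex_of_real (Re (W i \<omega> $$ (b, b)) ^ c p))"
      by (intro Bochner_Integration.integral_cong refl eq)
    ultimately show ?thesis by metis
  next
    case False
    then have "a < b" using ab by simp
    then have Z: "centred_complex_gaussian M (\<lambda>\<omega>. W i \<omega> $$ p)"
      and m2: "(\<integral>\<omega>. (cmod (W i \<omega> $$ p))\<^sup>2 \<partial>M) = v" "(\<integral>\<omega>. (W i \<omega> $$ p)\<^sup>2 \<partial>M) = 0"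
      using GUE[OF i] ab by (auto simp: GUE_def)
    show ?thesis
      using centred_complex_gaussian_integrable[OF Z] False ab(1)
        centred_complex_gaussian_moment[OF Z m2]
      by (simp add: entry_factor_def entry_factor_moment_def)
  qed
  then show "integrable M (\<lambda>\<omega>. entry_factor c p (W i \<omega> $$ p))"
    "(\<integral>\<omega>. entry_factor c p (W i \<omega> $$ p) \<partial>M) = entry_factor_moment v c p" by auto
qed

lemma matrix_entry_factor_expectation:
  assumes i: "i < k"
  shows "integrable M (\<lambda>\<omega>. \<Prod>p\<in>upper_indices N. entry_factor c p (W i \<omega> $$ p))"
    and "(\<integral>\<omega>. (\<Prod>p\<in>upper_indices N. entry_factor c p (W i \<omega> $$ p)) \<partial>M) = (\<Prod>p\<in>upper_indices N.
        entry_factor_moment v c p)"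
proof -
  have "indep_vars (\<lambda>_. borel) (\<lambda>p \<omega>. W i \<omega> $$ p) (upper_indices N)"
    using GUE[OF i] by (simp add: GUE_def upper_indices_def)
  then have ind: "indep_vars (\<lambda>_. borel) (\<lambda>p \<omega>. entry_factor c p (W i \<omega> $$ p)) (upper_indices N)"
    by (rule indep_vars_compose2) (rule entry_factor_measurable)
  show "integrable M (\<lambda>\<omega>. \<Prod>p\<in>upper_indices N. entry_factor c p (W i \<omega> $$ p))"
    by (rule indep_vars_integrable[OF finite_upper_indices ind entry_factor_expectation(1)[OF i]])
  have "(\<integral>\<omega>. (\<Prod>p\<in>upper_indices N. entry_factor c p (W i \<omega> $$ p)) \<partial>M)
    = (\<Prod>p\<in>upper_indices N. \<integral>\<omega>. entry_factor c p (W i \<omega> $$ p) \<partial>M)"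
    by (rule indep_vars_lebesgue_integral[OF finite_upper_indices ind
        entry_factor_expectation(1)[OF i]])
  also have "\<dots> = (\<Prod>p\<in>upper_indices N. complex_of_real (entry_factor_moment v c p))"
    by (intro prod.cong refl entry_factor_expectation(2)[OF i])
  finally show "(\<integral>\<omega>. (\<Prod>p\<in>upper_indices N. entry_factor c p (W i \<omega> $$ p)) \<partial>M) = (\<Prod>p\<in>upper_indices
      N. entry_factor_moment v c p)"
    by simp
qed

text \<open>Independence is used twice: first across the matrices, then across the entries on and above
  the diagonal of each of them.\<close>

lemma entry_monomial_expectation:
  assumes L: "set_mset L \<subseteq> entry_indices k N"
  shows "integrable M (entry_monomial W L)"
    and "expectation (entry_monomial W L) =
      complex_of_real (\<Prod>e\<in>{..<k} \<times> upper_indices N. entry_factor_moment v (\<lambda>p. count L (fst e, p))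
          (snd e))"
proof -
  define H :: "nat \<Rightarrow> (nat \<times> nat \<Rightarrow> complex) \<Rightarrow> complex"
    where "H i f = (\<Prod>p\<in>upper_indices N. entry_factor (\<lambda>p. count L (i, p)) p (f p))" for i f
  define Y where "Y i \<omega> = H i (\<lambda>p\<in>{..<N} \<times> {..<N}. W i \<omega> $$ p)" for i \<omega>
  have Y: "Y i \<omega> = (\<Prod>p\<in>upper_indices N. entry_factor (\<lambda>p. count L (i, p)) p (W i \<omega> $$ p))" for i \<omega>
    unfolding Y_def H_def using upper_indices_subset[of N] 
    by (intro prod.cong refl) (metis restrict_apply' subsetD)
  have Hm: "H i \<in> borel_measurable (Pi\<^sub>M ({..<N} \<times> {..<N}) (\<lambda>_. borel))" for i
  proof -
    have "(\<lambda>f. entry_factor (\<lambda>p. count L (i, p)) p (f p)) \<in> borel_measurable (Pi\<^sub>M ({..<N} \<times>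
        {..<N}) (\<lambda>_. borel))"
      if "p \<in> upper_indices N" for p
      using that upper_indices_subset[of N]
      by (intro measurable_compose[where f = "\<lambda>f. f p", OF measurable_component_singleton
          entry_factor_measurable]) auto
    then show ?thesis unfolding H_def[abs_def] by (rule borel_measurable_prod)
  qed
  have ind: "indep_vars (\<lambda>_. borel) Y {..<k}"
    unfolding Y_def[abs_def]
    by (rule indep_vars_compose2[OF indep[unfolded indep_mats_def]]) (rule Hm)
  have Yint: "i \<in> {..<k} \<Longrightarrow> integrable M (Y i)" for i
    unfolding Y[abs_def] using matrix_entry_factor_expectation(1) by simp
  have eq: "entry_monomial W L \<omega> = (\<Prod>i<k. Y i \<omega>)" if "\<omega> \<in> space M" for \<omega>
    unfolding Y by (rule entry_monomial_eq_prod[OF that L])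
  show "integrable M (entry_monomial W L)"
    using indep_vars_integrable[OF _ ind Yint] eq
    by (subst Bochner_Integration.integrable_cong[OF refl eq]) auto
  have "expectation (entry_monomial W L) = (\<integral>\<omega>. (\<Prod>i<k. Y i \<omega>) \<partial>M)"
    by (rule Bochner_Integration.integral_cong[OF refl eq])
  also have "\<dots> = (\<Prod>i<k. expectation (Y i))"
    by (rule indep_vars_lebesgue_integral[OF _ ind Yint]) auto
  also have "\<dots> = (\<Prod>i<k. \<Prod>p\<in>upper_indices N. complex_of_real (entry_factor_moment v (\<lambda>p. count L
      (i, p)) p))"
    unfolding Y[abs_def] using matrix_entry_factor_expectation(2) by (intro prod.cong refl) simp
  also have "\<dots> = complex_of_real (\<Prod>e\<in>{..<k} \<times> upper_indices N. entry_factor_moment v (\<lambda>p. count L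
      (fst e, p)) (snd e))"
    by (subst prod.cartesian_product) (simp add: case_prod_unfold)
  finally show "expectation (entry_monomial W L) =
      complex_of_real (\<Prod>e\<in>{..<k} \<times> upper_indices N. entry_factor_moment v (\<lambda>p. count L (fst e, p))
          (snd e))" .
qed

text \<open>The additional entry \<open>x\<close> affects only the moment of the one independent variable \<open>Z\<close> on which
  it depends. For a complex entry, \<open>E[Z Z\<^sup>p cnj(Z)\<^sup>q] = v q E[Z\<^sup>p cnj(Z)\<^bsup>q - 1\<^esup>]\<close>, together with the
  conjugate identity; for a real diagonal entry, \<open>E[Z Z\<^sup>n] = v n E[Z\<^bsup>n - 1\<^esup>]\<close>. In all cases \<open>x\<close> pairs
  off with an occurrence of the transposed entry.\<close>

theorem wick_one_step:
  assumes x: "x \<in> entry_indices k N" and L: "set_mset L \<subseteq> entry_indices k N"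
  shows "expectation (entry_monomial W (add_mset x L)) =
    v * count L (transpose_index x) * expectation (entry_monomial W (L - {#transpose_index x#}))"
proof -
  obtain i a b where x_eq: "x = (i, (a, b))" and iab: "i < k" "a < N" "b < N"
    using x by (auto simp: entry_indices_def)
  \<comment> \<open>The position on or above the diagonal that determines the entry \<open>x\<close>.\<close>
  define p0 where "p0 = (min a b, max a b)"
  define e0 where "e0 = (i, p0)"
  let ?I = "{..<k} \<times> upper_indices N"
  let ?F = "\<lambda>L e. entry_factor_moment v (\<lambda>p. count L (fst e, p)) (snd e)"
  have e0: "e0 \<in> ?I" using iab by (auto simp: e0_def p0_def upper_indices_def)
  have fin: "finite ?I" by simp
  have others: "(\<Prod>e\<in>?I - {e0}. ?F (add_mset x L) e) = (\<Prod>e\<in>?I - {e0}. ?F (L - {#transpose_index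
      x#}) e)"
  proof (rule prod.cong[OF refl])
    fix e assume e: "e \<in> ?I - {e0}"
    then obtain j p where e_eq: "e = (j, p)" and p: "p \<in> upper_indices N" and ne: "(j, p) \<noteq> (i,
        p0)" by (auto simp: e0_def)
    have "x \<in> {(i, p0), (i, prod.swap p0)}" "transpose_index x \<in> {(i, p0), (i, prod.swap p0)}"
      by (auto simp: x_eq transpose_index_def p0_def min_def max_def)
    moreover have "(j, p) \<noteq> (i, prod.swap p0)" "(j, prod.swap p) \<noteq> (i, p0)" "(j, prod.swap p) \<noteq>
        (i, prod.swap p0)"
      using ne p by (cases p; auto simp: p0_def upper_indices_def)+
    ultimately have "(j, p) \<noteq> x" "(j, prod.swap p) \<noteq> x" "(j, p) \<noteq> transpose_index x" "(j,
        prod.swap p) \<noteq> transpose_index x"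
      using ne by (metis empty_iff insert_iff)+
    then show "?F (add_mset x L) e = ?F (L - {#transpose_index x#}) e"
      by (simp add: entry_factor_moment_def e_eq)
  qed
  have main: "?F (add_mset x L) e0 = v * count L (transpose_index x) * ?F (L - {#transpose_index
      x#}) e0"
  proof -
    consider "a = b" | "a < b" | "b < a" by linarith
    then show ?thesis
    proof cases
      case 1
      then show ?thesis
        by (simp add: entry_factor_moment_def x_eq transpose_index_def e0_def p0_def gauss_moment_Suc)
    next
      case 2
      then show ?thesis
        by (cases "count L (i, b, a)") (auto simp: entry_factor_moment_def x_eq
            transpose_index_def e0_def p0_def)
    next
      case 3
      then show ?thesis
        by (cases "count L (i, b, a)") (auto simp: entry_factor_moment_def x_eq
            transpose_index_def e0_def p0_def)
    qed
  qed
  have L1: "set_mset (add_mset x L) \<subseteq> entry_indices k N" and L2: "set_mset (L - {#transpose_index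
      x#}) \<subseteq> entry_indices k N"
    using x L by (auto dest: in_diffD)
  have "expectation (entry_monomial W (add_mset x L)) = complex_of_real (?F (add_mset x L) e0 *
      (\<Prod>e\<in>?I - {e0}. ?F (add_mset x L) e))"
    unfolding entry_monomial_expectation(2)[OF L1] by (simp only: prod.remove[OF fin e0])
  also have "\<dots> = complex_of_real (v * count L (transpose_index x) * (?F (L - {#transpose_index
      x#}) e0 * (\<Prod>e\<in>?I - {e0}. ?F (L - {#transpose_index x#}) e)))"
    unfolding others main by (simp only: mult.assoc)
  also have "\<dots> = v * count L (transpose_index x) * expectation (entry_monomial W (L -
      {#transpose_index x#}))"
    unfolding entry_monomial_expectation(2)[OF L2] prod.remove[OF fin e0, of "?F (L -
        {#transpose_index x#})"]
    by (simp only: of_real_mult of_real_of_nat_eq)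
  finally show ?thesis .
qed

end

section \<open>Words in matrices and their traces\<close>

definition mat_word :: "nat \<Rightarrow> (nat \<Rightarrow> complex mat) \<Rightarrow> nat list \<Rightarrow> complex mat" where
  "mat_word N X u = word_eval (mat_space N) X u"

definition ntrace :: "nat \<Rightarrow> complex mat \<Rightarrow> complex" where
  "ntrace N Y = (\<Sum>i<N. Y $$ (i, i)) / of_nat N"

lemma mat_word_Nil [simp]: "mat_word N X [] = 1\<^sub>m N"
  and mat_word_Cons [simp]: "mat_word N X (i # u) = X i * mat_word N X u"
  by (simp_all add: mat_word_def word_eval_def mat_space_def)

lemma mat_word_carrier:
  assumes "\<And>i. i \<in> set u \<Longrightarrow> X i \<in> carrier_mat N N"
  shows "mat_word N X u \<in> carrier_mat N N"
  using assms by (induction u) (auto intro!: mult_carrier_mat)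

lemma mult_mat_entry:
  assumes "Y \<in> carrier_mat N N" "Z \<in> carrier_mat N N" "i < N" "j < N"
  shows "(Y * Z) $$ (i, j) = (\<Sum>e<N. Y $$ (i, e) * Z $$ (e, j))"
  using assms by (auto simp: scalar_prod_def atLeast0LessThan)

lemma mat_word_append:
  assumes "\<And>i. i \<in> set u \<union> set w \<Longrightarrow> X i \<in> carrier_mat N N"
  shows "mat_word N X (u @ w) = mat_word N X u * mat_word N X w"
  using assms
proof (induction u)
  case Nil
  then have "mat_word N X w \<in> carrier_mat N N" by (intro mat_word_carrier) auto
  then show ?case by simp
next
  case (Cons i u)
  then have "mat_word N X w \<in> carrier_mat N N" "mat_word N X u \<in> carrier_mat N N" "X i \<in>
      carrier_mat N N"
    by (auto intro!: mat_word_carrier)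
  moreover have "mat_word N X (u @ w) = mat_word N X u * mat_word N X w"
    using Cons.prems by (intro Cons.IH) auto
  ultimately show ?case 
    using assoc_mult_mat[of "X i" N N "mat_word N X u" N "mat_word N X w" N] by simp
qed

lemma trace_mult:
  assumes "Y \<in> carrier_mat N N" "Z \<in> carrier_mat N N"
  shows "(\<Sum>a<N. \<Sum>b<N. Y $$ (a, b) * Z $$ (b, a)) = of_nat N * ntrace N (Y * Z)"
proof -
  have "(\<Sum>a<N. \<Sum>b<N. Y $$ (a, b) * Z $$ (b, a)) = (\<Sum>a<N. (Y * Z) $$ (a, a))"
    using assms by (intro sum.cong refl) (simp add: mult_mat_entry del: index_mult_mat)
  then show ?thesis by (cases "N = 0") (simp_all add: ntrace_def)
qed

lemma ntrace_commute:
  assumes "Y \<in> carrier_mat N N" "Z \<in> carrier_mat N N"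
  shows "ntrace N (Y * Z) = ntrace N (Z * Y)"
proof (cases "N = 0")
  case False
  have "of_nat N * ntrace N (Y * Z) = of_nat N * ntrace N (Z * Y)"
    unfolding trace_mult[OF assms, symmetric] trace_mult[OF assms(2,1), symmetric]
    by (subst sum.swap) (simp add: mult.commute)
  then show ?thesis using False by simp
qed (simp add: ntrace_def)

text \<open>In the product of \<open>tr(i y)\<close> with the traces of the words in \<open>us\<close>, pairing the letter \<open>i\<close> with an
  occurrence of \<open>i\<close> in a word \<open>p i q\<close> merges two traces into \<open>tr(y q p)\<close>. Each element of the list
  \<open>joins i y us\<close> consists of the words whose traces remain after one such pairing.\<close>

primrec joins :: "'x \<Rightarrow> 'x list \<Rightarrow> 'x list list \<Rightarrow> 'x list list list" where
  "joins i y [] = []"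
| "joins i y (u # us) = map (\<lambda>(p, q). (y @ q @ p) # us) (splits i u) @ map ((#) u) (joins i y us)"

context gue_family
begin

text \<open>A list of coefficients and multisets of indices represents a polynomial in the entries.\<close>

definition poly_value :: "(complex \<times> (nat \<times> nat \<times> nat) multiset) list \<Rightarrow> 'w \<Rightarrow> complex" where
  "poly_value cs \<omega> = (\<Sum>(c, L)\<leftarrow>cs. c * entry_monomial W L \<omega>)"

definition poly_deriv :: "(complex \<times> (nat \<times> nat \<times> nat) multiset) list \<Rightarrow> nat \<times> nat \<times> nat \<Rightarrow> 'w \<Rightarrow>
    complex" where
  "poly_deriv cs x \<omega> = (\<Sum>(c, L)\<leftarrow>cs. c * (of_nat (count L (transpose_index x)) * entry_monomial W
      (L - {#transpose_index x#}) \<omega>))"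

text \<open>\<open>D x\<close> is the formal derivative of the polynomial \<open>F\<close> with respect to the entry that is paired
  with \<open>x\<close> in Wick's formula, that is, the transposed one. It is carried along as a second
  component because it depends on the polynomial expression; the entries may satisfy relations,
  and then the random variable \<open>F\<close> alone does not determine it.\<close>

definition entry_poly :: "('w \<Rightarrow> complex) \<Rightarrow> (nat \<times> nat \<times> nat \<Rightarrow> 'w \<Rightarrow> complex) \<Rightarrow> bool" where
  "entry_poly F D \<longleftrightarrow> (\<exists>cs. (\<forall>(c, L)\<in>set cs. set_mset L \<subseteq> entry_indices k N) \<and>
     (\<forall>\<omega>\<in>space M. F \<omega> = poly_value cs \<omega> \<and> (\<forall>x\<in>entry_indices k N. D x \<omega> = poly_deriv cs x \<omega>)))"

lemma entry_polyI:
  assumes "\<forall>(c, L)\<in>set cs. set_mset L \<subseteq> entry_indices k N"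
    and "\<And>\<omega>. \<omega> \<in> space M \<Longrightarrow> F \<omega> = poly_value cs \<omega>"
    and "\<And>\<omega> x. \<omega> \<in> space M \<Longrightarrow> x \<in> entry_indices k N \<Longrightarrow> D x \<omega> = poly_deriv cs x \<omega>"
  shows "entry_poly F D"
  unfolding entry_poly_def using assms by blast

lemma entry_poly_cong:
  assumes "entry_poly F D" "\<And>\<omega>. \<omega> \<in> space M \<Longrightarrow> F' \<omega> = F \<omega>"
    and "\<And>\<omega> x. \<omega> \<in> space M \<Longrightarrow> x \<in> entry_indices k N \<Longrightarrow> D' x \<omega> = D x \<omega>"
  shows "entry_poly F' D'"
proof -
  obtain cs where "\<forall>(c, L)\<in>set cs. set_mset L \<subseteq> entry_indices k N"
    "\<forall>\<omega>\<in>space M. F \<omega> = poly_value cs \<omega> \<and> (\<forall>x\<in>entry_indices k N. D x \<omega> = poly_deriv cs x \<omega>)"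
    using assms(1) unfolding entry_poly_def by blast
  then show ?thesis using assms(2,3) by (intro entry_polyI[of cs]) auto
qed

lemma entry_poly_const: "entry_poly (\<lambda>\<omega>. c) (\<lambda>x \<omega>. 0)"
  by (rule entry_polyI[of "[(c, {#})]"]) (auto simp: poly_value_def poly_deriv_def entry_monomial_def)

lemma entry_poly_entry:
  assumes "y \<in> entry_indices k N"
  shows "entry_poly (mat_entry W y) (\<lambda>x \<omega>. if y = transpose_index x then 1 else 0)"
  by (rule entry_polyI[of "[(1, {#y#})]"]) (use assms in \<open>auto simp: poly_value_def poly_deriv_def
      entry_monomial_def\<close>)

lemma entry_poly_add:
  assumes "entry_poly F D" "entry_poly G E"
  shows "entry_poly (\<lambda>\<omega>. F \<omega> + G \<omega>) (\<lambda>x \<omega>. D x \<omega> + E x \<omega>)"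
proof -
  obtain cs where cs: "\<forall>(c, L)\<in>set cs. set_mset L \<subseteq> entry_indices k N"
    "\<forall>\<omega>\<in>space M. F \<omega> = poly_value cs \<omega> \<and> (\<forall>x\<in>entry_indices k N. D x \<omega> = poly_deriv cs x \<omega>)"
    using assms(1) unfolding entry_poly_def by blast
  obtain ds where ds: "\<forall>(c, L)\<in>set ds. set_mset L \<subseteq> entry_indices k N"
    "\<forall>\<omega>\<in>space M. G \<omega> = poly_value ds \<omega> \<and> (\<forall>x\<in>entry_indices k N. E x \<omega> = poly_deriv ds x \<omega>)"
    using assms(2) unfolding entry_poly_def by blast
  show ?thesis
  proof (rule entry_polyI[of "cs @ ds"])
    show "\<forall>(c, L)\<in>set (cs @ ds). set_mset L \<subseteq> entry_indices k N" using cs(1) ds(1) by auto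
  qed (use cs(2) ds(2) in \<open>auto simp: poly_value_def poly_deriv_def\<close>)
qed

lemma entry_monomial_add: "entry_monomial W (L + K) \<omega> = entry_monomial W L \<omega> * entry_monomial W K \<omega>"
  by (simp add: entry_monomial_def)

lemma entry_monomial_Leibniz:
  "of_nat (count (L + K) y) * entry_monomial W (L + K - {#y#}) \<omega> =
     of_nat (count L y) * entry_monomial W (L - {#y#}) \<omega> * entry_monomial W K \<omega> +
     entry_monomial W L \<omega> * (of_nat (count K y) * entry_monomial W (K - {#y#}) \<omega>)"
proof -
  have 1: "entry_monomial W (L + K - {#y#}) \<omega> = entry_monomial W (L - {#y#}) \<omega> * entry_monomial W
      K \<omega>" if y: "y \<in># L"
  proof -
    obtain L' where "L = add_mset y L'" using multi_member_split[OF y] by blast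
    then show ?thesis by (simp add: entry_monomial_add)
  qed
  have 2: "entry_monomial W (L + K - {#y#}) \<omega> = entry_monomial W L \<omega> * entry_monomial W (K -
      {#y#}) \<omega>" if y: "y \<in># K"
  proof -
    obtain K' where "K = add_mset y K'" using multi_member_split[OF y] by blast
    then show ?thesis by (simp add: entry_monomial_add)
  qed
  consider "y \<notin># L" "y \<notin># K" | "y \<in># L" "y \<notin># K" | "y \<notin># L" "y \<in># K" | "y \<in># L" "y \<in># K"
    by blast
  then show ?thesis
  proof cases
    case 1
    then show ?thesis by (simp add: not_in_iff)
  next
    case c: 2
    then show ?thesis using 1[OF c(1)] by (simp add: not_in_iff)
  next
    case c: 3
    then show ?thesis using 2[OF c(2)] by (simp add: not_in_iff)
  next
    case c: 4
    have "of_nat (count (L + K) y) * entry_monomial W (L + K - {#y#}) \<omega> =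
        of_nat (count L y) * entry_monomial W (L + K - {#y#}) \<omega> + of_nat (count K y) *
            entry_monomial W (L + K - {#y#}) \<omega>"
      by (simp only: count_union of_nat_add distrib_right)
    also have "of_nat (count L y) * entry_monomial W (L + K - {#y#}) \<omega> =
        of_nat (count L y) * entry_monomial W (L - {#y#}) \<omega> * entry_monomial W K \<omega>"
      by (simp only: 1[OF c(1)] mult.assoc)
    also have "of_nat (count K y) * entry_monomial W (L + K - {#y#}) \<omega> =
        entry_monomial W L \<omega> * (of_nat (count K y) * entry_monomial W (K - {#y#}) \<omega>)"
      by (simp only: 2[OF c(2)] mult.left_commute)
    finally show ?thesis .
  qed
qed

lemma entry_poly_mult:
  assumes "entry_poly F D" "entry_poly G E"
  shows "entry_poly (\<lambda>\<omega>. F \<omega> * G \<omega>) (\<lambda>x \<omega>. D x \<omega> * G \<omega> + F \<omega> * E x \<omega>)"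
proof -
  obtain cs where cs: "\<forall>(c, L)\<in>set cs. set_mset L \<subseteq> entry_indices k N"
    "\<forall>\<omega>\<in>space M. F \<omega> = poly_value cs \<omega> \<and> (\<forall>x\<in>entry_indices k N. D x \<omega> = poly_deriv cs x \<omega>)"
    using assms(1) unfolding entry_poly_def by blast
  obtain ds where ds: "\<forall>(c, L)\<in>set ds. set_mset L \<subseteq> entry_indices k N"
    "\<forall>\<omega>\<in>space M. G \<omega> = poly_value ds \<omega> \<and> (\<forall>x\<in>entry_indices k N. E x \<omega> = poly_deriv ds x \<omega>)"
    using assms(2) unfolding entry_poly_def by blast
  define scale where "scale b ds = map (\<lambda>(d, K). (fst b * d, snd b + K)) ds"
    for b :: "complex \<times> (nat \<times> nat \<times> nat) multiset" and ds :: "(complex \<times> (nat \<times> nat \<times> nat)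
        multiset) list"
  have val1: "poly_value (scale (c, L) ds) \<omega> = c * entry_monomial W L \<omega> * poly_value ds \<omega>" for c L
      ds \<omega>
    by (induction ds) (auto simp: scale_def poly_value_def entry_monomial_add algebra_simps)
  have der1: "poly_deriv (scale (c, L) ds) x \<omega> =
      c * (of_nat (count L (transpose_index x)) * entry_monomial W (L - {#transpose_index x#}) \<omega>)
          * poly_value ds \<omega> +
      c * entry_monomial W L \<omega> * poly_deriv ds x \<omega>" for c L ds x \<omega>
  proof (induction ds)
    case (Cons b ds)
    obtain d K where b: "b = (d, K)" by force
    have "poly_deriv (scale (c, L) (b # ds)) x \<omega> =
      c * d * (of_nat (count (L + K) (transpose_index x)) * entry_monomial W (L + K -
          {#transpose_index x#}) \<omega>) + poly_deriv (scale (c, L) ds) x \<omega>"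
      by (simp add: scale_def poly_deriv_def b)
    then show ?case
      unfolding Cons.IH entry_monomial_Leibniz by (simp add: b poly_value_def poly_deriv_def
          algebra_simps)
  qed (simp add: scale_def poly_deriv_def poly_value_def)
  define ps where "ps = concat (map (\<lambda>b. scale b ds) cs)"
  have val: "poly_value (concat (map (\<lambda>b. scale b ds) cs)) \<omega> = poly_value cs \<omega> * poly_value ds \<omega>"
      for cs \<omega>
  proof (induction cs)
    case (Cons b cs)
    obtain c L where b: "b = (c, L)" by force
    have "poly_value (concat (map (\<lambda>b. scale b ds) (b # cs))) \<omega> = poly_value (scale b ds) \<omega> +
        poly_value (concat (map (\<lambda>b. scale b ds) cs)) \<omega>"
      by (simp add: poly_value_def)
    then show ?case unfolding Cons.IH b val1 by (simp add: poly_value_def algebra_simps)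
  qed (simp add: poly_value_def)
  have der: "poly_deriv (concat (map (\<lambda>b. scale b ds) cs)) x \<omega> = poly_deriv cs x \<omega> * poly_value ds
      \<omega> + poly_value cs \<omega> * poly_deriv ds x \<omega>" for cs x \<omega>
  proof (induction cs)
    case (Cons b cs)
    obtain c L where b: "b = (c, L)" by force
    have "poly_deriv (concat (map (\<lambda>b. scale b ds) (b # cs))) x \<omega> = poly_deriv (scale b ds) x \<omega> +
        poly_deriv (concat (map (\<lambda>b. scale b ds) cs)) x \<omega>"
      by (simp add: poly_deriv_def)
    then show ?case unfolding Cons.IH b der1 by (simp add: poly_value_def poly_deriv_def
        algebra_simps)
  qed (simp add: poly_value_def poly_deriv_def)
  show ?thesis
  proof (rule entry_polyI[of ps])
    show "\<forall>(c, L)\<in>set ps. set_mset L \<subseteq> entry_indices k N"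
      using cs(1) ds(1) by (fastforce simp: ps_def scale_def)
  qed (use cs(2) ds(2) in \<open>simp_all add: ps_def val der\<close>)
qed

lemma entry_poly_sum:
  assumes "finite I" "\<And>i. i \<in> I \<Longrightarrow> entry_poly (F i) (D i)"
  shows "entry_poly (\<lambda>\<omega>. \<Sum>i\<in>I. F i \<omega>) (\<lambda>x \<omega>. \<Sum>i\<in>I. D i x \<omega>)"
  using assms by (induction I rule: finite_induct) (simp_all add: entry_poly_const entry_poly_add)

lemma entry_poly_cmult:
  assumes "entry_poly F D"
  shows "entry_poly (\<lambda>\<omega>. c * F \<omega>) (\<lambda>x \<omega>. c * D x \<omega>)"
  using entry_poly_mult[OF entry_poly_const[of c] assms] by simp

lemma entry_poly_integrable:
  assumes "entry_poly F D"
  shows "integrable M F"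
proof -
  obtain cs where cs: "\<forall>(c, L)\<in>set cs. set_mset L \<subseteq> entry_indices k N"
    "\<forall>\<omega>\<in>space M. F \<omega> = poly_value cs \<omega> \<and> (\<forall>x\<in>entry_indices k N. D x \<omega> = poly_deriv cs x \<omega>)"
    using assms(1) unfolding entry_poly_def by blast
  have "integrable M (poly_value cs)"
    using cs(1) entry_monomial_expectation(1)
    by (induction cs) (auto simp: poly_value_def[abs_def])
  then show ?thesis using cs(2) by (subst Bochner_Integration.integrable_cong[OF refl, of _ _
      "poly_value cs"]) auto
qed

text \<open>Both sides are linear in the polynomial, and for a single monomial this is \<open>wick_one_step\<close>.\<close>

theorem gaussian_integration_by_parts:
  fixes F :: "'w \<Rightarrow> complex" and D :: "nat \<times> nat \<times> nat \<Rightarrow> 'w \<Rightarrow> complex"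
  assumes "entry_poly F D" and x: "x \<in> entry_indices k N"
  shows "integrable M (\<lambda>\<omega>. mat_entry W x \<omega> * F \<omega>)" and "integrable M (D x)"
    and "expectation (\<lambda>\<omega>. mat_entry W x \<omega> * F \<omega>) = v * expectation (D x)"
proof -
  obtain cs where cs: "\<forall>(c, L)\<in>set cs. set_mset L \<subseteq> entry_indices k N"
    "\<forall>\<omega>\<in>space M. F \<omega> = poly_value cs \<omega> \<and> (\<forall>x\<in>entry_indices k N. D x \<omega> = poly_deriv cs x \<omega>)"
    using assms(1) unfolding entry_poly_def by blast
  have main: "integrable M (poly_deriv cs x) \<and> integrable M (\<lambda>\<omega>. mat_entry W x \<omega> * poly_value cs \<omega>) \<and>
    expectation (\<lambda>\<omega>. mat_entry W x \<omega> * poly_value cs \<omega>) = v * expectation (poly_deriv cs x)"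
    using cs(1)
  proof (induction cs)
    case Nil
    then show ?case by (simp add: poly_value_def[abs_def] poly_deriv_def[abs_def])
  next
    case (Cons b cs)
    obtain c L where b: "b = (c, L)" by force
    have L: "set_mset L \<subseteq> entry_indices k N" and xL: "set_mset (add_mset x L) \<subseteq> entry_indices k N"
      and Lx: "set_mset (L - {#transpose_index x#}) \<subseteq> entry_indices k N"
      using Cons.prems x by (auto simp: b dest: in_diffD)
    have IH: "integrable M (poly_deriv cs x)" "integrable M (\<lambda>\<omega>. mat_entry W x \<omega> * poly_value cs \<omega>)"
      "expectation (\<lambda>\<omega>. mat_entry W x \<omega> * poly_value cs \<omega>) = v * expectation (poly_deriv cs x)"
      using Cons.IH Cons.prems by auto
    have e1: "(\<lambda>\<omega>. mat_entry W x \<omega> * poly_value (b # cs) \<omega>) = (\<lambda>\<omega>. c * entry_monomial W (add_mset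
        x L) \<omega> + mat_entry W x \<omega> * poly_value cs \<omega>)"
      by (simp add: poly_value_def b entry_monomial_def fun_eq_iff algebra_simps)
    have e2: "poly_deriv (b # cs) x = (\<lambda>\<omega>. (c * of_nat (count L (transpose_index x))) *
        entry_monomial W (L - {#transpose_index x#}) \<omega> + poly_deriv cs x \<omega>)"
      by (simp add: poly_deriv_def b fun_eq_iff)
    have i1: "integrable M (\<lambda>\<omega>. c * entry_monomial W (add_mset x L) \<omega>)"
      by (intro integrable_mult_right) (rule entry_monomial_expectation(1)[OF xL])
    have i2: "integrable M (\<lambda>\<omega>. (c * of_nat (count L (transpose_index x))) * entry_monomial W (L -
        {#transpose_index x#}) \<omega>)"
      by (intro integrable_mult_right) (rule entry_monomial_expectation(1)[OF Lx])
    have "expectation (\<lambda>\<omega>. mat_entry W x \<omega> * poly_value (b # cs) \<omega>) =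
        c * expectation (entry_monomial W (add_mset x L)) + v * expectation (poly_deriv cs x)"
      unfolding e1 Bochner_Integration.integral_add[OF i1 IH(2)] IH(3) integral_mult_right_zero ..
    moreover have "expectation (poly_deriv (b # cs) x) =
        (c * of_nat (count L (transpose_index x))) * expectation (entry_monomial W (L -
            {#transpose_index x#})) + expectation (poly_deriv cs x)"
      unfolding e2 Bochner_Integration.integral_add[OF i2 IH(1)] integral_mult_right_zero ..
    moreover have "integrable M (poly_deriv (b # cs) x)" "integrable M (\<lambda>\<omega>. mat_entry W x \<omega> *
        poly_value (b # cs) \<omega>)"
      unfolding e1 e2 by (intro Bochner_Integration.integrable_add i1 i2 IH)+
    ultimately show ?case
      unfolding wick_one_step[OF x L] by (simp add: algebra_simps)
  qed
  have e: "D x \<omega> = poly_deriv cs x \<omega>" "mat_entry W x \<omega> * F \<omega> = mat_entry W x \<omega> * poly_value cs \<omega>"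
    if "\<omega> \<in> space M" for \<omega>
    using cs(2) x that by simp_all
  have "integrable M (D x) = integrable M (poly_deriv cs x)"
    by (rule Bochner_Integration.integrable_cong[OF refl]) (rule e(1))
  moreover have "integrable M (\<lambda>\<omega>. mat_entry W x \<omega> * F \<omega>) = integrable M (\<lambda>\<omega>. mat_entry W x \<omega> *
      poly_value cs \<omega>)"
    by (rule Bochner_Integration.integrable_cong[OF refl]) (rule e(2))
  moreover have "expectation (D x) = expectation (poly_deriv cs x)"
    by (rule Bochner_Integration.integral_cong[OF refl]) (rule e(1))
  moreover have "expectation (\<lambda>\<omega>. mat_entry W x \<omega> * F \<omega>) = expectation (\<lambda>\<omega>. mat_entry W x \<omega> *
      poly_value cs \<omega>)"
    by (rule Bochner_Integration.integral_cong[OF refl]) (rule e(2))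
  ultimately show "integrable M (\<lambda>\<omega>. mat_entry W x \<omega> * F \<omega>)" "integrable M (D x)"
    "expectation (\<lambda>\<omega>. mat_entry W x \<omega> * F \<omega>) = v * expectation (D x)" using main by simp_all
qed

end

section \<open>The Schwinger-Dyson equation for random matrices\<close>

lemma split_sum_map_append:
  assumes "i \<notin> set w"
  shows "split_sum i F (u @ w) = split_sum i (\<lambda>p q. F p (q @ w)) u"
proof -
  have "splits i w = []" using assms by (simp add: splits_empty_iff)
  then show ?thesis by (simp add: split_sum_append split_sum_def[of i _ w])
qed

lemma split_sum_sum: "(\<Sum>e\<in>I. split_sum i (F e) u) = split_sum i (\<lambda>p q. \<Sum>e\<in>I. F e p q) u"
  by (induction I rule: infinite_finite_induct)
    (simp_all add: split_sum_add, simp_all add: split_sum_def case_prod_unfold)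

lemma integral_sum_list:
  fixes F :: "'b \<Rightarrow> 'w \<Rightarrow> complex"
  assumes "\<And>x. x \<in> set xs \<Longrightarrow> integrable M (F x)"
  shows "(\<integral>\<omega>. (\<Sum>x\<leftarrow>xs. F x \<omega>) \<partial>M) = (\<Sum>x\<leftarrow>xs. \<integral>\<omega>. F x \<omega> \<partial>M)"
    and "integrable M (\<lambda>\<omega>. \<Sum>x\<leftarrow>xs. F x \<omega>)"
proof -
  have "(\<integral>\<omega>. (\<Sum>x\<leftarrow>xs. F x \<omega>) \<partial>M) = (\<Sum>x\<leftarrow>xs. \<integral>\<omega>. F x \<omega> \<partial>M) \<and> integrable M (\<lambda>\<omega>. \<Sum>x\<leftarrow>xs. F x \<omega>)"
    using assms by (induction xs) auto
  then show "(\<integral>\<omega>. (\<Sum>x\<leftarrow>xs. F x \<omega>) \<partial>M) = (\<Sum>x\<leftarrow>xs. \<integral>\<omega>. F x \<omega> \<partial>M)"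
    "integrable M (\<lambda>\<omega>. \<Sum>x\<leftarrow>xs. F x \<omega>)" by auto
qed

lemma joins_letters:
  assumes "zs \<in> set (joins i y us)" "y \<in> lists V" "set us \<subseteq> lists V"
  shows "set zs \<subseteq> lists V"
  using assms
proof (induction us arbitrary: zs)
  case (Cons u us)
  consider p q where "(p, q) \<in> set (splits i u)" "zs = (y @ q @ p) # us"
    | ws where "ws \<in> set (joins i y us)" "zs = u # ws"
    using Cons.prems(1) by auto
  then show ?case
  proof cases
    case 1
    then show ?thesis using splits_imp[of p q i u] Cons.prems by auto
  next
    case 2
    then show ?thesis using Cons.IH[of ws] Cons.prems by auto
  qed
qed simp

locale gue_words = gue_family +
  fixes l :: nat and A :: "nat \<Rightarrow> complex mat"
  assumes A_carrier: "j < l \<Longrightarrow> A j \<in> carrier_mat N N"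
    and N_pos: "N \<ge> 1"
begin

definition letter_mat :: "'a \<Rightarrow> nat \<Rightarrow> complex mat" where
  "letter_mat \<omega> = append_tuple k (\<lambda>i. W i \<omega>) A"

definition word_mat :: "nat list \<Rightarrow> 'a \<Rightarrow> complex mat" where
  "word_mat u \<omega> = mat_word N (letter_mat \<omega>) u"

definition word_trace :: "nat list \<Rightarrow> 'a \<Rightarrow> complex" where
  "word_trace u \<omega> = ntrace N (word_mat u \<omega>)"

definition trace_prod :: "nat list list \<Rightarrow> 'a \<Rightarrow> complex" where
  "trace_prod us \<omega> = (\<Prod>u\<leftarrow>us. word_trace u \<omega>)"

lemma trace_prod_simps [simp]: "trace_prod [] \<omega> = 1" "trace_prod (u # us) \<omega> = word_trace u \<omega> *
    trace_prod us \<omega>"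
  by (simp_all add: trace_prod_def)

lemma letter_mat_carrier: "\<omega> \<in> space M \<Longrightarrow> i < k + l \<Longrightarrow> letter_mat \<omega> i \<in> carrier_mat N N"
  using W_carrier A_carrier by (simp add: letter_mat_def append_tuple_def)

lemma word_mat_carrier: "\<omega> \<in> space M \<Longrightarrow> u \<in> lists {..<k + l} \<Longrightarrow> word_mat u \<omega> \<in> carrier_mat N N"
  unfolding word_mat_def using letter_mat_carrier by (intro mat_word_carrier) auto

lemma word_mat_append:
  assumes "\<omega> \<in> space M" "u \<in> lists {..<k + l}" "w \<in> lists {..<k + l}"
  shows "word_mat (u @ w) \<omega> = word_mat u \<omega> * word_mat w \<omega>"
  unfolding word_mat_def using assms letter_mat_carrier by (intro mat_word_append) auto

lemma word_mat_append_entry: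
  assumes "\<omega> \<in> space M" "u \<in> lists {..<k + l}" "w \<in> lists {..<k + l}" "a < N" "b < N"
  shows "word_mat (u @ w) \<omega> $$ (a, b) = (\<Sum>e<N. word_mat u \<omega> $$ (a, e) * word_mat w \<omega> $$ (e, b))"
  using assms by (simp add: word_mat_append mult_mat_entry word_mat_carrier del: index_mult_mat)

lemma word_trace_commute:
  assumes "\<omega> \<in> space M" "u \<in> lists {..<k + l}" "w \<in> lists {..<k + l}"
  shows "word_trace (u @ w) \<omega> = word_trace (w @ u) \<omega>"
  unfolding word_trace_def using assms by (simp add: word_mat_append ntrace_commute word_mat_carrier)

lemma word_trace_sum:
  assumes "\<omega> \<in> space M" "u \<in> lists {..<k + l}" "w \<in> lists {..<k + l}"
  shows "(\<Sum>a<N. \<Sum>b<N. word_mat u \<omega> $$ (a, b) * word_mat w \<omega> $$ (b, a)) = of_nat N * word_trace (u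
      @ w) \<omega>"
  unfolding word_trace_def using assms by (simp add: word_mat_append trace_mult word_mat_carrier)

abbreviation row_of :: "nat \<times> nat \<times> nat \<Rightarrow> nat" where "row_of x \<equiv> fst (snd x)"
abbreviation column_of :: "nat \<times> nat \<times> nat \<Rightarrow> nat" where "column_of x \<equiv> snd (snd x)"

text \<open>The derivative of a product of matrices is a sum over the places where the differentiated letter
  occurs: \<open>p W q\<close> with \<open>W\<close> replaced by a matrix unit has the entry \<open>p\<^bsub>c b\<^esub> q\<^bsub>a d\<^esub>\<close> at \<open>(c, d)\<close>.\<close>

definition deriv_word_mat :: "nat list \<Rightarrow> nat \<times> nat \<Rightarrow> nat \<times> nat \<times> nat \<Rightarrow> 'a \<Rightarrow> complex" where
  "deriv_word_mat u cd x \<omega> = split_sum (fst x) (\<lambda>p q. word_mat p \<omega> $$ (fst cd, column_of x) *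
      word_mat q \<omega> $$ (row_of x, snd cd)) u"

lemma entry_poly_word_mat:
  assumes "u \<in> lists {..<k + l}" "c < N" "d < N"
  shows "entry_poly (\<lambda>\<omega>. word_mat u \<omega> $$ (c, d)) (deriv_word_mat u (c, d))"
  using assms
proof (induction u arbitrary: c rule: list.induct)
  case Nil
  show ?case
    by (rule entry_poly_cong[OF entry_poly_const[of "1\<^sub>m N $$ (c, d)"]]) (simp_all add:
        word_mat_def deriv_word_mat_def)
next
  case (Cons y u)
  have y: "y < k + l" and u: "u \<in> lists {..<k + l}" using Cons.prems by auto
  define E where "E e x = (if y = fst x \<and> c = column_of x \<and> e = row_of x then 1 else 0 ::
      complex)" for e and x :: "nat \<times> nat \<times> nat"
  have letter: "entry_poly (\<lambda>\<omega>. letter_mat \<omega> y $$ (c, e)) (\<lambda>x \<omega>. E e x)" if e: "e < N" for e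
  proof (cases "y < k")
    case True
    then have "(y, (c, e)) \<in> entry_indices k N" using e Cons.prems by (simp add: entry_indices_def)
    from entry_poly_entry[OF this] show ?thesis
      by (rule entry_poly_cong) (use True in \<open>auto simp: letter_mat_def append_tuple_def
          mat_entry_def E_def transpose_index_def prod_eq_iff\<close>)
  next
    case False
    show ?thesis
      by (rule entry_poly_cong[OF entry_poly_const[of "A (y - k) $$ (c, e)"]])
        (use False in \<open>auto simp: letter_mat_def append_tuple_def E_def entry_indices_def\<close>)
  qed
  have "entry_poly (\<lambda>\<omega>. \<Sum>e<N. letter_mat \<omega> y $$ (c, e) * word_mat u \<omega> $$ (e, d))
    (\<lambda>x \<omega>. \<Sum>e<N. E e x * word_mat u \<omega> $$ (e, d) + letter_mat \<omega> y $$ (c, e) * deriv_word_mat u (e,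
        d) x \<omega>)"
    using Cons.prems u by (intro entry_poly_sum entry_poly_mult letter Cons.IH) auto
  then show ?case
  proof (rule entry_poly_cong)
    fix \<omega> assume \<omega>: "\<omega> \<in> space M"
    show mwy: "word_mat (y # u) \<omega> $$ (c, d) = (\<Sum>e<N. letter_mat \<omega> y $$ (c, e) * word_mat u \<omega> $$
        (e, d))"
      using mult_mat_entry[OF letter_mat_carrier[OF \<omega> y] word_mat_carrier[OF \<omega> u] Cons.prems(2,3)]
          by (simp add: word_mat_def)
    fix x assume x: "x \<in> entry_indices k N"
    then have rx: "row_of x < N" "column_of x < N" by (auto simp: entry_indices_def)
    have "(\<Sum>e<N. E e x * word_mat u \<omega> $$ (e, d)) = (if y = fst x \<and> c = column_of x then word_mat u
        \<omega> $$ (row_of x, d) else 0)"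
    proof -
      have "(\<Sum>e<N. E e x * word_mat u \<omega> $$ (e, d))
        = (\<Sum>e<N. if e = row_of x then (if y = fst x \<and> c = column_of x then word_mat u \<omega> $$ (e, d)
            else 0) else 0)"
        by (intro sum.cong) (auto simp: E_def)
      then show ?thesis using rx by simp
    qed
    also have "\<dots> = (if y = fst x then word_mat [] \<omega> $$ (c, column_of x) * word_mat u \<omega> $$ (row_of
        x, d) else 0)"
      using rx Cons.prems by (simp add: word_mat_def)
    finally have 1: "(\<Sum>e<N. E e x * word_mat u \<omega> $$ (e, d)) = (if y = fst x then word_mat [] \<omega> $$
        (c, column_of x) * word_mat u \<omega> $$ (row_of x, d) else 0)" .
    have "(\<Sum>e<N. letter_mat \<omega> y $$ (c, e) * deriv_word_mat u (e, d) x \<omega>)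
      = split_sum (fst x) (\<lambda>p q. \<Sum>e<N. letter_mat \<omega> y $$ (c, e) * (word_mat p \<omega> $$ (e, column_of
          x) * word_mat q \<omega> $$ (row_of x, d))) u"
      by (simp add: deriv_word_mat_def split_sum_cmult[symmetric] split_sum_sum)
    also have "\<dots> = split_sum (fst x) (\<lambda>p q. word_mat (y # p) \<omega> $$ (c, column_of x) * word_mat q \<omega>
        $$ (row_of x, d)) u"
    proof (rule split_sum_cong)
      fix p q assume "u = p @ fst x # q"
      then have p: "p \<in> lists {..<k + l}" using u by auto
      have "word_mat (y # p) \<omega> $$ (c, column_of x) = (\<Sum>e<N. letter_mat \<omega> y $$ (c, e) * word_mat p
          \<omega> $$ (e, column_of x))"
        using mult_mat_entry[OF letter_mat_carrier[OF \<omega> y] word_mat_carrier[OF \<omega> p] Cons.prems(2)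
            rx(2)] by (simp add: word_mat_def)
      then show "(\<Sum>e<N. letter_mat \<omega> y $$ (c, e) * (word_mat p \<omega> $$ (e, column_of x) * word_mat q
          \<omega> $$ (row_of x, d))) =
        word_mat (y # p) \<omega> $$ (c, column_of x) * word_mat q \<omega> $$ (row_of x, d)"
        by (simp add: sum_distrib_right mult.assoc)
    qed
    finally show "deriv_word_mat (y # u) (c, d) x \<omega> = (\<Sum>e<N. E e x * word_mat u \<omega> $$ (e, d) +
        letter_mat \<omega> y $$ (c, e) * deriv_word_mat u (e, d) x \<omega>)"
      unfolding sum.distrib 1 by (simp add: deriv_word_mat_def split_sum_Cons)
  qed
qed

definition deriv_word_trace :: "nat list \<Rightarrow> nat \<times> nat \<times> nat \<Rightarrow> 'a \<Rightarrow> complex" where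
  "deriv_word_trace u x \<omega> = split_sum (fst x) (\<lambda>p q. word_mat (q @ p) \<omega> $$ snd x) u / of_nat N"

lemma entry_poly_word_trace:
  assumes u: "u \<in> lists {..<k + l}"
  shows "entry_poly (word_trace u) (deriv_word_trace u)"
proof -
  have "entry_poly (\<lambda>\<omega>. (1 / of_nat N) * (\<Sum>c<N. word_mat u \<omega> $$ (c, c)))
    (\<lambda>x \<omega>. (1 / of_nat N) * (\<Sum>c<N. deriv_word_mat u (c, c) x \<omega>))"
    using u by (intro entry_poly_cmult entry_poly_sum entry_poly_word_mat) auto
  then show ?thesis
  proof (rule entry_poly_cong)
    fix \<omega> x assume \<omega>: "\<omega> \<in> space M" and x: "x \<in> entry_indices k N"
    then have rx: "row_of x < N" "column_of x < N" by (auto simp: entry_indices_def)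
    have "(\<Sum>c<N. deriv_word_mat u (c, c) x \<omega>) =
      split_sum (fst x) (\<lambda>p q. \<Sum>c<N. word_mat p \<omega> $$ (c, column_of x) * word_mat q \<omega> $$ (row_of x,
          c)) u"
      by (simp add: deriv_word_mat_def split_sum_sum)
    also have "\<dots> = split_sum (fst x) (\<lambda>p q. word_mat (q @ p) \<omega> $$ snd x) u"
    proof (rule split_sum_cong)
      fix p q assume "u = p @ fst x # q"
      then have pq: "p \<in> lists {..<k + l}" "q \<in> lists {..<k + l}" using u by auto
      show "(\<Sum>c<N. word_mat p \<omega> $$ (c, column_of x) * word_mat q \<omega> $$ (row_of x, c)) = word_mat (q
          @ p) \<omega> $$ snd x"
        using word_mat_append_entry[OF \<omega> pq(2,1) rx] by (simp add: mult.commute)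
    qed
    finally show "deriv_word_trace u x \<omega> = (1 / of_nat N) * (\<Sum>c<N. deriv_word_mat u (c, c) x \<omega>)"
      by (simp add: deriv_word_trace_def)
  qed (simp add: word_trace_def ntrace_def)
qed

primrec deriv_trace_prod :: "nat list list \<Rightarrow> nat \<times> nat \<times> nat \<Rightarrow> 'a \<Rightarrow> complex" where
  "deriv_trace_prod [] x \<omega> = 0"
| "deriv_trace_prod (u # us) x \<omega> = deriv_word_trace u x \<omega> * trace_prod us \<omega> + word_trace u \<omega> *
    deriv_trace_prod us x \<omega>"

lemma entry_poly_trace_prod:
  assumes "set us \<subseteq> lists {..<k + l}"
  shows "entry_poly (trace_prod us) (deriv_trace_prod us)"
  using assms
proof (induction us)
  case Nil
  show ?case
    by (rule entry_poly_cong[OF entry_poly_const[of 1]]) simp_all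
next
  case (Cons u us)
  then have "entry_poly (\<lambda>\<omega>. word_trace u \<omega> * trace_prod us \<omega>) (\<lambda>x \<omega>. deriv_word_trace u x \<omega> *
      trace_prod us \<omega> + word_trace u \<omega> * deriv_trace_prod us x \<omega>)"
    by (intro entry_poly_mult entry_poly_word_trace) auto
  then show ?case by (rule entry_poly_cong) simp_all
qed

lemma trace_prod_integrable: "set us \<subseteq> lists {..<k + l} \<Longrightarrow> integrable M (trace_prod us)"
  using entry_poly_trace_prod entry_poly_integrable by blast

text \<open>Summing over all entries closes the open indices of the differentiated trace and of the word
  \<open>y\<close> into one trace. The sum of products of entries contributes a factor \<open>N\<close>, which cancels the
  normalisation of the differentiated trace.\<close>

lemma sum_deriv_trace_prod:
  assumes \<omega>: "\<omega> \<in> space M" and y: "y \<in> lists {..<k + l}" and us: "set us \<subseteq> lists {..<k + l}"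
  shows "(\<Sum>a<N. \<Sum>b<N. word_mat y \<omega> $$ (b, a) * deriv_trace_prod us (i, (a, b)) \<omega>) = (\<Sum>zs\<leftarrow>joins i y
      us. trace_prod zs \<omega>)"
  using us
proof (induction us)
  case (Cons u us)
  have u: "u \<in> lists {..<k + l}" using Cons.prems by simp
  have "(\<Sum>a<N. \<Sum>b<N. word_mat y \<omega> $$ (b, a) * deriv_word_trace u (i, (a, b)) \<omega>)
    = split_sum i (\<lambda>p q. (\<Sum>a<N. \<Sum>b<N. word_mat y \<omega> $$ (b, a) * word_mat (q @ p) \<omega> $$ (a, b))) u /
        of_nat N"
    by (simp add: deriv_word_trace_def split_sum_sum[symmetric] split_sum_cmult sum_divide_distrib)
  also have "\<dots> = split_sum i (\<lambda>p q. of_nat N * word_trace (y @ q @ p) \<omega>) u / of_nat N"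
  proof (intro arg_cong2[where f = "(/)"] split_sum_cong refl)
    fix p q assume "u = p @ i # q"
    then have qp: "q @ p \<in> lists {..<k + l}" using u by auto
    show "(\<Sum>a<N. \<Sum>b<N. word_mat y \<omega> $$ (b, a) * word_mat (q @ p) \<omega> $$ (a, b)) = of_nat N *
        word_trace (y @ q @ p) \<omega>"
      by (subst sum.swap) (rule word_trace_sum[OF \<omega> y qp])
  qed
  also have "\<dots> = split_sum i (\<lambda>p q. word_trace (y @ q @ p) \<omega>) u"
    using N_pos by (simp add: split_sum_cmult)
  finally have 1: "(\<Sum>a<N. \<Sum>b<N. word_mat y \<omega> $$ (b, a) * deriv_word_trace u (i, (a, b)) \<omega>) =
      split_sum i (\<lambda>p q. word_trace (y @ q @ p) \<omega>) u" .
  have "(\<Sum>a<N. \<Sum>b<N. word_mat y \<omega> $$ (b, a) * deriv_trace_prod (u # us) (i, (a, b)) \<omega>)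
    = (\<Sum>a<N. \<Sum>b<N. word_mat y \<omega> $$ (b, a) * deriv_word_trace u (i, (a, b)) \<omega>) * trace_prod us \<omega> +
      word_trace u \<omega> * (\<Sum>a<N. \<Sum>b<N. word_mat y \<omega> $$ (b, a) * deriv_trace_prod us (i, (a, b)) \<omega>)"
    by (simp add: distrib_left sum.distrib sum_distrib_left sum_distrib_right mult_ac)
  also have "\<dots> = split_sum i (\<lambda>p q. word_trace (y @ q @ p) \<omega>) u * trace_prod us \<omega> + word_trace u \<omega>
      * (\<Sum>zs\<leftarrow>joins i y us. trace_prod zs \<omega>)"
    using Cons by (simp add: 1)
  also have "\<dots> = (\<Sum>zs\<leftarrow>joins i y (u # us). trace_prod zs \<omega>)"
    by (simp add: split_sum_def sum_list_mult_const[symmetric] sum_list_const_mult[symmetric]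
        comp_def case_prod_unfold)
  finally show ?case .
qed simp

text \<open>By cyclicity, \<open>tr(\<alpha> i u)\<close> is \<open>1 / N\<close> times the sum over \<open>a\<close> and \<open>b\<close> of \<open>(W i)\<^bsub>a b\<^esub> (u \<alpha>)\<^bsub>b a\<^esub>\<close>, and each
  summand is integrated by parts. Where the derivative hits \<open>u\<close>, the two open indices close separately
  and produce two unnormalised traces, hence a factor \<open>N\<^sup>2\<close>; where it hits another trace, there is no
  such factor. The variance of the entries is \<open>v\<close>, so the first kind of term has the weight
  \<open>N v\<close> and the second kind \<open>v / N\<close>.\<close>

theorem schwinger_dyson_gue:
  assumes i: "i < k" and \<alpha>: "\<alpha> \<in> lists {k..<k + l}" and u: "u \<in> lists {..<k + l}"
    and us: "set us \<subseteq> lists {..<k + l}"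
  shows "expectation (trace_prod ((\<alpha> @ i # u) # us)) =
    of_real (real N * v) * (\<Sum>(p, q)\<leftarrow>splits i u. expectation (trace_prod (p # (\<alpha> @ q) # us))) +
    of_real (real N * v) / of_nat N ^ 2 * (\<Sum>zs\<leftarrow>joins i (u @ \<alpha>) us. expectation (trace_prod zs))"
proof -
  define y where "y = u @ \<alpha>"
  have \<alpha>': "\<alpha> \<in> lists {..<k + l}" using \<alpha> by auto
  have y: "y \<in> lists {..<k + l}" using u \<alpha>' by (simp add: y_def)
  have i\<alpha>: "i \<notin> set \<alpha>" using \<alpha> i by auto
  define F where "F ab \<omega> = word_mat y \<omega> $$ (snd ab, fst ab) * trace_prod us \<omega>" for ab :: "nat \<times>
      nat" and \<omega>
  define D where "D ab x \<omega> = deriv_word_mat y (snd ab, fst ab) x \<omega> * trace_prod us \<omega> +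
    word_mat y \<omega> $$ (snd ab, fst ab) * deriv_trace_prod us x \<omega>" for ab :: "nat \<times> nat" and x \<omega>
  let ?J = "{..<N} \<times> {..<N}"
  have FD: "entry_poly (F ab) (D ab)" if "ab \<in> ?J" for ab
    unfolding F_def[abs_def] D_def[abs_def] using that y us
    by (intro entry_poly_mult entry_poly_word_mat entry_poly_trace_prod) auto
  have ind: "(i, ab) \<in> entry_indices k N" if "ab \<in> ?J" for ab
    using that i by (auto simp: entry_indices_def)
  note ibp = gaussian_integration_by_parts[OF FD ind]
  have "expectation (trace_prod ((\<alpha> @ i # u) # us)) =
    expectation (\<lambda>\<omega>. (1 / of_nat N) * (\<Sum>ab\<in>?J. mat_entry W (i, ab) \<omega> * F ab \<omega>))"
  proof (rule Bochner_Integration.integral_cong[OF refl])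
    fix \<omega> assume \<omega>: "\<omega> \<in> space M"
    have iu: "i # u \<in> lists {..<k + l}" "[i] \<in> lists {..<k + l}" using i u by auto
    have "word_trace (\<alpha> @ i # u) \<omega> = word_trace ([i] @ y) \<omega>"
      using word_trace_commute[OF \<omega> \<alpha>' iu(1)] by (simp add: y_def)
    moreover have "of_nat N * word_trace ([i] @ y) \<omega> = (\<Sum>a<N. \<Sum>b<N. word_mat [i] \<omega> $$ (a, b) *
        word_mat y \<omega> $$ (b, a))"
      by (rule word_trace_sum[OF \<omega> iu(2) y, symmetric])
    moreover have "word_mat [i] \<omega> = W i \<omega>"
      using W_carrier[OF i \<omega>] i by (simp add: word_mat_def letter_mat_def append_tuple_def)
    ultimately have "of_nat N * word_trace (\<alpha> @ i # u) \<omega> = (\<Sum>ab\<in>?J. mat_entry W (i, ab) \<omega> *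
        word_mat y \<omega> $$ (snd ab, fst ab))"
      by (simp add: sum.cartesian_product mat_entry_def case_prod_unfold)
    then have "word_trace (\<alpha> @ i # u) \<omega> = (1 / of_nat N) * (\<Sum>ab\<in>?J. mat_entry W (i, ab) \<omega> *
        word_mat y \<omega> $$ (snd ab, fst ab))"
      using N_pos by (simp add: field_simps)
    then show "trace_prod ((\<alpha> @ i # u) # us) \<omega> = (1 / of_nat N) * (\<Sum>ab\<in>?J. mat_entry W (i, ab) \<omega> *
        F ab \<omega>)"
      by (simp add: F_def sum_distrib_right mult.assoc)
  qed
  also have "\<dots> = (1 / of_nat N) * (\<Sum>ab\<in>?J. expectation (\<lambda>\<omega>. mat_entry W (i, ab) \<omega> * F ab \<omega>))"
    unfolding integral_mult_right_zero
    by (subst Bochner_Integration.integral_sum) (rule ibp(1), assumption+, rule refl)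
  also have "\<dots> = (1 / of_nat N) * (\<Sum>ab\<in>?J. of_real v * expectation (D ab (i, ab)))"
    by (intro arg_cong2[where f = "(*)"] refl sum.cong ibp(3))
  also have "\<dots> = of_real v / of_nat N * expectation (\<lambda>\<omega>. \<Sum>ab\<in>?J. D ab (i, ab) \<omega>)"
    by (subst Bochner_Integration.integral_sum) (auto intro: ibp(2) simp: sum_distrib_left[symmetric])
  also have "expectation (\<lambda>\<omega>. \<Sum>ab\<in>?J. D ab (i, ab) \<omega>) =
    expectation (\<lambda>\<omega>. of_nat N ^ 2 * (\<Sum>(p, q)\<leftarrow>splits i u. trace_prod (p # (\<alpha> @ q) # us) \<omega>) +
      (\<Sum>zs\<leftarrow>joins i y us. trace_prod zs \<omega>))"
  proof (rule Bochner_Integration.integral_cong[OF refl])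
    fix \<omega> assume \<omega>: "\<omega> \<in> space M"
    have "(\<Sum>ab\<in>?J. deriv_word_mat y (snd ab, fst ab) (i, ab) \<omega>)
      = split_sum i (\<lambda>p q. \<Sum>ab\<in>?J. word_mat p \<omega> $$ (snd ab, snd ab) * word_mat (q @ \<alpha>) \<omega> $$ (fst
          ab, fst ab)) u"
      by (simp add: deriv_word_mat_def split_sum_sum y_def split_sum_map_append[OF i\<alpha>])
    also have "\<dots> = split_sum i (\<lambda>p q. of_nat N ^ 2 * (word_trace p \<omega> * word_trace (\<alpha> @ q) \<omega>)) u"
    proof (rule split_sum_cong)
      fix p q assume "u = p @ i # q"
      then have q: "q \<in> lists {..<k + l}" using u by auto
      have "(\<Sum>ab\<in>?J. word_mat p \<omega> $$ (snd ab, snd ab) * word_mat (q @ \<alpha>) \<omega> $$ (fst ab, fst ab))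
        = (\<Sum>a<N. \<Sum>b<N. word_mat p \<omega> $$ (b, b) * word_mat (q @ \<alpha>) \<omega> $$ (a, a))"
        by (simp add: sum.cartesian_product case_prod_unfold)
      also have "\<dots> = (\<Sum>b<N. word_mat p \<omega> $$ (b, b)) * (\<Sum>a<N. word_mat (q @ \<alpha>) \<omega> $$ (a, a))"
        by (subst sum.swap) (simp add: sum_product)
      also have "\<dots> = of_nat N ^ 2 * (word_trace p \<omega> * word_trace (q @ \<alpha>) \<omega>)"
        using N_pos by (simp add: word_trace_def ntrace_def power2_eq_square)
      also have "word_trace (q @ \<alpha>) \<omega> = word_trace (\<alpha> @ q) \<omega>" by (rule word_trace_commute[OF \<omega> q \<alpha>'])
      finally show "(\<Sum>ab\<in>?J. word_mat p \<omega> $$ (snd ab, snd ab) * word_mat (q @ \<alpha>) \<omega> $$ (fst ab, fst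
          ab)) =
        of_nat N ^ 2 * (word_trace p \<omega> * word_trace (\<alpha> @ q) \<omega>)" .
    qed
    finally have 1: "(\<Sum>ab\<in>?J. deriv_word_mat y (snd ab, fst ab) (i, ab) \<omega>) * trace_prod us \<omega> =
      of_nat N ^ 2 * (\<Sum>(p, q)\<leftarrow>splits i u. trace_prod (p # (\<alpha> @ q) # us) \<omega>)"
      by (simp add: split_sum_cmult) (simp add: split_sum_def sum_list_mult_const[symmetric]
          case_prod_unfold mult.assoc)
    have "(\<Sum>ab\<in>?J. word_mat y \<omega> $$ (snd ab, fst ab) * deriv_trace_prod us (i, ab) \<omega>) = (\<Sum>zs\<leftarrow>joins
        i y us. trace_prod zs \<omega>)"
      using sum_deriv_trace_prod[OF \<omega> y us, of i] by (simp add: sum.cartesian_product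
          case_prod_unfold)
    then show "(\<Sum>ab\<in>?J. D ab (i, ab) \<omega>) = of_nat N ^ 2 * (\<Sum>(p, q)\<leftarrow>splits i u. trace_prod (p # (\<alpha> @
        q) # us) \<omega>) +
      (\<Sum>zs\<leftarrow>joins i y us. trace_prod zs \<omega>)"
      by (simp only: D_def sum.distrib sum_distrib_right[symmetric] 1)
  qed
  also have "\<dots> = of_nat N ^ 2 * (\<Sum>(p, q)\<leftarrow>splits i u. expectation (trace_prod (p # (\<alpha> @ q) # us))) +
      (\<Sum>zs\<leftarrow>joins i y us. expectation (trace_prod zs))"
  proof -
    have s: "integrable M (trace_prod (fst pq # (\<alpha> @ snd pq) # us))" if "pq \<in> set (splits i u)" for pq
      using splits_imp[of "fst pq" "snd pq" i u] that u \<alpha>' us by (intro trace_prod_integrable) auto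
    have j: "integrable M (trace_prod zs)" if "zs \<in> set (joins i y us)" for zs
      using joins_letters[OF that y us] by (rule trace_prod_integrable)
    note s' = integral_sum_list[of "splits i u" M "\<lambda>pq. trace_prod (fst pq # (\<alpha> @ snd pq) # us)",
        OF s]
    note j' = integral_sum_list[of "joins i y us" M trace_prod, OF j]
    show ?thesis
      unfolding case_prod_unfold
      by (subst Bochner_Integration.integral_add[OF integrable_mult_right[OF s'(2)] j'(2)])
        (simp_all only: integral_mult_right_zero s'(1) j'(1))
  qed
  finally have eq: "expectation (trace_prod ((\<alpha> @ i # u) # us)) = of_real v / of_nat N *
      (of_nat N ^ 2 * (\<Sum>(p, q)\<leftarrow>splits i u. expectation (trace_prod (p # (\<alpha> @ q) # us))) +
      (\<Sum>zs\<leftarrow>joins i y us. expectation (trace_prod zs)))" .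
  show ?thesis
    unfolding eq y_def using N_pos by (simp add: field_simps power2_eq_square)
qed

lemma trace_prod_unfold:
  "trace_prod us = (\<lambda>\<omega>. \<Prod>u\<leftarrow>us. ntrace N (mat_word N (append_tuple k (\<lambda>i. W i \<omega>) A) u))"
  by (simp add: fun_eq_iff trace_prod_def word_trace_def word_mat_def letter_mat_def)

end

section \<open>The Schwinger-Dyson equation for the free product model\<close>

lemma word_eval_map: "word_eval S x (map f u) = word_eval S (\<lambda>i. x (f i)) u"
  by (induction u) (simp_all add: word_eval_def)

lemma word_eval_cong:
  assumes "\<And>i. i \<in> set u \<Longrightarrow> x i = y i"
  shows "word_eval S x u = word_eval S y u"
  using assms by (induction u) (simp_all add: word_eval_def)

lemma semicircular_model_state:
  assumes "free_product_model k l v \<nu> S w a" and i: "i < k" and v: "v \<ge> 0" and u: "u \<in> lists {i}"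
  shows "model_state k S w a (i # u) =
    v * split_sum i (\<lambda>p q. model_state k S w a p * model_state k S w a q) u"
proof -
  interpret nc_prob_space S using assms by (simp add: free_product_model_def)
  have sc: "semicircular S v (w i)" using assms by (simp add: free_product_model_def)
  define m where "m = semicircle_moment v"
  have mom: "model_state k S w a (replicate n i) = of_real (m n)" for n
    using word_eval_replicate[of "append_tuple k w a" i n] sc i
    by (simp add: model_state_def semicircular_def append_tuple_def m_def semicircle_moment_def)
  have "complex_of_real (m 0) = 1"
    using mom[of 0] state_one by (simp add: model_state_def word_eval_def)
  then have m0: "m 0 = 1" by simp
  have ur: "u = replicate (length u) i"
    using u by (intro replicate_eqI) auto
  define n where "n = length u"
  have "model_state k S w a (replicate (Suc n) i) =
    v * split_sum i (\<lambda>p q. model_state k S w a p * model_state k S w a q) (replicate n i)"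
    unfolding mom split_sum_replicate
    using semicircle_moment_recursion[OF v m0[unfolded m_def], of n] by (simp add: m_def)
  then show ?thesis using ur by (simp add: n_def)
qed

theorem schwinger_dyson_model:
  assumes model: "free_product_model k l v \<nu> S w a" and i: "i < k" and v: "v \<ge> 0"
    and \<alpha>: "\<alpha> \<in> lists {k..<k + l}" and u: "u \<in> lists {..<k + l}"
  shows "model_state k S w a (\<alpha> @ i # u) =
    v * split_sum i (\<lambda>p q. model_state k S w a p * model_state k S w a (\<alpha> @ q)) u"
proof -
  interpret nc_prob_space S using model by (simp add: free_product_model_def)
  show ?thesis
  proof (rule schwinger_dyson_free[OF word_free_model[OF model], where s = i and j = k])
    show "model_state k S w a [] = 1" by (simp add: model_state_def word_eval_def state_one)
    show "letter_class k l i = {i}" using i by (simp add: letter_class_def)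
    show "\<And>t. t \<in> {..k} \<Longrightarrow> t \<noteq> i \<Longrightarrow> i \<notin> letter_class k l t"
      using i by (auto simp: letter_class_def)
    show "\<And>u. u \<in> lists {i} \<Longrightarrow> model_state k S w a (i # u) =
        v * split_sum i (\<lambda>p q. model_state k S w a p * model_state k S w a q) u"
      by (rule semicircular_model_state[OF model i v])
    show "u \<in> lists (\<Union>t\<in>{..k}. letter_class k l t)" using u by (simp only: UN_letter_class)
    show "\<alpha> \<in> lists (letter_class k l k)" using \<alpha> by (simp add: letter_class_def)
  qed (use i in auto)
qed

lemma mat_space_state_word: "state (mat_space N) (word_eval (mat_space N) X u) = ntrace N
    (mat_word N X u)"
  by (simp add: mat_word_def ntrace_def mat_space_def)

lemma star_law_unstarred_word:
  assumes "nc_prob_space S" and "\<And>j. j < l \<Longrightarrow> a j \<in> carrier S" and u: "u \<in> lists {..<l}"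
  shows "star_law S a (nc_monom (map (\<lambda>j. (j, False)) u)) = state S (word_eval S a u)"
proof -
  interpret nc_prob_space S by fact
  let ?x = "\<lambda>(i, b). if b then star S (a i) else a i"
  have "nc_law S ?x (nc_monom (map (\<lambda>j. (j, False)) u)) =
    lin_ext (\<lambda>u. state S (word_eval S ?x u)) (nc_monom (map (\<lambda>j. (j, False)) u))"
  proof (rule nc_law_eq_lin_ext)
    show "nc_monom (map (\<lambda>j. (j, False)) u) \<in> ncpolys ({..<l} \<times> {False})"
      using u by (intro ncpolys_closed) auto
    show "\<And>i. i \<in> {..<l} \<times> {False} \<Longrightarrow> ?x i \<in> carrier S" using assms by auto
  qed
  then show ?thesis by (simp add: star_law_def word_eval_map)
qed

text \<open>The model realises the \<open>*\<close>-distribution of the matrices \<open>A j\<close>, whose expectation is that of a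
  constant. The letters \<open>x\<close> below \<open>k\<close> do not occur in \<open>u\<close> and are arbitrary.\<close>

lemma model_state_deterministic:
  assumes model: "free_product_model k l v (rand_star_law M N (\<lambda>j _. A j)) S w a"
    and M: "prob_space M" and N: "N \<ge> 1" and A: "\<And>j. j < l \<Longrightarrow> A j \<in> carrier_mat N N"
    and u: "u \<in> lists {k..<k + l}"
  shows "model_state k S w a u = ntrace N (mat_word N (append_tuple k x A) u)"
proof -
  interpret M: prob_space M by fact
  define u' where "u' = map (\<lambda>j. j - k) u"
  have "j - k < l" if "j \<in> set u" for j
  proof -
    have "j \<in> {k..<k + l}" using u that by auto
    then show ?thesis by auto
  qed
  then have u': "u' \<in> lists {..<l}" by (auto simp: u'_def)
  define Q where "Q = nc_monom (map (\<lambda>j. (j, False)) u')"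
  have Q: "Q \<in> ncpolys ({..<l} \<times> UNIV)"
    unfolding Q_def using u' by (intro ncpolys_closed) auto
  have "word_eval S (append_tuple k w a) u = word_eval S a u'"
    unfolding u'_def word_eval_map using u by (intro word_eval_cong) (auto simp: append_tuple_def)
  then have "model_state k S w a u = state S (word_eval S a u')"
    by (simp add: model_state_def)
  also have "\<dots> = star_law S a Q"
    unfolding Q_def using model by (intro star_law_unstarred_word[OF _ _ u', symmetric]) (auto
        simp: free_product_model_def)
  also have "\<dots> = rand_star_law M N (\<lambda>j _. A j) Q"
    using model Q by (simp add: free_product_model_def)
  also have "\<dots> = star_law (mat_space N) A Q"
    by (simp add: rand_star_law_def M.prob_space)
  also have "\<dots> = state (mat_space N) (word_eval (mat_space N) A u')"
    unfolding Q_def using A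
    by (intro star_law_unstarred_word[OF nc_prob_space_mat_space[OF N] _ u']) (auto simp:
        mat_space_def)
  also have "word_eval (mat_space N) A u' = word_eval (mat_space N) (append_tuple k x A) u"
    unfolding u'_def word_eval_map using u by (intro word_eval_cong) (auto simp: append_tuple_def)
  finally show ?thesis by (simp only: mat_space_state_word)
qed

section \<open>Operator norm bounds for traces\<close>

lemma vec_norm2_nonneg: "vec_norm2 x \<ge> 0"
  by (simp add: vec_norm2_def L2_set_nonneg)

lemma vec_norm2_smult: "vec_norm2 (c \<cdot>\<^sub>v x) = cmod c * vec_norm2 x"
proof -
  have "vec_norm2 (c \<cdot>\<^sub>v x) = L2_set (\<lambda>i. cmod c * cmod (vec_index x i)) {..<dim_vec x}"
    unfolding vec_norm2_def by (intro L2_set_cong) (auto simp: norm_mult)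
  then show ?thesis by (simp add: vec_norm2_def L2_set_right_distrib)
qed

lemma vec_norm2_component: "i < dim_vec x \<Longrightarrow> cmod (vec_index x i) \<le> vec_norm2 x"
  unfolding vec_norm2_def by (rule member_le_L2_set) auto

text \<open>The operator norm is defined as a supremum of reals, which is a least upper bound only of sets
  that are bounded above. Here the sum of the absolute values of the entries is an upper bound.\<close>

lemma op_norm_bdd:
  fixes Y :: "complex mat"
  assumes Y: "Y \<in> carrier_mat N N"
  shows "bdd_above ((\<lambda>x. vec_norm2 (Y *\<^sub>v x)) ` {x \<in> carrier_vec (dim_col Y). vec_norm2 x \<le> 1})"
proof (rule bdd_aboveI2)
  fix x assume "x \<in> {x \<in> carrier_vec (dim_col Y). vec_norm2 x \<le> 1}"
  then have x: "dim_vec x = N" "vec_norm2 x \<le> 1" using Y by auto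
  have "vec_norm2 (Y *\<^sub>v x) \<le> (\<Sum>i<N. \<bar>cmod (vec_index (Y *\<^sub>v x) i)\<bar>)"
    unfolding vec_norm2_def using L2_set_le_sum_abs[of "\<lambda>i. cmod (vec_index (Y *\<^sub>v x) i)"
        "{..<N}"] Y by simp
  also have "\<dots> \<le> (\<Sum>i<N. \<Sum>j<N. cmod (Y $$ (i, j)))"
  proof (rule sum_mono)
    fix i assume i: "i \<in> {..<N}"
    have "vec_index (Y *\<^sub>v x) i = (\<Sum>j<N. Y $$ (i, j) * vec_index x j)"
      using Y i x by (simp add: scalar_prod_def atLeast0LessThan)
    then have "\<bar>cmod (vec_index (Y *\<^sub>v x) i)\<bar> \<le> (\<Sum>j<N. cmod (Y $$ (i, j) * vec_index x j))"
      by (simp add: norm_sum)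
    also have "\<dots> \<le> (\<Sum>j<N. cmod (Y $$ (i, j)))"
    proof (rule sum_mono)
      fix j assume "j \<in> {..<N}"
      then have "cmod (vec_index x j) \<le> 1" using vec_norm2_component[of j x] x by auto
      then show "cmod (Y $$ (i, j) * vec_index x j) \<le> cmod (Y $$ (i, j))"
        by (simp add: norm_mult mult_left_le)
    qed
    finally show "\<bar>cmod (vec_index (Y *\<^sub>v x) i)\<bar> \<le> (\<Sum>j<N. cmod (Y $$ (i, j)))" .
  qed
  finally show "vec_norm2 (Y *\<^sub>v x) \<le> (\<Sum>i<N. \<Sum>j<N. cmod (Y $$ (i, j)))" .
qed

lemma vec_norm2_mult_le:
  fixes Y :: "complex mat"
  assumes Y: "Y \<in> carrier_mat N N" and x: "x \<in> carrier_vec N"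
  shows "vec_norm2 (Y *\<^sub>v x) \<le> op_norm Y * vec_norm2 x"
proof (cases "vec_norm2 x = 0")
  case True
  have "vec_index x i = 0" if "i < N" for i
    using vec_norm2_component[of i x] True that x by auto
  then have "x = 0\<^sub>v N" using x by (intro eq_vecI) auto
  then have "Y *\<^sub>v x = 0\<^sub>v N" using Y by auto
  then show ?thesis using True by (simp add: vec_norm2_def L2_set_def)
next
  case False
  then have pos: "vec_norm2 x > 0" using vec_norm2_nonneg[of x] by simp
  define c where "c = complex_of_real (1 / vec_norm2 x)"
  have c: "cmod c = 1 / vec_norm2 x" using pos by (simp add: c_def norm_divide)
  have "vec_norm2 (Y *\<^sub>v (c \<cdot>\<^sub>v x)) \<le> op_norm Y"
    unfolding op_norm_def
  proof (rule cSUP_upper[OF _ op_norm_bdd[OF Y]])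
    show "c \<cdot>\<^sub>v x \<in> {x \<in> carrier_vec (dim_col Y). vec_norm2 x \<le> 1}"
      using x Y pos by (simp add: vec_norm2_smult c)
  qed
  moreover have "Y *\<^sub>v (c \<cdot>\<^sub>v x) = c \<cdot>\<^sub>v (Y *\<^sub>v x)" by (rule mult_mat_vec[OF Y x])
  ultimately show ?thesis
    using pos by (simp add: vec_norm2_smult c divide_le_eq)
qed

lemma op_norm_nonneg:
  fixes Y :: "complex mat"
  assumes Y: "Y \<in> carrier_mat N N"
  shows "op_norm Y \<ge> 0"
  unfolding op_norm_def
  by (rule cSUP_upper2[OF op_norm_bdd[OF Y], of "0\<^sub>v N"])
    (use Y in \<open>auto simp: vec_norm2_nonneg vec_norm2_def L2_set_def\<close>)

lemma vec_norm2_mat_word_le: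
  assumes X: "\<And>i. i \<in> set u \<Longrightarrow> X i \<in> carrier_mat N N \<and> op_norm (X i) \<le> C"
    and x: "x \<in> carrier_vec N"
  shows "vec_norm2 (mat_word N X u *\<^sub>v x) \<le> C ^ length u * vec_norm2 x"
  using X
proof (induction u)
  case Nil
  then show ?case using x by simp
next
  case (Cons i u)
  have Xi: "X i \<in> carrier_mat N N" "op_norm (X i) \<le> C" using Cons.prems by auto
  have mw: "mat_word N X u \<in> carrier_mat N N" using Cons.prems by (intro mat_word_carrier) auto
  then have y: "mat_word N X u *\<^sub>v x \<in> carrier_vec N" using x by (rule mult_mat_vec_carrier)
  have C: "C \<ge> 0" using op_norm_nonneg[OF Xi(1)] Xi(2) by linarith
  have "vec_norm2 (mat_word N X (i # u) *\<^sub>v x) = vec_norm2 (X i *\<^sub>v (mat_word N X u *\<^sub>v x))"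
    using assoc_mult_mat_vec[OF Xi(1) mw x] by simp
  also have "\<dots> \<le> op_norm (X i) * vec_norm2 (mat_word N X u *\<^sub>v x)"
    by (rule vec_norm2_mult_le[OF Xi(1) y])
  also have "\<dots> \<le> C * (C ^ length u * vec_norm2 x)"
    using Cons C Xi(2) by (intro mult_mono) (auto simp: vec_norm2_nonneg)
  finally show ?case by (simp add: mult.assoc)
qed

lemma ntrace_mat_word_le:
  assumes X: "\<And>i. i \<in> set u \<Longrightarrow> X i \<in> carrier_mat N N \<and> op_norm (X i) \<le> C" and N: "N \<ge> 1"
  shows "cmod (ntrace N (mat_word N X u)) \<le> C ^ length u"
proof -
  have mw: "mat_word N X u \<in> carrier_mat N N" using X by (intro mat_word_carrier) auto
  have "cmod (mat_word N X u $$ (i, i)) \<le> C ^ length u" if i: "i < N" for i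
  proof -
    have n1: "vec_norm2 (unit_vec N i :: complex vec) = 1"
    proof -
      have "vec_norm2 (unit_vec N i :: complex vec) = L2_set (\<lambda>j. if j = i then 1 else 0) {..<N}"
        unfolding vec_norm2_def by (intro L2_set_cong) (auto simp: unit_vec_def)
      also have "\<dots> = 1" using i by (simp add: L2_set_def if_distrib[of "\<lambda>x. x ^ 2"] cong: if_cong)
      finally show ?thesis .
    qed
    have "mat_word N X u $$ (i, i) = vec_index (mat_word N X u *\<^sub>v unit_vec N i) i"
      using mw i by simp
    also have "cmod \<dots> \<le> vec_norm2 (mat_word N X u *\<^sub>v unit_vec N i)"
      using mw i by (intro vec_norm2_component) auto
    also have "\<dots> \<le> C ^ length u"
      using vec_norm2_mat_word_le[where u = u and X = X and N = N and x = "unit_vec N i", OF X] n1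
          by simp
    finally show ?thesis .
  qed
  then have "cmod (\<Sum>i<N. mat_word N X u $$ (i, i)) \<le> of_nat (card {..<N}) * C ^ length u"
    by (intro sum_norm_bound) auto
  then show ?thesis using N by (simp add: ntrace_def norm_divide divide_le_eq mult.commute)
qed

section \<open>Comparison of the two recursions\<close>

lemma sum_list_in_bigo:
  fixes f :: "'b \<Rightarrow> 'c \<Rightarrow> complex"
  assumes "\<And>x. x \<in> set xs \<Longrightarrow> f x \<in> O[F](g)"
  shows "(\<lambda>n. \<Sum>x\<leftarrow>xs. f x n) \<in> O[F](g)"
  using assms by (induction xs) (auto intro!: sum_in_bigo)

definition random_letter_count :: "nat \<Rightarrow> nat list list \<Rightarrow> nat" where
  "random_letter_count k us = length (filter (\<lambda>x. x < k) (concat us))"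

lemma random_letter_count_simps [simp]:
  "random_letter_count k [] = 0" "random_letter_count k (u # us) = length (filter (\<lambda>x. x < k) u) +
      random_letter_count k us"
  "random_letter_count k (us @ vs) = random_letter_count k us + random_letter_count k vs"
  by (simp_all add: random_letter_count_def)

lemma random_letter_count_joins:
  assumes "zs \<in> set (joins i y us)" "i < k"
  shows "Suc (random_letter_count k zs) = random_letter_count k (y # us)"
  using assms(1)
proof (induction us arbitrary: zs)
  case (Cons u us)
  consider p q where "(p, q) \<in> set (splits i u)" "zs = (y @ q @ p) # us"
    | ws where "ws \<in> set (joins i y us)" "zs = u # ws"
    using Cons.prems by auto
  then show ?case
  proof cases
    case 1
    then show ?thesis using splits_imp[of p q i u] assms(2) by simp
  next
    case 2
    then show ?thesis using Cons.IH[of ws] by simp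
  qed
qed simp

text \<open>Move a word with a letter below \<open>k\<close> to the front and expand it at its first such letter. All
  lists of words that arise have fewer letters below \<open>k\<close>, so the two claims follow together by
  induction: the difference satisfies the recursion of \<open>G\<close> with the additional term
  \<open>v / N\<^sup>2 \<Sum> F\<close>, and the first claim is what controls this term.\<close>

theorem schwinger_dyson_comparison:
  fixes F G :: "nat \<Rightarrow> nat list list \<Rightarrow> complex" and v :: "nat \<Rightarrow> real"
  assumes v: "v \<in> O(\<lambda>_. 1)"
    and permF: "\<And>N u us ws. F N (us @ u # ws) = F N (u # us @ ws)"
    and permG: "\<And>N u us ws. G N (us @ u # ws) = G N (u # us @ ws)"
    and recF: "\<And>N i \<alpha> u us. N \<ge> 1 \<Longrightarrow> i < k \<Longrightarrow> \<alpha> \<in> lists {k..<K} \<Longrightarrow> u \<in> lists {..<K} \<Longrightarrow> set us \<subseteq> lists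
        {..<K} \<Longrightarrow>
      F N ((\<alpha> @ i # u) # us) = of_real (v N) * (\<Sum>(p, q)\<leftarrow>splits i u. F N (p # (\<alpha> @ q) # us)) +
        of_real (v N) / of_nat N ^ 2 * (\<Sum>zs\<leftarrow>joins i (u @ \<alpha>) us. F N zs)"
    and recG: "\<And>N i \<alpha> u us. N \<ge> 1 \<Longrightarrow> i < k \<Longrightarrow> \<alpha> \<in> lists {k..<K} \<Longrightarrow> u \<in> lists {..<K} \<Longrightarrow> set us \<subseteq> lists
        {..<K} \<Longrightarrow>
      G N ((\<alpha> @ i # u) # us) = of_real (v N) * (\<Sum>(p, q)\<leftarrow>splits i u. G N (p # (\<alpha> @ q) # us))"
    and base: "\<And>N us. N \<ge> 1 \<Longrightarrow> set us \<subseteq> lists {k..<K} \<Longrightarrow> F N us = G N us"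
    and bounded: "\<And>us. set us \<subseteq> lists {k..<K} \<Longrightarrow> (\<lambda>N. F N us) \<in> O(\<lambda>_. 1)"
    and us: "set us \<subseteq> lists {..<K}"
  shows "(\<lambda>N. F N us) \<in> O(\<lambda>_. 1)" and "(\<lambda>N. F N us - G N us) \<in> O(\<lambda>N. 1 / of_nat N ^ 2)"
proof -
  have vc: "(\<lambda>N. complex_of_real (v N)) \<in> O(\<lambda>_. 1 :: complex)"
    using v by (simp add: bigo_def)
  have ev: "eventually (\<lambda>N::nat. N \<ge> 1) at_top" by (rule eventually_ge_at_top)
  have "(\<lambda>N. F N us) \<in> O(\<lambda>_. 1) \<and> (\<lambda>N. F N us - G N us) \<in> O(\<lambda>N. 1 / of_nat N ^ 2)"
    using us
  proof (induction "random_letter_count k us" arbitrary: us rule: less_induct)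
    case less
    show ?case
    proof (cases "set us \<subseteq> lists {k..<K}")
      case True
      have "eventually (\<lambda>N. F N us - G N us = 0) at_top"
        by (rule eventually_mono[OF ev]) (simp add: base True)
      from landau_o.big.in_cong[OF this]
      have "(\<lambda>N. F N us - G N us) \<in> O(\<lambda>N. 1 / of_nat N ^ 2)" by simp
      then show ?thesis using bounded[OF True] by simp
    next
      case False
      then obtain x where x: "x \<in> set us" "x \<notin> lists {k..<K}" by blast
      obtain pre post where us: "us = pre @ x # post" using split_list[OF x(1)] by blast
      have xK: "x \<in> lists {..<K}" using less.prems x(1) by blast
      have "\<exists>i\<in>set x. i < k" using x(2) xK by force
      then obtain \<alpha> i u where xi: "x = \<alpha> @ i # u" "i < k" "\<forall>j\<in>set \<alpha>. \<not> j < k"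
        using split_list_first_prop[of x "\<lambda>i. i < k"] by blast
      have \<alpha>: "\<alpha> \<in> lists {k..<K}" and u: "u \<in> lists {..<K}"
        using xi xK by auto
      define rest where "rest = pre @ post"
      have rest: "set rest \<subseteq> lists {..<K}" using less.prems by (auto simp: rest_def us)
      have count: "random_letter_count k us = random_letter_count k (x # rest)" by (simp add: us
          rest_def)
      have IHs: "(\<lambda>N. F N (p # (\<alpha> @ q) # rest)) \<in> O(\<lambda>_. 1) \<and>
          (\<lambda>N. F N (p # (\<alpha> @ q) # rest) - G N (p # (\<alpha> @ q) # rest)) \<in> O(\<lambda>N. 1 / of_nat N ^ 2)"
        if "(p, q) \<in> set (splits i u)" for p q
      proof (rule less.hyps)
        have upq: "u = p @ i # q" using splits_imp[OF that] .
        show "random_letter_count k (p # (\<alpha> @ q) # rest) < random_letter_count k us"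
          unfolding count using xi upq by simp
        show "set (p # (\<alpha> @ q) # rest) \<subseteq> lists {..<K}" using upq u \<alpha> rest by auto
      qed
      have IHj: "(\<lambda>N. F N zs) \<in> O(\<lambda>_. 1)" if zs: "zs \<in> set (joins i (u @ \<alpha>) rest)" for zs
      proof -
        have "random_letter_count k zs < random_letter_count k us"
          unfolding count using random_letter_count_joins[OF zs xi(2)] xi by simp
        moreover have "set zs \<subseteq> lists {..<K}"
          using u \<alpha> rest by (intro joins_letters[OF zs]) auto
        ultimately show ?thesis using less.hyps by blast
      qed
      have Fus: "F N us = F N ((\<alpha> @ i # u) # rest)" and Gus: "G N us = G N ((\<alpha> @ i # u) # rest)" for N
        using permF[of N pre x post] permG[of N pre x post] by (simp_all add: us rest_def xi)
      define s where "s N = (\<Sum>pq\<leftarrow>splits i u. F N (fst pq # (\<alpha> @ snd pq) # rest))" for N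
      define d where "d N = (\<Sum>pq\<leftarrow>splits i u. F N (fst pq # (\<alpha> @ snd pq) # rest) - G N (fst pq # (\<alpha>
          @ snd pq) # rest))" for N
      define j where "j N = (\<Sum>zs\<leftarrow>joins i (u @ \<alpha>) rest. F N zs)" for N
      have s: "s \<in> O(\<lambda>_. 1)" unfolding s_def[abs_def] using IHs by (intro sum_list_in_bigo) auto
      have d: "d \<in> O(\<lambda>N. 1 / of_nat N ^ 2)" unfolding d_def[abs_def] using IHs by (intro
          sum_list_in_bigo) auto
      have j: "j \<in> O(\<lambda>_. 1)" unfolding j_def[abs_def] using IHj by (intro sum_list_in_bigo) auto
      have vs: "(\<lambda>N. of_real (v N) * s N) \<in> O(\<lambda>_. 1)" using landau_o.big_mult[OF vc s] by simp
      have vd: "(\<lambda>N. of_real (v N) * d N) \<in> O(\<lambda>N. 1 / of_nat N ^ 2)" using landau_o.big_mult[OF vc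
          d] by simp
      have vj: "(\<lambda>N. of_real (v N) / of_nat N ^ 2 * j N) \<in> O(\<lambda>N. 1 / of_nat N ^ 2)"
        using landau_o.big_mult[OF landau_o.big_mult[OF vc landau_o.big_refl[of "\<lambda>N. 1 / of_nat N
            ^ 2"]] j] by simp
      have inv: "(\<lambda>N. 1 / of_nat N ^ 2 :: complex) \<in> O(\<lambda>_. 1)"
      proof (rule bigoI[of _ 1], rule eventually_mono[OF ev])
        fix N :: nat assume "N \<ge> 1"
        then have "real N ^ 2 \<ge> 1" by simp
        then show "norm (1 / of_nat N ^ 2 :: complex) \<le> 1 * norm (1 :: complex)"
          by (simp add: norm_divide norm_power divide_le_eq)
      qed
      have "(\<lambda>N. F N us) \<in> O(\<lambda>_. 1) \<longleftrightarrow> (\<lambda>N. of_real (v N) * s N + of_real (v N) / of_nat N ^ 2 * j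
          N) \<in> O(\<lambda>_. 1)"
        using recF[OF _ xi(2) \<alpha> u rest]
        by (intro landau_o.big.in_cong eventually_mono[OF ev]) (simp add: Fus s_def j_def
            case_prod_unfold)
      moreover have "(\<lambda>N. of_real (v N) * s N + of_real (v N) / of_nat N ^ 2 * j N) \<in> O(\<lambda>_. 1)"
        using vs landau_o.big.trans[OF vj inv] by (rule sum_in_bigo)
      moreover have "(\<lambda>N. F N us - G N us) \<in> O(\<lambda>N. 1 / of_nat N ^ 2) \<longleftrightarrow>
        (\<lambda>N. of_real (v N) * d N + of_real (v N) / of_nat N ^ 2 * j N) \<in> O(\<lambda>N. 1 / of_nat N ^ 2)"
        using recF[OF _ xi(2) \<alpha> u rest] recG[OF _ xi(2) \<alpha> u rest]
        by (intro landau_o.big.in_cong eventually_mono[OF ev])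
          (simp add: Fus Gus d_def j_def case_prod_unfold sum_list_subtractf right_diff_distrib)
      moreover have "(\<lambda>N. of_real (v N) * d N + of_real (v N) / of_nat N ^ 2 * j N) \<in> O(\<lambda>N. 1 /
          of_nat N ^ 2)"
        using vd vj by (rule sum_in_bigo)
      ultimately show ?thesis by blast
    qed
  qed
  then show "(\<lambda>N. F N us) \<in> O(\<lambda>_. 1)" "(\<lambda>N. F N us - G N us) \<in> O(\<lambda>N. 1 / of_nat N ^ 2)" by auto
qed

theorem theorem5:
  fixes k l :: nat
    and \<sigma> :: "nat \<Rightarrow> real"
    and M :: "nat \<Rightarrow> 'w measure"
    and W :: "nat \<Rightarrow> nat \<Rightarrow> 'w \<Rightarrow> complex mat"
    and A :: "nat \<Rightarrow> nat \<Rightarrow> complex mat"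
    and S :: "nat \<Rightarrow> 'a nc_space"
    and w a :: "nat \<Rightarrow> nat \<Rightarrow> 'a"
  assumes "k \<ge> 1" and "l \<ge> 1"
    and "\<And>N. N \<ge> 1 \<Longrightarrow> prob_space (M N)"
    and "\<And>N i. N \<ge> 1 \<Longrightarrow> i < k \<Longrightarrow> GUE (M N) N ((\<sigma> N)\<^sup>2) (W N i)"
    and "\<And>N. N \<ge> 1 \<Longrightarrow> indep_mats (M N) N (W N) {..<k}"
    and "(\<lambda>N. (\<sigma> N)\<^sup>2) \<in> O(\<lambda>N. 1 / real N)"
    and "\<And>N j. N \<ge> 1 \<Longrightarrow> j < l \<Longrightarrow> A N j \<in> carrier_mat N N"
    and "\<And>j. j < l \<Longrightarrow> bdd_above ((\<lambda>N. op_norm (A N j)) ` {1..})"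
    and "\<And>N. N \<ge> 1 \<Longrightarrow>
           free_product_model k l (real N * (\<sigma> N)\<^sup>2)
             (rand_star_law (M N) N (\<lambda>j _. A N j)) (S N) (w N) (a N)"
  shows "\<forall>P \<in> ncpolys {..<k + l}.
           (\<lambda>N. rand_law (M N) N (append_tuple k (W N) (\<lambda>j _. A N j)) P
                - nc_law (S N) (append_tuple k (w N) (a N)) P) \<in> O(\<lambda>N. 1 / of_nat N ^ 2)"
proof
  fix P :: "nat ncpoly" assume P: "P \<in> ncpolys {..<k + l}"
  define letters where "letters N \<omega> = append_tuple k (\<lambda>i. W N i \<omega>) (A N)" for N \<omega>
  define v where "v N = real N * (\<sigma> N)\<^sup>2" for N
  define F where "F N us = (\<integral>\<omega>. (\<Prod>u\<leftarrow>us. ntrace N (mat_word N (letters N \<omega>) u)) \<partial>M N)" for N us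
  define \<phi> where "\<phi> N = model_state k (S N) (w N) (a N)" for N
  define G where "G N us = (\<Prod>u\<leftarrow>us. \<phi> N u)" for N us
  have v0: "v N \<ge> 0" for N by (simp add: v_def)
  have ev: "eventually (\<lambda>N::nat. N \<ge> 1) at_top" by (rule eventually_ge_at_top)
  have model: "free_product_model k l (v N) (rand_star_law (M N) N (\<lambda>j _. A N j)) (S N) (w N) (a N)"
    if "N \<ge> 1" for N
    using assms(9)[OF that] by (simp add: v_def)
  have gue: "gue_words (M N) k N ((\<sigma> N)\<^sup>2) (W N) l (A N)" if "N \<ge> 1" for N
    unfolding gue_words_def gue_family_def gue_words_axioms_def gue_family_axioms_def
    using assms(3-5,7) that by simp
  have F: "F N us = (\<integral>\<omega>. gue_words.trace_prod k N (W N) (A N) us \<omega> \<partial>M N)" if "N \<ge> 1" for N us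
    unfolding F_def letters_def gue_words.trace_prod_unfold[OF gue[OF that]] ..
  have vO: "v \<in> O(\<lambda>_. 1)"
  proof -
    have "(\<lambda>N. real N * (\<sigma> N)\<^sup>2) \<in> O(\<lambda>N. real N * (1 / real N))"
      by (rule landau_o.big_mult[OF landau_o.big_refl assms(6)])
    moreover have "(\<lambda>N. real N * (1 / real N)) \<in> O(\<lambda>_. 1)"
      by (rule bigoI[of _ 1]) simp
    ultimately show ?thesis unfolding v_def[abs_def] by (rule landau_o.big.trans)
  qed
  have base: "(\<Prod>u\<leftarrow>us. ntrace N (mat_word N (letters N \<omega>) u)) = G N us"
    if N: "N \<ge> 1" and us: "set us \<subseteq> lists {k..<k + l}" for N us \<omega>
    unfolding G_def \<phi>_def letters_def
    using model_state_deterministic[OF model[OF N] assms(3)[OF N] N assms(7)[OF N]] us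
    by (intro arg_cong[of _ _ prod_list] map_cong refl) (auto simp: subset_iff)
  have FG: "F N us = G N us" if N: "N \<ge> 1" and us: "set us \<subseteq> lists {k..<k + l}" for N us
    using base[OF that] prob_space.prob_space[OF assms(3)[OF N]] by (simp add: F_def)
  have bounded: "(\<lambda>N. F N us) \<in> O(\<lambda>_. 1)" if us: "set us \<subseteq> lists {k..<k + l}" for us
  proof -
    have "\<forall>j\<in>{..<l}. \<exists>C. \<forall>N\<ge>1. op_norm (A N j) \<le> C"
    proof
      fix j assume "j \<in> {..<l}"
      then obtain C where "\<forall>x\<in>(\<lambda>N. op_norm (A N j)) ` {1..}. x \<le> C"
        using assms(8)[of j] unfolding bdd_above_def by auto
      then show "\<exists>C. \<forall>N\<ge>1. op_norm (A N j) \<le> C" by (intro exI[of _ C]) auto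
    qed
    then obtain C where C: "\<And>j N. j < l \<Longrightarrow> N \<ge> 1 \<Longrightarrow> op_norm (A N j) \<le> C j"
      by (metis lessThan_iff)
    define B where "B = (\<Sum>j<l. \<bar>C j\<bar>)"
    have CB: "C j \<le> B" if "j < l" for j
      unfolding B_def using that member_le_sum[of j "{..<l}" "\<lambda>j. \<bar>C j\<bar>"] by simp
    \<comment> \<open>Words in deterministic letters do not involve the random matrices, so the sample point is
        arbitrary.\<close>
    have trace_le: "cmod (ntrace N (mat_word N (letters N undefined) u)) \<le> B ^ length u"
      if N: "N \<ge> 1" and u: "u \<in> lists {k..<k + l}" for N u
    proof (rule ntrace_mat_word_le[OF _ N])
      fix i assume "i \<in> set u"
      then have "i \<in> {k..<k + l}" using u by auto
      then have i: "\<not> i < k" "i - k < l" by auto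
      then show "letters N undefined i \<in> carrier_mat N N \<and> op_norm (letters N undefined i) \<le> B"
        using assms(7)[OF N i(2)] order_trans[OF C[OF i(2) N] CB[OF i(2)]]
        by (simp add: letters_def append_tuple_def)
    qed
    have prod: "cmod (\<Prod>u\<leftarrow>us. ntrace N (mat_word N (letters N undefined) u)) \<le> B ^ length (concat us)"
      if N: "N \<ge> 1" and us: "set us \<subseteq> lists {k..<k + l}" for N us
      using us
    proof (induction us)
      case (Cons u us)
      have "B \<ge> 0" by (simp add: B_def sum_nonneg)
      then show ?case
        using Cons trace_le[OF N, of u] by (auto simp: norm_mult power_add intro!: mult_mono)
    qed simp
    have "cmod (F N us) \<le> B ^ length (concat us)" if "N \<ge> 1" for N
      using prod[OF that us] unfolding base[OF that us] FG[OF that us] .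
    then show ?thesis
      by (intro bigoI[of _ "B ^ length (concat us)"] eventually_mono[OF ev]) simp
  qed
  have comparison: "(\<lambda>N. F N us - G N us) \<in> O(\<lambda>N. 1 / of_nat N ^ 2)" if "set us \<subseteq> lists {..<k +
      l}" for us
  proof (rule schwinger_dyson_comparison(2)[OF vO _ _ _ _ FG bounded that])
    fix N i :: nat and \<alpha> u :: "nat list" and us :: "nat list list"
    assume *: "N \<ge> 1" "i < k" "\<alpha> \<in> lists {k..<k + l}" "u \<in> lists {..<k + l}" "set us \<subseteq> lists {..<k
        + l}"
    show "F N ((\<alpha> @ i # u) # us) = of_real (v N) * (\<Sum>(p, q)\<leftarrow>splits i u. F N (p # (\<alpha> @ q) # us)) +
        of_real (v N) / of_nat N ^ 2 * (\<Sum>zs\<leftarrow>joins i (u @ \<alpha>) us. F N zs)"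
      unfolding F[OF *(1)] v_def by (rule gue_words.schwinger_dyson_gue[OF gue[OF *(1)] *(2-5)])
    show "G N ((\<alpha> @ i # u) # us) = of_real (v N) * (\<Sum>(p, q)\<leftarrow>splits i u. G N (p # (\<alpha> @ q) # us))"
      using schwinger_dyson_model[OF model[OF *(1)] *(2) v0 *(3,4)]
      by (simp add: G_def \<phi>_def split_sum_def sum_list_mult_const[symmetric] case_prod_unfold
          mult.assoc)
  qed (simp_all add: F_def G_def mult_ac)
  have "rand_law (M N) N (append_tuple k (W N) (\<lambda>j _. A N j)) P - nc_law (S N) (append_tuple k (w
      N) (a N)) P
    = (\<Sum>u\<in>Poly_Mapping.keys P. Poly_Mapping.lookup P u * (F N [u] - G N [u]))" if N: "N \<ge> 1" for N
  proof -
    interpret gue_words "M N" k N "(\<sigma> N)\<^sup>2" "W N" l "A N" by (rule gue[OF N])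
    have S: "nc_prob_space (S N)" using model[OF N] by (simp add: free_product_model_def)
    have "append_tuple k (w N) (a N) i \<in> carrier (S N)" if "i \<in> {..<k + l}" for i
      using model[OF N] that by (auto simp: free_product_model_def append_tuple_def semicircular_def)
    then have 1: "nc_law (S N) (append_tuple k (w N) (a N)) P = lin_ext (\<lambda>u. G N [u]) P"
      using nc_prob_space.nc_law_eq_lin_ext[OF S P] by (simp add: G_def \<phi>_def model_state_def)
    have app: "(\<lambda>i. append_tuple k (W N) (\<lambda>j _. A N j) i \<omega>) = letters N \<omega>" for \<omega>
      by (auto simp: letters_def append_tuple_def)
    have "rand_law (M N) N (append_tuple k (W N) (\<lambda>j _. A N j)) P
      = (\<integral>\<omega>. (\<Sum>u\<in>Poly_Mapping.keys P. Poly_Mapping.lookup P u * trace_prod [u] \<omega>) \<partial>M N)"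
      unfolding rand_law_def app
    proof (rule Bochner_Integration.integral_cong[OF refl])
      fix \<omega> assume \<omega>: "\<omega> \<in> space (M N)"
      have "letters N \<omega> i \<in> carrier (mat_space N)" if "i \<in> {..<k + l}" for i
        using letter_mat_carrier[OF \<omega>, of i] that by (simp add: letter_mat_def letters_def
            mat_space_def)
      then have "nc_law (mat_space N) (letters N \<omega>) P = lin_ext (\<lambda>u. state (mat_space N)
          (word_eval (mat_space N) (letters N \<omega>) u)) P"
        by (rule nc_prob_space.nc_law_eq_lin_ext[OF nc_prob_space_mat_space[OF N] P])
      then show "nc_law (mat_space N) (letters N \<omega>) P = (\<Sum>u\<in>Poly_Mapping.keys P.
          Poly_Mapping.lookup P u * trace_prod [u] \<omega>)"
        by (simp add: lin_ext_def mat_space_state_word trace_prod_unfold letters_def)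
    qed
    also have "\<dots> = (\<Sum>u\<in>Poly_Mapping.keys P. Poly_Mapping.lookup P u * F N [u])"
    proof -
      have "integrable (M N) (trace_prod [u])" if "u \<in> Poly_Mapping.keys P" for u
        using P that by (intro trace_prod_integrable) (auto simp: ncpolys_def)
      then show ?thesis
        unfolding F[OF N] by (subst Bochner_Integration.integral_sum) (auto simp del:
            trace_prod_simps)
    qed
    finally show ?thesis
      unfolding 1 lin_ext_def by (simp add: sum_subtractf right_diff_distrib)
  qed
  then have "(\<lambda>N. rand_law (M N) N (append_tuple k (W N) (\<lambda>j _. A N j)) P - nc_law (S N)
      (append_tuple k (w N) (a N)) P)
      \<in> O(\<lambda>N. 1 / of_nat N ^ 2) \<longleftrightarrow>
    (\<lambda>N. \<Sum>u\<in>Poly_Mapping.keys P. Poly_Mapping.lookup P u * (F N [u] - G N [u])) \<in> O(\<lambda>N. 1 / of_nat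
        N ^ 2)"
    by (intro landau_o.big.in_cong eventually_mono[OF ev])
  also have "\<dots>"
  proof (rule big_sum_in_bigo)
    fix u assume "u \<in> Poly_Mapping.keys P"
    then have "set [u] \<subseteq> lists {..<k + l}" using P by (auto simp: ncpolys_def)
    from comparison[OF this] show "(\<lambda>N. Poly_Mapping.lookup P u * (F N [u] - G N [u])) \<in> O(\<lambda>N. 1 /
        of_nat N ^ 2)"
      by simp
  qed
  finally show "(\<lambda>N. rand_law (M N) N (append_tuple k (W N) (\<lambda>j _. A N j)) P
      - nc_law (S N) (append_tuple k (w N) (a N)) P) \<in> O(\<lambda>N. 1 / of_nat N ^ 2)" .
qed

end
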